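(* There exists an absolute constant $C>0$ (independent of $d,\rho,\tau,F$ and the triangulation) such that the following holds. Let $d\ge1$, let $\Omega\subset\mathbb{R}^d$ be a bounded polyhedral domain, and let $\mathcal{T}_h$ be a $\rho$-shape-regular triangulation of $\Omega$. Then for any $\tau\in\mathcal{T}_h$ and any $(d-1)$-dimensional face $F$ of $\tau$, $$\|v\|_{L^2(F)}\le C\left(\rho^{1/2}d^{1/2}h_\tau^{-1/2}\|v\|_{L^2(\tau)}+\rho^{1/2}d^{-1/2}h_\tau^{1/2}|v|_{H^1(\tau)}\right),\qquad v\in H^1(\tau).$$
   Context: A triangulation $\mathcal{T}_h$ of $\Omega$ is a finite conforming collection of pairwise disjoint open $d$-simplices whose closures have union $\overline\Omega$. For a $d$-simplex $\tau$, $h_\tau$ is its diameter and $r_\tau$ its inradius. $\mathcal{T}_h$ is $\rho$-shape-regular ($\rho>0$) if $h_\tau\le\rho\,r_\tau$ for all $\tau\in\mathcal{T}_h$. $|v|_{H^1(\tau)}=\|\nabla v\|_{L^2(\tau)}$; $v$ on $F$ is understood as the trace. *)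

theory Defs
  imports "HOL-Analysis.Analysis"
begin

section \<open>Euclidean spaces of variable dimension\<close>

text \<open>
  The constant of the theorem must not depend on the dimension, so the dimension has to be a
  bound natural number and cannot be a type. All the spaces \<open>\<real>\<^sup>d\<close> are therefore realised inside
  one type, the finitely supported real sequences with the \<^emph>\<open>Euclidean\<close> inner product;
  \<open>\<real>\<^sup>d\<close> is the subspace \<open>Rn d\<close> of sequences supported in \<open>{..<d}\<close>.
  (The existing normed structure on \<open>nat \<Rightarrow>\<^sub>0 real\<close> carries the \<open>\<ell>\<^sub>1\<close> norm and is not usable here.)
\<close>

typedef fvec = "{f :: nat \<Rightarrow> real. finite {i. f i \<noteq> 0}}"
  morphisms coord Abs_fvec
  by (rule exI[of _ "\<lambda>_. 0"]) simp

setup_lifting type_definition_fvec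

lemma finite_coord: "finite {i. coord x i \<noteq> 0}"
  using coord[of x] by simp

instantiation fvec :: real_vector
begin

lift_definition zero_fvec :: fvec is "\<lambda>_. 0" by simp

lift_definition plus_fvec :: "fvec \<Rightarrow> fvec \<Rightarrow> fvec" is "\<lambda>f g i. f i + g i"
  subgoal for f g by (rule finite_subset[of _ "{i. f i \<noteq> 0} \<union> {i. g i \<noteq> 0}"]) auto
  done

lift_definition minus_fvec :: "fvec \<Rightarrow> fvec \<Rightarrow> fvec" is "\<lambda>f g i. f i - g i"
  subgoal for f g by (rule finite_subset[of _ "{i. f i \<noteq> 0} \<union> {i. g i \<noteq> 0}"]) auto
  done

lift_definition uminus_fvec :: "fvec \<Rightarrow> fvec" is "\<lambda>f i. - f i" by simp

lift_definition scaleR_fvec :: "real \<Rightarrow> fvec \<Rightarrow> fvec" is "\<lambda>c f i. c * f i"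
  subgoal for c f by (rule finite_subset[of _ "{i. f i \<noteq> 0}"]) auto
  done

instance
  by standard (transfer; simp add: algebra_simps)+

end

lemma coord_zero [simp]: "coord 0 i = 0"
  and coord_add [simp]: "coord (x + y) i = coord x i + coord y i"
  and coord_diff [simp]: "coord (x - y) i = coord x i - coord y i"
  and coord_minus [simp]: "coord (- x) i = - coord x i"
  and coord_scaleR [simp]: "coord (c *\<^sub>R x) i = c * coord x i"
  by (transfer; simp)+

lemma fvec_eq_iff: "x = y \<longleftrightarrow> (\<forall>i. coord x i = coord y i)"
  by (auto simp: coord_inject[symmetric])

instantiation fvec :: real_normed_vector
begin

definition norm_fvec :: "fvec \<Rightarrow> real" where
  "norm x = L2_set (coord x) {i. coord x i \<noteq> 0}"

definition sgn_fvec :: "fvec \<Rightarrow> fvec" where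
  "sgn (x :: fvec) = x /\<^sub>R norm x"

definition dist_fvec :: "fvec \<Rightarrow> fvec \<Rightarrow> real" where
  "dist (x :: fvec) y = norm (x - y)"

definition uniformity_fvec :: "(fvec \<times> fvec) filter" where
  "(uniformity :: (fvec \<times> fvec) filter) = (INF e\<in>{0<..}. principal {(x, y). dist x y < e})"

definition open_fvec :: "fvec set \<Rightarrow> bool" where
  "open (U :: fvec set) \<longleftrightarrow> (\<forall>x\<in>U. \<forall>\<^sub>F (x', y) in uniformity. x' = x \<longrightarrow> y \<in> U)"

lemma norm_fvec_superset:
  assumes "finite A" "{i. coord x i \<noteq> 0} \<subseteq> A"
  shows "norm x = L2_set (coord x) A"
  unfolding norm_fvec_def L2_set_def using assms
  by (intro arg_cong[where f = sqrt] sum.mono_neutral_left) auto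

instance
proof
  fix x y :: fvec and r :: real and U :: "fvec set"
  define A where "A = {i. coord x i \<noteq> 0} \<union> {i. coord y i \<noteq> 0}"
  have A: "finite A" "{i. coord x i \<noteq> 0} \<subseteq> A" "{i. coord y i \<noteq> 0} \<subseteq> A"
    "{i. coord (x + y) i \<noteq> 0} \<subseteq> A" "{i. coord (r *\<^sub>R x) i \<noteq> 0} \<subseteq> A"
    by (auto simp: A_def finite_coord)
  show "norm (x + y) \<le> norm x + norm y"
    using L2_set_triangle_ineq[of "coord x" "coord y" A]
    by (simp add: norm_fvec_superset[OF A(1) A(2)] norm_fvec_superset[OF A(1) A(3)]
        norm_fvec_superset[OF A(1) A(4)] L2_set_def)
  show "norm (r *\<^sub>R x) = \<bar>r\<bar> * norm x"
    by (simp add: norm_fvec_superset[OF A(1) A(2)] norm_fvec_superset[OF A(1) A(5)] L2_set_def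
        power_mult_distrib real_sqrt_mult sum_distrib_left[symmetric])
  show "norm x = 0 \<longleftrightarrow> x = 0"
    by (auto simp: norm_fvec_def L2_set_def sum_nonneg_eq_0_iff finite_coord fvec_eq_iff)
  show "sgn x = x /\<^sub>R norm x" by (rule sgn_fvec_def)
  show "dist x y = norm (x - y)" by (rule dist_fvec_def)
  show "(uniformity :: (fvec \<times> fvec) filter) = (INF e\<in>{0<..}. principal {(x, y). dist x y < e})"
    by (rule uniformity_fvec_def)
  show "open U \<longleftrightarrow> (\<forall>x\<in>U. \<forall>\<^sub>F (x', y) in uniformity. x' = x \<longrightarrow> y \<in> U)"
    by (rule open_fvec_def)
qed

end

instantiation fvec :: real_inner
begin

definition inner_fvec :: "fvec \<Rightarrow> fvec \<Rightarrow> real" where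
  "x \<bullet> y = (\<Sum>i | coord x i \<noteq> 0. coord x i * coord y i)"

lemma inner_fvec_superset:
  assumes "finite A" "{i. coord x i \<noteq> 0} \<subseteq> A"
  shows "x \<bullet> y = (\<Sum>i\<in>A. coord x i * coord y i)"
  unfolding inner_fvec_def using assms by (intro sum.mono_neutral_left) auto

instance
proof
  fix x y z :: fvec and r :: real
  define A where "A = {i. coord x i \<noteq> 0} \<union> {i. coord y i \<noteq> 0}"
  have A: "finite A" "{i. coord x i \<noteq> 0} \<subseteq> A" "{i. coord y i \<noteq> 0} \<subseteq> A"
    "{i. coord (x + y) i \<noteq> 0} \<subseteq> A" "{i. coord (r *\<^sub>R x) i \<noteq> 0} \<subseteq> A"
    by (auto simp: A_def finite_coord)
  show "x \<bullet> y = y \<bullet> x"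
    by (simp add: inner_fvec_superset[OF A(1) A(2)] inner_fvec_superset[OF A(1) A(3)] mult.commute)
  show "(x + y) \<bullet> z = x \<bullet> z + y \<bullet> z"
    by (simp add: inner_fvec_superset[OF A(1) A(2)] inner_fvec_superset[OF A(1) A(3)]
        inner_fvec_superset[OF A(1) A(4)] algebra_simps sum.distrib)
  show "(r *\<^sub>R x) \<bullet> y = r * (x \<bullet> y)"
    by (simp add: inner_fvec_superset[OF A(1) A(2)] inner_fvec_superset[OF A(1) A(5)]
        sum_distrib_left mult.assoc)
  show "0 \<le> x \<bullet> x"
    by (simp add: inner_fvec_def sum_nonneg)
  show "x \<bullet> x = 0 \<longleftrightarrow> x = 0"
    by (auto simp: inner_fvec_def sum_nonneg_eq_0_iff finite_coord fvec_eq_iff)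
  show "norm x = sqrt (x \<bullet> x)"
    by (simp add: norm_fvec_def inner_fvec_def L2_set_def power2_eq_square)
qed

end

definition Rn :: "nat \<Rightarrow> fvec set" where
  "Rn d = {x. \<forall>i\<ge>d. coord x i = 0}"

lift_definition unit_vec :: "nat \<Rightarrow> fvec" is "\<lambda>i j. if j = i then 1 else 0" by simp

text \<open>Borel and Lebesgue measure on \<open>Rn d\<close>; for \<open>d = 0\<close> this is the unit mass at the origin.\<close>

definition lborel_Rn :: "nat \<Rightarrow> fvec measure" where
  "lborel_Rn d = distr (\<Pi>\<^sub>M i\<in>{..<d}. lborel) (restrict_space borel (Rn d))
     (\<lambda>x. \<Sum>i<d. x i *\<^sub>R unit_vec i)"

lemma coord_sum: "coord (sum f A) j = (\<Sum>i\<in>A. coord (f i) j)"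
  by (induction A rule: infinite_finite_induct) auto
lemma measurable_Rn_embedding: "(\<lambda>x. \<Sum>i<d. x i *\<^sub>R unit_vec i) \<in> (\<Pi>\<^sub>M i\<in>{..<d}. lborel) \<rightarrow>\<^sub>M restrict_space borel (Rn d)"
proof (rule measurable_restrict_space2)
  show "(\<lambda>x. \<Sum>i<d. x i *\<^sub>R unit_vec i) \<in> space (\<Pi>\<^sub>M i\<in>{..<d}. lborel) \<rightarrow> Rn d"
    by (auto simp: Rn_def coord_sum unit_vec.rep_eq)
  have 1: "(\<lambda>x::nat\<Rightarrow>real. \<Sum>i<d. x i *\<^sub>R unit_vec i) \<in> borel \<rightarrow>\<^sub>M borel"
    by (intro borel_measurable_continuous_onI continuous_intros) auto
  have 2: "(\<lambda>x::nat\<Rightarrow>real. (\<lambda>i. if i < d then x i else 0)) \<in> (\<Pi>\<^sub>M i\<in>{..<d}. lborel) \<rightarrow>\<^sub>M borel"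
    unfolding measurable_cong_sets[OF refl sets_PiM_equal_borel[symmetric]]
    apply (rule measurable_PiM_single')
    subgoal for i by (cases "i < d") (auto)
    by (auto)
  show "(\<lambda>x. \<Sum>i<d. x i *\<^sub>R unit_vec i) \<in> (\<Pi>\<^sub>M i\<in>{..<d}. lborel) \<rightarrow>\<^sub>M borel"
    using measurable_compose[OF 2 1] by simp
qed

definition lebesgue_Rn :: "nat \<Rightarrow> fvec measure" where
  "lebesgue_Rn d = completion (lborel_Rn d)"


section \<open>Simplices and triangulations\<close>

text \<open>
  Open \<open>d\<close>-simplices in \<open>Rn d\<close>. Since \<open>d + 1\<close> affinely independent points of \<open>Rn d\<close> have affine
  hull \<open>Rn d\<close>, the relative interior is the interior with respect to \<open>Rn d\<close>.
\<close>

definition open_simplex :: "nat \<Rightarrow> fvec set \<Rightarrow> bool" where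
  "open_simplex d \<tau> \<longleftrightarrow>
     (\<exists>P \<subseteq> Rn d. card P = d + 1 \<and> \<not> affine_dependent P \<and> \<tau> = rel_interior (convex hull P))"

text \<open>
  Faces of codimension one, as in \<^const>\<open>facet_of\<close>; that constant and \<^const>\<open>aff_dim\<close> need a
  type of class \<^class>\<open>euclidean_space\<close>. The second condition says that \<open>F\<close> has affine
  dimension \<open>d - 1\<close>.
\<close>

definition simplex_facet :: "nat \<Rightarrow> fvec set \<Rightarrow> fvec set \<Rightarrow> bool" where
  "simplex_facet d \<tau> F \<longleftrightarrow> F face_of closure \<tau> \<and>
     (\<exists>B. affine hull B = affine hull F \<and> \<not> affine_dependent B \<and> card B = d)"

definition inradius :: "nat \<Rightarrow> fvec set \<Rightarrow> real" where
  "inradius d \<tau> = Sup {r. 0 < r \<and> (\<exists>x\<in>Rn d. ball x r \<inter> Rn d \<subseteq> \<tau>)}"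

definition polyhedral_domain :: "nat \<Rightarrow> fvec set \<Rightarrow> bool" where
  "polyhedral_domain d \<Omega> \<longleftrightarrow>
     \<Omega> \<noteq> {} \<and> \<Omega> \<subseteq> Rn d \<and> openin (top_of_set (Rn d)) \<Omega> \<and> connected \<Omega> \<and>
     (\<exists>\<P>. finite \<P> \<and> (\<forall>K\<in>\<P>. polytope K) \<and> closure \<Omega> = \<Union>\<P>)"

text \<open>
  Conformity: the closures of any two elements meet in a common face. The empty set is a face
  in the sense of \<^const>\<open>face_of\<close>.
\<close>

definition triangulation_of :: "nat \<Rightarrow> fvec set \<Rightarrow> fvec set set \<Rightarrow> bool" where
  "triangulation_of d \<Omega> \<T> \<longleftrightarrow>
     finite \<T> \<and> (\<forall>\<tau>\<in>\<T>. open_simplex d \<tau>) \<and> disjoint \<T> \<and>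
     (\<forall>\<tau>\<in>\<T>. \<forall>\<tau>'\<in>\<T>. closure \<tau> \<inter> closure \<tau>' face_of closure \<tau> \<and>
                        closure \<tau> \<inter> closure \<tau>' face_of closure \<tau>') \<and>
     (\<Union>\<tau>\<in>\<T>. closure \<tau>) = closure \<Omega>"

definition shape_regular :: "nat \<Rightarrow> real \<Rightarrow> fvec set set \<Rightarrow> bool" where
  "shape_regular d \<rho> \<T> \<longleftrightarrow> \<rho> > 0 \<and> (\<forall>\<tau>\<in>\<T>. diameter \<tau> \<le> \<rho> * inradius d \<tau>)"


section \<open>Function spaces and traces\<close>

text \<open>Functions represent their classes modulo null sets.\<close>

definition in_L2 :: "fvec measure \<Rightarrow> fvec set \<Rightarrow> (fvec \<Rightarrow> real) \<Rightarrow> bool" where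
  "in_L2 M S f \<longleftrightarrow> set_borel_measurable M S f \<and> set_integrable M S (\<lambda>x. (f x)\<^sup>2)"

definition L2_norm :: "fvec measure \<Rightarrow> fvec set \<Rightarrow> (fvec \<Rightarrow> real) \<Rightarrow> real" where
  "L2_norm M S f = sqrt (LINT x:S|M. (f x)\<^sup>2)"

definition partial :: "nat \<Rightarrow> (fvec \<Rightarrow> real) \<Rightarrow> fvec \<Rightarrow> real" where
  "partial i f x = deriv (\<lambda>t. f (x + t *\<^sub>R unit_vec i)) 0"

definition grad :: "nat \<Rightarrow> (fvec \<Rightarrow> real) \<Rightarrow> fvec \<Rightarrow> fvec" where
  "grad d f x = (\<Sum>i<d. partial i f x *\<^sub>R unit_vec i)"

text \<open>\<open>f\<close> is \<open>C\<^sup>\<infinity>\<close> on \<open>Rn d\<close>: all iterated partial derivatives exist and are continuous.\<close>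

definition smooth :: "nat \<Rightarrow> (fvec \<Rightarrow> real) \<Rightarrow> bool" where
  "smooth d f \<longleftrightarrow> (\<forall>is\<in>lists {..<d}.
     continuous_on (Rn d) (foldr partial is f) \<and>
     (\<forall>i<d. \<forall>x\<in>Rn d. (\<lambda>t. foldr partial is f (x + t *\<^sub>R unit_vec i)) differentiable at 0))"

definition test_function :: "nat \<Rightarrow> fvec set \<Rightarrow> (fvec \<Rightarrow> real) \<Rightarrow> bool" where
  "test_function d U \<phi> \<longleftrightarrow> smooth d \<phi> \<and>
     (\<exists>K. compact K \<and> K \<subseteq> U \<and> (\<forall>x\<in>Rn d - K. \<phi> x = 0))"

definition has_weak_grad :: "nat \<Rightarrow> fvec set \<Rightarrow> (fvec \<Rightarrow> real) \<Rightarrow> (fvec \<Rightarrow> fvec) \<Rightarrow> bool" where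
  "has_weak_grad d U v G \<longleftrightarrow>
     (\<forall>x. G x \<in> Rn d) \<and>
     (\<forall>i<d. in_L2 (lebesgue_Rn d) U (\<lambda>x. coord (G x) i)) \<and>
     (\<forall>\<phi>. test_function d U \<phi> \<longrightarrow> (\<forall>i<d.
        (LINT x:U|lebesgue_Rn d. v x * partial i \<phi> x) =
        - (LINT x:U|lebesgue_Rn d. coord (G x) i * \<phi> x)))"

definition in_H1 :: "nat \<Rightarrow> fvec set \<Rightarrow> (fvec \<Rightarrow> real) \<Rightarrow> bool" where
  "in_H1 d U v \<longleftrightarrow> in_L2 (lebesgue_Rn d) U v \<and> (\<exists>G. has_weak_grad d U v G)"

definition weak_grad :: "nat \<Rightarrow> fvec set \<Rightarrow> (fvec \<Rightarrow> real) \<Rightarrow> fvec \<Rightarrow> fvec" where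
  "weak_grad d U v = (SOME G. has_weak_grad d U v G)"

definition H1_seminorm :: "nat \<Rightarrow> fvec set \<Rightarrow> (fvec \<Rightarrow> real) \<Rightarrow> real" where
  "H1_seminorm d U v = L2_norm (lebesgue_Rn d) U (\<lambda>x. norm (weak_grad d U v x))"

text \<open>
  Surface measure on the hyperplane spanned by a facet \<open>F\<close>: \<open>(d - 1)\<close>-dimensional Lebesgue
  measure transported by an isometry of \<open>Rn (d - 1)\<close> onto the hyperplane. Lebesgue measure is
  invariant under isometries, so the choice does not matter. For \<open>d = 1\<close> it is the
  unit mass at the point \<open>F\<close>.
\<close>

definition isometry_onto :: "nat \<Rightarrow> fvec set \<Rightarrow> (fvec \<Rightarrow> fvec) \<Rightarrow> bool" where
  "isometry_onto k H \<phi> \<longleftrightarrow>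
     \<phi> ` Rn k = H \<and> (\<forall>x\<in>Rn k. \<forall>y\<in>Rn k. dist (\<phi> x) (\<phi> y) = dist x y)"

definition surface_measure :: "nat \<Rightarrow> fvec set \<Rightarrow> fvec measure" where
  "surface_measure d F = completion
     (distr (lborel_Rn (d - 1)) (restrict_space borel (affine hull F))
        (SOME \<phi>. isometry_onto (d - 1) (affine hull F) \<phi>))"

text \<open>
  The trace is the \<open>L\<^sup>2(F)\<close>-limit of the restrictions to \<open>F\<close> of functions smooth up to
  the boundary that converge to \<open>v\<close> in \<open>H\<^sup>1(\<tau>)\<close>, i.e. the value at \<open>v\<close> of the continuous extension to
  \<open>H\<^sup>1(\<tau>)\<close> of the restriction operator \<open>u \<mapsto> u|\<^sub>F\<close>.
\<close>

definition is_trace ::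
  "nat \<Rightarrow> fvec set \<Rightarrow> fvec set \<Rightarrow> (fvec \<Rightarrow> real) \<Rightarrow> (fvec \<Rightarrow> real) \<Rightarrow> bool" where
  "is_trace d \<tau> F v w \<longleftrightarrow> in_L2 (surface_measure d F) F w \<and>
     (\<exists>u :: nat \<Rightarrow> fvec \<Rightarrow> real. (\<forall>k. smooth d (u k)) \<and>
        (\<lambda>k. L2_norm (lebesgue_Rn d) \<tau> (\<lambda>x. u k x - v x)) \<longlonglongrightarrow> 0 \<and>
        (\<lambda>k. L2_norm (lebesgue_Rn d) \<tau> (\<lambda>x. norm (grad d (u k) x - weak_grad d \<tau> v x))) \<longlonglongrightarrow> 0 \<and>
        (\<lambda>k. L2_norm (surface_measure d F) F (\<lambda>x. u k x - w x)) \<longlonglongrightarrow> 0)"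

definition trace_on :: "nat \<Rightarrow> fvec set \<Rightarrow> fvec set \<Rightarrow> (fvec \<Rightarrow> real) \<Rightarrow> fvec \<Rightarrow> real" where
  "trace_on d \<tau> F v = (SOME w. is_trace d \<tau> F v w)"

end

theory Submission
  imports Defs
begin

text \<open>
  View the simplex as a cone of height \<open>D\<close> with apex \<open>a\<close> over the facet \<open>F\<close>. For smooth \<open>u\<close> and
  \<open>y \<in> F\<close>, integrating the derivative of \<open>t\<^sup>d u(a + t (y - a))\<^sup>2\<close> over \<open>0 \<le> t \<le> 1\<close> and then over \<open>F\<close>
  gives \<open>D \<parallel>u\<parallel>\<^sup>2 \<le> 2 d \<parallel>u\<parallel>\<^sup>2 + h\<^sup>2 / d \<parallel>\<nabla>u\<parallel>\<^sup>2\<close>, with the norm over \<open>F\<close> on the left and those over \<open>\<tau>\<close>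
  on the right; \<open>D\<close> is at least the inradius, hence at least \<open>h / \<rho>\<close>.
  The trace is only a limit, so its existence is part of the claim: functions in \<open>H\<^sup>1(\<tau>)\<close> are
  dilated about an interior point and mollified, which approximates them by smooth functions, and by
  the inequality for smooth functions the restrictions to \<open>F\<close> form a Cauchy sequence in \<open>L\<^sup>2(F)\<close>.
  Invariance of Lebesgue measure under isometries of \<open>Rn d\<close>, needed to slice the cone parallel to \<open>F\<close>,
  follows from the uniqueness of translation invariant measures.
\<close>


section \<open>Lebesgue measure on \<open>Rn d\<close>\<close>

text \<open>Since the dimension is a variable, the ambient space \<open>fvec\<close> is infinite
  dimensional: closed bounded sets need not be compact, and the basic facts about Lebesgue measure
  on \<open>Rn d\<close> are obtained by induction on \<open>d\<close>, one coordinate at a time.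
  The change of variables behind the cone is composed of translations, homotheties and linear
  isometries. The powers of d come from one choice. Differentiating t^d gives the term d u^2, and
  Young's inequality for 2 u (x - a) . grad u is applied with weight d, so that it costs another d
  u^2 and leaves |x - a|^2 |grad u|^2 / d. The resulting factors are sqrt(2 d / D) and h / sqrt(d
  D); with 1 / D \<le> \<rho> / h the constant 2 majorises both sqrt 2 and 1.
  \<open>trace_on\<close> is a \<open>SOME\<close>, so the inequality is proved for every function
  satisfying \<open>is_trace\<close>. Elements of H^1 are measurable only for the completed measure,
  whereas Tonelli runs over Borel sets; they are replaced by Borel representatives before
  mollifying.\<close>

lemma coord_unit_vec [simp]: "coord (unit_vec i) j = (if j = i then 1 else 0)"
  by (simp add: unit_vec.rep_eq)

lemma Rn_subspace: "subspace (Rn d)"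
  by (auto simp: subspace_def Rn_def)

lemma Rn_closure [simp]:
  "0 \<in> Rn d"
  "x \<in> Rn d \<Longrightarrow> y \<in> Rn d \<Longrightarrow> x + y \<in> Rn d"
  "x \<in> Rn d \<Longrightarrow> y \<in> Rn d \<Longrightarrow> x - y \<in> Rn d"
  "x \<in> Rn d \<Longrightarrow> c *\<^sub>R x \<in> Rn d"
  "x \<in> Rn d \<Longrightarrow> - x \<in> Rn d"
  "i < d \<Longrightarrow> unit_vec i \<in> Rn d"
  by (auto simp: Rn_def)

lemma Rn_sum [simp]: "(\<And>i. i \<in> A \<Longrightarrow> f i \<in> Rn d) \<Longrightarrow> sum f A \<in> Rn d"
  by (simp add: Rn_subspace subspace_sum)

lemma Rn_mono: "m \<le> n \<Longrightarrow> Rn m \<subseteq> Rn n"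
  by (auto simp: Rn_def)

lemma Rn_Suc: "x \<in> Rn d \<Longrightarrow> x \<in> Rn (Suc d)"
  by (auto simp: Rn_def)

lemma Rn_0 [simp]: "Rn 0 = {0}"
  by (auto simp: Rn_def fvec_eq_iff)

lemma Rn_expand: "x \<in> Rn d \<Longrightarrow> x = (\<Sum>i<d. coord x i *\<^sub>R unit_vec i)"
  by (auto simp: fvec_eq_iff coord_sum Rn_def if_distrib cong: if_cong)

lemma inner_Rn: "x \<in> Rn d \<Longrightarrow> x \<bullet> y = (\<Sum>i<d. coord x i * coord y i)"
  by (rule inner_fvec_superset) (auto simp: Rn_def not_le[symmetric])

lemma norm_Rn: "x \<in> Rn d \<Longrightarrow> norm x = sqrt (\<Sum>i<d. (coord x i)\<^sup>2)"
  by (simp add: norm_eq_sqrt_inner inner_Rn power2_eq_square)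

lemma norm_unit_vec [simp]: "norm (unit_vec i) = 1"
  using norm_Rn[of "unit_vec i" "Suc i"] by simp

lemma inner_unit_vec [simp]: "unit_vec i \<bullet> x = coord x i" "x \<bullet> unit_vec i = coord x i"
proof -
  show "unit_vec i \<bullet> x = coord x i"
    using inner_Rn[of "unit_vec i" "Suc i" x] by simp
  then show "x \<bullet> unit_vec i = coord x i" by (simp add: inner_commute)
qed

lemma abs_coord_le_norm: "\<bar>coord x i\<bar> \<le> norm x"
  using Cauchy_Schwarz_ineq2[of "unit_vec i" x] by simp

lemma norm_le_sum_coord: "x \<in> Rn d \<Longrightarrow> norm x \<le> (\<Sum>i<d. \<bar>coord x i\<bar>)"
  by (subst Rn_expand, assumption) (rule sum_norm_le, simp)

lemma bounded_linear_coord: "bounded_linear (\<lambda>x. coord x i)"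
  by (rule bounded_linear_intro[of _ 1]) (auto simp: abs_coord_le_norm)

lemmas continuous_on_coord [continuous_intros] = bounded_linear.continuous_on[OF bounded_linear_coord]

lemma borel_measurable_coord [measurable]: "(\<lambda>x. coord x i) \<in> borel_measurable borel"
  by (intro borel_measurable_continuous_onI continuous_intros)

section \<open>Borel measurability on \<open>Rn d\<close>\<close>

lemma space_lborel_Rn [simp]: "space (lborel_Rn d) = Rn d"
  by (simp add: lborel_Rn_def space_restrict_space)

lemma sets_lborel_Rn: "sets (lborel_Rn d) = sets (restrict_space borel (Rn d))"
  by (simp add: lborel_Rn_def)

lemma measurable_coord_Rn [measurable]: "(\<lambda>x. coord x i) \<in> borel_measurable (lborel_Rn d)"
  unfolding measurable_cong_sets[OF sets_lborel_Rn refl]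
  by (rule measurable_restrict_space1) simp

text \<open>A map into \<open>Rn d\<close> is the embedding of its coordinate tuple, so
  measurability can be tested coordinatewise. Most maps between the spaces \<open>Rn d\<close> below
  are shown to be measurable in this way.\<close>

lemma measurable_into_restrict_Rn:
  assumes "\<And>x. x \<in> space N \<Longrightarrow> f x \<in> Rn d"
    and "\<And>i. i < d \<Longrightarrow> (\<lambda>x. coord (f x) i) \<in> borel_measurable N"
  shows "f \<in> N \<rightarrow>\<^sub>M restrict_space borel (Rn d)"
proof -
  have "(\<lambda>x. \<lambda>i\<in>{..<d}. coord (f x) i) \<in> N \<rightarrow>\<^sub>M (\<Pi>\<^sub>M i\<in>{..<d}. lborel)"
    using assms(2) by (intro measurable_restrict) auto
  from measurable_compose[OF this measurable_Rn_embedding]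
  have "(\<lambda>x. \<Sum>i<d. coord (f x) i *\<^sub>R unit_vec i) \<in> N \<rightarrow>\<^sub>M restrict_space borel (Rn d)"
    by simp
  then show ?thesis
    by (subst measurable_cong) (use assms(1) in \<open>auto intro: Rn_expand\<close>)
qed

lemma measurable_into_Rn:
  assumes "\<And>x. x \<in> space N \<Longrightarrow> f x \<in> Rn d"
    and "\<And>i. i < d \<Longrightarrow> (\<lambda>x. coord (f x) i) \<in> borel_measurable N"
  shows "f \<in> N \<rightarrow>\<^sub>M lborel_Rn d"
  unfolding measurable_cong_sets[OF refl sets_lborel_Rn]
  by (rule measurable_into_restrict_Rn) (use assms in auto)

lemma continuous_on_imp_measurable_Rn:
  fixes f :: "fvec \<Rightarrow> 'a::topological_space"
  assumes "continuous_on (Rn d) f"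
  shows "f \<in> borel_measurable (lborel_Rn d)"
  unfolding measurable_cong_sets[OF sets_lborel_Rn refl]
  by (rule borel_measurable_continuous_on_restrict[OF assms])

lemma sigma_finite_lborel: "product_sigma_finite (\<lambda>i::nat. lborel :: real measure)"
  by (simp add: product_sigma_finite_def sigma_finite_lborel)

section \<open>Tonelli in the last coordinate and the invariances that follow from it\<close>

lemma nn_integral_lborel_Rn:
  assumes "f \<in> borel_measurable (lborel_Rn d)"
  shows "(\<integral>\<^sup>+x. f x \<partial>lborel_Rn d) = (\<integral>\<^sup>+x. f (\<Sum>i<d. x i *\<^sub>R unit_vec i) \<partial>(\<Pi>\<^sub>M i\<in>{..<d}. lborel))"
  using assms unfolding lborel_Rn_def
  by (subst nn_integral_distr) (auto intro: measurable_Rn_embedding)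

lemma nn_integral_lborel_Rn_0: 
  assumes "f \<in> borel_measurable (lborel_Rn 0)"
  shows "(\<integral>\<^sup>+x. f x \<partial>lborel_Rn 0) = f 0"
  by (simp add: nn_integral_lborel_Rn[OF assms] product_sigma_finite.nn_integral_empty[OF sigma_finite_lborel]
     product_sigma_finite.emeasure_PiM[OF sigma_finite_lborel, of "{}" "\<lambda>_. UNIV", simplified] space_PiM_empty)

lemma measurable_add_unit_vec: 
   "(\<lambda>(x, s). x + s *\<^sub>R unit_vec d) \<in> lborel_Rn d \<Otimes>\<^sub>M borel \<rightarrow>\<^sub>M lborel_Rn (Suc d)"
  by (rule measurable_into_Rn) (auto simp: space_pair_measure split_beta Rn_Suc)

text \<open>Tonelli for the product over \<open>insert d {..<d}\<close>. It is the induction step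
  for translations, scalings and products of one-variable functions, and later the point where the
  normal direction is split off when a simplex is sliced.\<close>

lemma nn_integral_lborel_Rn_Suc:
  assumes f: "f \<in> borel_measurable (lborel_Rn (Suc d))"
  shows "(\<integral>\<^sup>+x. f x \<partial>lborel_Rn (Suc d)) = (\<integral>\<^sup>+x. \<integral>\<^sup>+s. f (x + s *\<^sub>R unit_vec d) \<partial>lborel \<partial>lborel_Rn d)"
proof -
  interpret product_sigma_finite "\<lambda>i::nat. lborel :: real measure" by (rule sigma_finite_lborel)
  have m: "(\<lambda>x. f (\<Sum>i<Suc d. x i *\<^sub>R unit_vec i)) \<in> borel_measurable (\<Pi>\<^sub>M i\<in>insert d {..<d}. lborel)"
    using measurable_compose[OF measurable_Rn_embedding, of f "Suc d" borel] f 
    by (simp add: measurable_cong_sets[OF sets_lborel_Rn refl] lessThan_Suc)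
  have m2: "(\<lambda>p. f (fst p + snd p *\<^sub>R unit_vec d)) \<in> borel_measurable (lborel_Rn d \<Otimes>\<^sub>M borel)"
    using measurable_compose[OF measurable_add_unit_vec f] by (simp add: split_beta)
  have "(\<integral>\<^sup>+x. f x \<partial>lborel_Rn (Suc d)) = (\<integral>\<^sup>+x. f (\<Sum>i<Suc d. x i *\<^sub>R unit_vec i) \<partial>(\<Pi>\<^sub>M i\<in>insert d {..<d}. lborel))"
    by (simp only: nn_integral_lborel_Rn[OF f] lessThan_Suc)
  also have "\<dots> = (\<integral>\<^sup>+x. \<integral>\<^sup>+s. f (\<Sum>i<Suc d. (x(d := s)) i *\<^sub>R unit_vec i) \<partial>lborel \<partial>(\<Pi>\<^sub>M i\<in>{..<d}. lborel))"
    by (subst product_nn_integral_insert) (use m in auto)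
  also have "\<dots> = (\<integral>\<^sup>+x. \<integral>\<^sup>+s. f ((\<Sum>i<d. x i *\<^sub>R unit_vec i) + s *\<^sub>R unit_vec d) \<partial>lborel \<partial>(\<Pi>\<^sub>M i\<in>{..<d}. lborel))"
    by (intro nn_integral_cong arg_cong[where f = f]) (auto intro!: sum.cong)
  also have "\<dots> = (\<integral>\<^sup>+x. \<integral>\<^sup>+s. f (x + s *\<^sub>R unit_vec d) \<partial>lborel \<partial>lborel_Rn d)"
    by (rule nn_integral_lborel_Rn[symmetric])
      (use m2 in \<open>auto intro!: lborel.borel_measurable_nn_integral simp: split_beta cong: measurable_cong_sets\<close>)
  finally show ?thesis .
qed

lemma nn_integral_translate_lborel:
  "f \<in> borel_measurable borel \<Longrightarrow> (\<integral>\<^sup>+s. f (a + s) \<partial>lborel) = (\<integral>\<^sup>+s. f (s::real) \<partial>lborel)"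
  using nn_integral_real_affine[of f 1 a] by simp

lemma measurable_translate_Rn: "a \<in> Rn d \<Longrightarrow> (\<lambda>x. a + x) \<in> lborel_Rn d \<rightarrow>\<^sub>M lborel_Rn d"
  by (rule measurable_into_Rn) auto
lemma measurable_scale_Rn: "(\<lambda>x. c *\<^sub>R x) \<in> lborel_Rn d \<rightarrow>\<^sub>M lborel_Rn d"
  by (rule measurable_into_Rn) auto

text \<open>Induction on \<open>d\<close>: the shift splits into its part in \<open>Rn d\<close>,
  handled by the induction hypothesis, and its last coordinate, handled by translation invariance on
  the real line.\<close>

lemma nn_integral_translate_Rn:
  assumes "a \<in> Rn d" "f \<in> borel_measurable (lborel_Rn d)"
  shows "(\<integral>\<^sup>+x. f (a + x) \<partial>lborel_Rn d) = (\<integral>\<^sup>+x. f x \<partial>lborel_Rn d)"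
  using assms
proof (induction d arbitrary: a f)
  case 0
  then show ?case by simp
next
  case (Suc d)
  note [measurable] = Suc.prems(2)
  define b where "b = a - coord a d *\<^sub>R unit_vec d"
  have b: "b \<in> Rn d" using Suc.prems(1) by (auto simp: b_def Rn_def le_Suc_eq)
  have m2 [measurable]: "(\<lambda>p. f (fst p + snd p *\<^sub>R unit_vec d)) \<in> borel_measurable (lborel_Rn d \<Otimes>\<^sub>M borel)"
    using measurable_compose[OF measurable_add_unit_vec Suc.prems(2)] by (simp add: split_beta)
  have m3: "(\<lambda>x. \<integral>\<^sup>+s. f (x + s *\<^sub>R unit_vec d) \<partial>lborel) \<in> borel_measurable (lborel_Rn d)"
    using m2 by (auto intro!: lborel.borel_measurable_nn_integral simp: split_beta cong: measurable_cong_sets)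
  have m4: "(\<lambda>s. f (x + s *\<^sub>R unit_vec d)) \<in> borel_measurable borel" if "x \<in> Rn d" for x
    using measurable_compose[OF _ m2, of "\<lambda>s. (x, s)" borel] that by simp
  have *: "(\<lambda>x. f (a + x)) \<in> borel_measurable (lborel_Rn (Suc d))"
    by (rule measurable_compose[OF measurable_translate_Rn Suc.prems(2)]) fact
  have eq: "a + (x + s *\<^sub>R unit_vec d) = (b + x) + (coord a d + s) *\<^sub>R unit_vec d" for x s
    by (simp add: b_def algebra_simps)
  have "(\<integral>\<^sup>+x. f (a + x) \<partial>lborel_Rn (Suc d)) = 
     (\<integral>\<^sup>+x. \<integral>\<^sup>+s. f ((b + x) + (coord a d + s) *\<^sub>R unit_vec d) \<partial>lborel \<partial>lborel_Rn d)"
    by (subst nn_integral_lborel_Rn_Suc[OF *]) (simp add: eq)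
  also have "\<dots> = (\<integral>\<^sup>+x. \<integral>\<^sup>+s. f ((b + x) + s *\<^sub>R unit_vec d) \<partial>lborel \<partial>lborel_Rn d)"
    using b by (intro nn_integral_cong nn_integral_translate_lborel m4) auto
  also have "\<dots> = (\<integral>\<^sup>+x. \<integral>\<^sup>+s. f (x + s *\<^sub>R unit_vec d) \<partial>lborel \<partial>lborel_Rn d)"
    by (rule Suc.IH[OF b m3])
  also have "\<dots> = (\<integral>\<^sup>+x. f x \<partial>lborel_Rn (Suc d))"
    by (rule nn_integral_lborel_Rn_Suc[symmetric]) fact
  finally show ?case .
qed

text \<open>Every coordinate contributes one factor \<open>\<bar>c\<bar>\<close>. Negative
  \<open>c\<close> is included; \<open>c = -1\<close> gives the reflection needed for convolution
  kernels.\<close>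

lemma nn_integral_scale_Rn:
  assumes "c \<noteq> 0" "f \<in> borel_measurable (lborel_Rn d)"
  shows "(\<integral>\<^sup>+x. f x \<partial>lborel_Rn d) = ennreal (\<bar>c\<bar> ^ d) * (\<integral>\<^sup>+x. f (c *\<^sub>R x) \<partial>lborel_Rn d)"
  using assms(2)
proof (induction d arbitrary: f)
  case 0
  then show ?case
    using measurable_compose[OF measurable_scale_Rn 0, of c] by (simp add: nn_integral_lborel_Rn_0)
next
  case (Suc d)
  note [measurable] = Suc.prems
  have m2 [measurable]: "(\<lambda>p. f (fst p + snd p *\<^sub>R unit_vec d)) \<in> borel_measurable (lborel_Rn d \<Otimes>\<^sub>M borel)"
    using measurable_compose[OF measurable_add_unit_vec Suc.prems] by (simp add: split_beta)
  have m3: "(\<lambda>x. \<integral>\<^sup>+s. f (x + s *\<^sub>R unit_vec d) \<partial>lborel) \<in> borel_measurable (lborel_Rn d)"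
    using m2 by (auto intro!: lborel.borel_measurable_nn_integral simp: split_beta cong: measurable_cong_sets)
  have m4: "(\<lambda>s. f (x + s *\<^sub>R unit_vec d)) \<in> borel_measurable borel" if "x \<in> Rn d" for x
    using measurable_compose[OF _ m2, of "\<lambda>s. (x, s)" borel] that by simp
  have *: "(\<lambda>x. f (c *\<^sub>R x)) \<in> borel_measurable (lborel_Rn (Suc d))"
    by (rule measurable_compose[OF measurable_scale_Rn Suc.prems])
  have m5: "(\<lambda>x. \<integral>\<^sup>+s. f (c *\<^sub>R x + (c * s) *\<^sub>R unit_vec d) \<partial>lborel) \<in> borel_measurable (lborel_Rn d)"
    using measurable_compose[OF _ *, OF measurable_add_unit_vec] 
    by (auto intro!: lborel.borel_measurable_nn_integral simp: split_beta scaleR_add_right cong: measurable_cong_sets)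
  have "(\<integral>\<^sup>+x. f x \<partial>lborel_Rn (Suc d)) = (\<integral>\<^sup>+x. \<integral>\<^sup>+s. f (x + s *\<^sub>R unit_vec d) \<partial>lborel \<partial>lborel_Rn d)"
    by (rule nn_integral_lborel_Rn_Suc) fact
  also have "\<dots> = ennreal (\<bar>c\<bar> ^ d) * (\<integral>\<^sup>+x. \<integral>\<^sup>+s. f (c *\<^sub>R x + s *\<^sub>R unit_vec d) \<partial>lborel \<partial>lborel_Rn d)"
    by (rule Suc.IH[OF m3])
  also have "(\<integral>\<^sup>+x. \<integral>\<^sup>+s. f (c *\<^sub>R x + s *\<^sub>R unit_vec d) \<partial>lborel \<partial>lborel_Rn d)
     = (\<integral>\<^sup>+x. ennreal \<bar>c\<bar> * (\<integral>\<^sup>+s. f (c *\<^sub>R x + (c * s) *\<^sub>R unit_vec d) \<partial>lborel) \<partial>lborel_Rn d)"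
    using assms(1) by (intro nn_integral_cong, subst nn_integral_real_affine[where c = c and t = 0]) (auto intro!: m4)
  also have "\<dots> = ennreal \<bar>c\<bar> * (\<integral>\<^sup>+x. f (c *\<^sub>R x) \<partial>lborel_Rn (Suc d))"
    using m5 by (subst nn_integral_cmult)  (auto simp: nn_integral_lborel_Rn_Suc[OF *] scaleR_add_right)
  finally show ?case by (simp add: ennreal_mult' ac_simps)
qed

text \<open>Evaluates the volume of cubes and, later, the mass of product kernels.\<close>

lemma nn_integral_prod_Rn:
  assumes "\<And>i. i < d \<Longrightarrow> g i \<in> borel_measurable borel"
  shows "(\<integral>\<^sup>+x. (\<Prod>i<d. g i (coord x i)) \<partial>lborel_Rn d) = (\<Prod>i<d. (\<integral>\<^sup>+s. (g i s :: ennreal) \<partial>lborel))"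
  using assms
proof (induction d)
  case 0
  then show ?case by (subst nn_integral_lborel_Rn_0) auto
next
  case (Suc d)
  note [measurable] = Suc.prems
  have m: "(\<lambda>x. \<Prod>i<n. g i (coord x i)) \<in> borel_measurable (lborel_Rn m)" if "n \<le> Suc d" for n m
    using Suc.prems that by (intro borel_measurable_prod_ennreal measurable_compose[OF measurable_coord_Rn]) auto
  have "(\<integral>\<^sup>+x. (\<Prod>i<Suc d. g i (coord x i)) \<partial>lborel_Rn (Suc d)) = 
    (\<integral>\<^sup>+x. \<integral>\<^sup>+s. (\<Prod>i<Suc d. g i (coord (x + s *\<^sub>R unit_vec d) i)) \<partial>lborel \<partial>lborel_Rn d)"
    by (rule nn_integral_lborel_Rn_Suc) (use m[of "Suc d"] in simp)
  also have "\<dots> = (\<integral>\<^sup>+x. \<integral>\<^sup>+s. (\<Prod>i<d. g i (coord x i)) * g d s \<partial>lborel \<partial>lborel_Rn d)"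
    by (intro nn_integral_cong) (auto simp: Rn_def intro!: prod.cong)
  also have "\<dots> = (\<integral>\<^sup>+x. (\<Prod>i<d. g i (coord x i)) * (\<integral>\<^sup>+s. g d s \<partial>lborel) \<partial>lborel_Rn d)"
    by (intro nn_integral_cong nn_integral_cmult) (use Suc.prems in auto)
  also have "\<dots> = (\<integral>\<^sup>+x. (\<Prod>i<d. g i (coord x i)) \<partial>lborel_Rn d) * (\<integral>\<^sup>+s. g d s \<partial>lborel)"
    by (intro nn_integral_multc m) auto
  finally show ?case using Suc by simp
qed

section \<open>Cubes, balls and sigma-finiteness\<close>

lemma cube_sets_Rn: "{x \<in> Rn d. \<forall>i<d. coord x i \<in> {-r..r}} \<in> sets (lborel_Rn d)"
proof -
  have "{x \<in> space (lborel_Rn d). \<forall>i<d. coord x i \<in> {-r..r}} \<in> sets (lborel_Rn d)"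
    by measurable
  then show ?thesis by (simp only: space_lborel_Rn)
qed

lemma emeasure_cube_Rn:
  assumes "r \<ge> 0"
  shows "emeasure (lborel_Rn d) {x \<in> Rn d. \<forall>i<d. coord x i \<in> {-r..r}} = ennreal ((2 * r) ^ d)"
proof -
  have "emeasure (lborel_Rn d) {x \<in> Rn d. \<forall>i<d. coord x i \<in> {-r..r}} = 
    (\<integral>\<^sup>+x. indicator {x \<in> Rn d. \<forall>i<d. coord x i \<in> {-r..r}} x \<partial>lborel_Rn d)"
    by (rule nn_integral_indicator[symmetric]) (rule cube_sets_Rn)
  also have "\<dots> = (\<integral>\<^sup>+x. (\<Prod>i<d. indicator {-r..r} (coord x i)) \<partial>lborel_Rn d)"
    by (intro nn_integral_cong) (auto simp: indicator_def of_bool_def intro!: prod.neutral prod_zero)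
  also have "\<dots> = ennreal ((2 * r) ^ d)"
    using assms by (subst nn_integral_prod_Rn) (auto simp: ennreal_power)
  finally show ?thesis .
qed

lemma emeasure_bounded_Rn:
  assumes "bounded S"
  shows "emeasure (lborel_Rn d) S < \<infinity>"
proof (cases "S \<in> sets (lborel_Rn d)")
  case True
  from assms obtain r where r: "r > 0" "\<And>x. x \<in> S \<Longrightarrow> norm x \<le> r" by (auto simp: bounded_pos)
  have "S \<subseteq> {x \<in> Rn d. \<forall>i<d. coord x i \<in> {-r..r}}"
  proof safe
    fix x i assume x: "x \<in> S"
    show "x \<in> Rn d" using sets.sets_into_space[OF True] x by auto
    have "\<bar>coord x i\<bar> \<le> r" using abs_coord_le_norm[of x i] r(2)[OF x] by linarith
    then show "coord x i \<in> {-r..r}" by auto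
  qed
  then have "emeasure (lborel_Rn d) S \<le> emeasure (lborel_Rn d) {x \<in> Rn d. \<forall>i<d. coord x i \<in> {-r..r}}"
    by (rule emeasure_mono[OF _ cube_sets_Rn])
  also have "\<dots> = ennreal ((2 * r) ^ d)"
    by (rule emeasure_cube_Rn) (use r(1) in simp)
  finally have "emeasure (lborel_Rn d) S \<le> ennreal ((2 * r) ^ d)" .
  then show ?thesis by (simp add: le_less_trans)
qed (simp add: emeasure_notin_sets)

lemma ball_sets_Rn [measurable]: "ball c r \<inter> Rn d \<in> sets (lborel_Rn d)"
  unfolding sets_lborel_Rn sets_restrict_space
  by (rule image_eqI[of _ _ "ball c r"]) (auto simp del: Rn_closure)

lemma emeasure_ball_pos_Rn:
  assumes "r > 0"
  shows "emeasure (lborel_Rn d) (ball 0 r \<inter> Rn d) > 0"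
proof -
  \<comment> \<open>On a cube of half-width \<open>s\<close> the norm is at most
    \<open>real d * s\<close>, which is below \<open>r\<close>; the summand \<open>1\<close> covers
    \<open>d = 0\<close>.\<close>
  define s where "s = r / (2 * (real d + 1))"
  have s: "s > 0" "real d * s < r" using assms by (auto simp: s_def field_simps add_strict_increasing2 intro!: add_nonneg_pos)
  have "{x \<in> Rn d. \<forall>i<d. coord x i \<in> {-s..s}} \<subseteq> ball 0 r \<inter> Rn d"
  proof safe
    fix x assume x: "x \<in> Rn d" "\<forall>i<d. coord x i \<in> {-s..s}"
    have "norm x \<le> (\<Sum>i<d. \<bar>coord x i\<bar>)" by (rule norm_le_sum_coord) fact
    also have "\<dots> \<le> (\<Sum>i<d. s)" by (intro sum_mono) (use x in \<open>force simp: abs_le_iff\<close>)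
    also have "\<dots> < r" using s by simp
    finally show "x \<in> ball 0 r" by simp
  qed
  note le = this
  have "0 < ennreal ((2 * s) ^ d)" using s by simp
  also have "\<dots> = emeasure (lborel_Rn d) {x \<in> Rn d. \<forall>i<d. coord x i \<in> {-s..s}}"
    by (rule emeasure_cube_Rn[symmetric]) (use s in simp)
  also have "\<dots> \<le> emeasure (lborel_Rn d) (ball 0 r \<inter> Rn d)"
    by (rule emeasure_mono[OF le ball_sets_Rn])
  finally show ?thesis .
qed

lemma sigma_finite_lborel_Rn: "sigma_finite_measure (lborel_Rn d)"
proof
  have fin: "emeasure (lborel_Rn d) (ball 0 (real n) \<inter> Rn d) \<noteq> \<infinity>" for n
    using emeasure_bounded_Rn[of "ball 0 (real n) \<inter> Rn d" d] by (auto simp: bounded_Int)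
  show "\<exists>A. countable A \<and> A \<subseteq> sets (lborel_Rn d) \<and> \<Union>A = space (lborel_Rn d) \<and> (\<forall>a\<in>A. emeasure (lborel_Rn d) a \<noteq> \<infinity>)"
    by (rule exI[of _ "range (\<lambda>n::nat. ball 0 (real n) \<inter> Rn d)"])
      (use fin ball_sets_Rn in \<open>auto intro: reals_Archimedean2\<close>)
qed

text \<open>Uniqueness of translation invariant measures: the double integral of \<open>f (U x + y) * k y\<close>,
  with \<open>k\<close> the indicator of a ball, is evaluated in both orders.\<close>

lemma nn_integral_linear_isometry_Rn:
  assumes U: "\<And>x. x \<in> Rn d \<Longrightarrow> U x \<in> Rn d"
    and onto: "\<And>y. y \<in> Rn d \<Longrightarrow> \<exists>x\<in>Rn d. U x = y"
    and add: "\<And>x y. x \<in> Rn d \<Longrightarrow> y \<in> Rn d \<Longrightarrow> U (x + y) = U x + U y"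
    and norm: "\<And>x. x \<in> Rn d \<Longrightarrow> norm (U x) = norm x"
    and Um [measurable]: "U \<in> lborel_Rn d \<rightarrow>\<^sub>M lborel_Rn d"
    and f [measurable]: "f \<in> borel_measurable (lborel_Rn d)"
  shows "(\<integral>\<^sup>+x. f (U x) \<partial>lborel_Rn d) = (\<integral>\<^sup>+x. f x \<partial>lborel_Rn d)"
proof -
  let ?M = "lborel_Rn d"
  interpret sigma_finite_measure ?M by (rule sigma_finite_lborel_Rn)
  interpret pair_sigma_finite ?M ?M ..
  define k :: "fvec \<Rightarrow> ennreal" where "k = indicator (ball 0 1 \<inter> Rn d)"
  have k [measurable]: "k \<in> borel_measurable ?M" unfolding k_def by measurable
  \<comment> \<open>Positive and finite, so that this factor can be cancelled at the end.\<close>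
  have K: "(\<integral>\<^sup>+x. k x \<partial>?M) \<noteq> 0" "(\<integral>\<^sup>+x. k x \<partial>?M) \<noteq> \<infinity>"
    unfolding k_def using emeasure_ball_pos_Rn[of 1 d] emeasure_bounded_Rn[of "ball 0 1 \<inter> Rn d" d]
    by (auto simp: bounded_Int)
  have add_m: "(\<lambda>p. U (fst p) + snd p) \<in> ?M \<Otimes>\<^sub>M ?M \<rightarrow>\<^sub>M ?M"
    using measurable_compose[OF measurable_compose[OF measurable_fst Um] measurable_coord_Rn] 
    by (intro measurable_into_Rn) (auto simp: space_pair_measure U)
  have diff_m: "(\<lambda>p. snd p - U (fst p)) \<in> ?M \<Otimes>\<^sub>M ?M \<rightarrow>\<^sub>M ?M"
    using measurable_compose[OF measurable_compose[OF measurable_fst Um] measurable_coord_Rn] 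
    by (intro measurable_into_Rn) (auto simp: space_pair_measure U)
  have fm [measurable]: "(\<lambda>p. f (U (fst p) + snd p)) \<in> borel_measurable (?M \<Otimes>\<^sub>M ?M)"
    by (rule measurable_compose[OF add_m f])
  have km [measurable]: "(\<lambda>p. k (snd p - U (fst p))) \<in> borel_measurable (?M \<Otimes>\<^sub>M ?M)"
    by (rule measurable_compose[OF diff_m k])
  have fU [measurable]: "(\<lambda>x. f (U x)) \<in> borel_measurable ?M" by measurable
  have "(\<integral>\<^sup>+x. f (U x) \<partial>?M) * (\<integral>\<^sup>+y. k y \<partial>?M) = (\<integral>\<^sup>+y. (\<integral>\<^sup>+x. f (U x) \<partial>?M) * k y \<partial>?M)"
    by (subst nn_integral_cmult) auto
  \<comment> \<open>Writing \<open>y = U b\<close> turns the shift of the values by \<open>y\<close>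
    into a shift of the argument by \<open>b\<close>.\<close>
  also have "\<dots> = (\<integral>\<^sup>+y. (\<integral>\<^sup>+x. f (U x + y) \<partial>?M) * k y \<partial>?M)"
  proof (rule nn_integral_cong)
    fix y assume "y \<in> space ?M"
    then obtain b where b: "b \<in> Rn d" "U b = y" using onto by auto
    have "(\<integral>\<^sup>+x. f (U x) \<partial>?M) = (\<integral>\<^sup>+x. f (U (b + x)) \<partial>?M)"
      by (rule nn_integral_translate_Rn[symmetric]) (use b fU in auto)
    also have "\<dots> = (\<integral>\<^sup>+x. f (U x + y) \<partial>?M)"
      by (intro nn_integral_cong) (use b add in \<open>auto simp: add.commute\<close>)
    finally show "(\<integral>\<^sup>+x. f (U x) \<partial>?M) * k y = (\<integral>\<^sup>+x. f (U x + y) \<partial>?M) * k y"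
      by (simp only:)
  qed
  also have "\<dots> = (\<integral>\<^sup>+y. (\<integral>\<^sup>+x. f (U x + y) * k y \<partial>?M) \<partial>?M)"
  proof (rule nn_integral_cong)
    fix y assume "y \<in> space ?M"
    from measurable_compose[OF measurable_Pair2'[OF this] fm]
    have "(\<lambda>x. f (U x + y)) \<in> borel_measurable ?M" by simp
    then show "(\<integral>\<^sup>+x. f (U x + y) \<partial>?M) * k y = (\<integral>\<^sup>+x. f (U x + y) * k y \<partial>?M)"
      by (rule nn_integral_multc[symmetric])
  qed
  also have "\<dots> = (\<integral>\<^sup>+x. (\<integral>\<^sup>+y. f (U x + y) * k y \<partial>?M) \<partial>?M)"
    by (rule Fubini') (auto simp: split_beta)
  also have "\<dots> = (\<integral>\<^sup>+x. (\<integral>\<^sup>+y. f y * k (y - U x) \<partial>?M) \<partial>?M)"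
  proof (rule nn_integral_cong)
    fix x assume x: "x \<in> space ?M"
    have m: "(\<lambda>y. f y * k (y - U x)) \<in> borel_measurable ?M"
      using measurable_compose[OF measurable_Pair1'[OF x] km] f 
      by (intro borel_measurable_times_ennreal) simp_all
    show "(\<integral>\<^sup>+y. f (U x + y) * k y \<partial>?M) = (\<integral>\<^sup>+y. f y * k (y - U x) \<partial>?M)"
      using nn_integral_translate_Rn[OF U m, of x] x by simp
  qed
  also have "\<dots> = (\<integral>\<^sup>+y. (\<integral>\<^sup>+x. f y * k (y - U x) \<partial>?M) \<partial>?M)"
    by (rule Fubini'[symmetric]) (auto simp: split_beta)
  also have "\<dots> = (\<integral>\<^sup>+y. f y * (\<integral>\<^sup>+x. k (y - U x) \<partial>?M) \<partial>?M)"
  proof (rule nn_integral_cong)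
    fix y assume "y \<in> space ?M"
    from measurable_compose[OF measurable_Pair2'[OF this] km]
    have "(\<lambda>x. k (y - U x)) \<in> borel_measurable ?M" by simp
    then show "(\<integral>\<^sup>+x. f y * k (y - U x) \<partial>?M) = f y * (\<integral>\<^sup>+x. k (y - U x) \<partial>?M)"
      by (rule nn_integral_cmult)
  qed
  \<comment> \<open>Here the isometry enters: with \<open>y = U b\<close> the vector
    \<open>y - U x = U (b - x)\<close> has the norm of \<open>b - x\<close>, so the indicator of the
    centred ball takes the same value at both, and the inner integral no longer depends on
    \<open>y\<close>.\<close>
  also have "\<dots> = (\<integral>\<^sup>+y. f y * (\<integral>\<^sup>+x. k x \<partial>?M) \<partial>?M)"
  proof (rule nn_integral_cong)
    fix y assume "y \<in> space ?M"
    then obtain b where b: "b \<in> Rn d" "U b = y" using onto by auto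
    have "(\<integral>\<^sup>+x. k x \<partial>?M) = (\<integral>\<^sup>+x. k (- b + x) \<partial>?M)"
      by (rule nn_integral_translate_Rn[symmetric]) (use b in auto)
    also have "\<dots> = (\<integral>\<^sup>+x. k (y - U x) \<partial>?M)"
    proof (intro nn_integral_cong)
      fix x assume "x \<in> space ?M"
      then have x: "x \<in> Rn d" by simp
      have "U b = U (b - x) + U x" using add[of "b - x" x] x b by simp
      then have "y - U x = U (b - x)" using b by simp
      moreover have "U (b - x) \<in> Rn d" "- b + x \<in> Rn d" using x b U by simp_all
      moreover have "norm (U (b - x)) = norm (- b + x)"
        using norm[of "b - x"] x b by (simp add: norm_minus_commute)
      ultimately show "k (- b + x) = k (y - U x)"
        unfolding k_def indicator_def by simp
    qed
    finally show "f y * (\<integral>\<^sup>+x. k (y - U x) \<partial>?M) = f y * (\<integral>\<^sup>+x. k x \<partial>?M)"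
      by (rule arg_cong[OF sym])
  qed
  also have "\<dots> = (\<integral>\<^sup>+y. f y \<partial>?M) * (\<integral>\<^sup>+x. k x \<partial>?M)"
    by (rule nn_integral_multc) fact
  finally have "(\<integral>\<^sup>+x. k x \<partial>?M) * (\<integral>\<^sup>+x. f (U x) \<partial>?M) = (\<integral>\<^sup>+x. k x \<partial>?M) * (\<integral>\<^sup>+x. f x \<partial>?M)"
    by (simp only: mult.commute)
  then show ?thesis
    using K unfolding ennreal_mult_cancel_left by (auto simp only: infinity_ennreal_def)
qed


section \<open>Square integrable functions\<close>

text \<open>The set of integration is moved into the integrand as an indicator factor, so that one
  calculus serves the volume measure, the surface measure and their completions.\<close>

definition sq_int :: "'a measure \<Rightarrow> ('a \<Rightarrow> real) \<Rightarrow> bool" where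
  "sq_int M f \<longleftrightarrow> f \<in> borel_measurable M \<and> integrable M (\<lambda>x. (f x)\<^sup>2)"

definition l2 :: "'a measure \<Rightarrow> ('a \<Rightarrow> real) \<Rightarrow> real" where
  "l2 M f = sqrt (LINT x|M. (f x)\<^sup>2)"

lemma l2_nonneg [simp]: "0 \<le> l2 M f"
  by (simp add: l2_def)

lemma l2_power2: "(l2 M f)\<^sup>2 = (LINT x|M. (f x)\<^sup>2)"
  by (simp add: l2_def)

lemma in_L2_iff: "in_L2 M S f \<longleftrightarrow> sq_int M (\<lambda>x. indicator S x * f x)"
proof -
  have "(\<lambda>x. indicator S x *\<^sub>R (f x)\<^sup>2) = (\<lambda>x. (indicator S x * f x)\<^sup>2)"
    by (auto simp: fun_eq_iff indicator_def)
  then show ?thesis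
    by (simp add: in_L2_def sq_int_def set_borel_measurable_def set_integrable_def)
qed

lemma L2_norm_eq: "L2_norm M S f = l2 M (\<lambda>x. indicator S x * f x)"
proof -
  have "(\<lambda>x. indicator S x *\<^sub>R (f x)\<^sup>2) = (\<lambda>x. (indicator S x * f x)\<^sup>2)"
    by (auto simp: fun_eq_iff indicator_def)
  then show ?thesis
    by (simp add: L2_norm_def l2_def set_lebesgue_integral_def)
qed

lemma sq_int_measurable: "sq_int M f \<Longrightarrow> f \<in> borel_measurable M"
  by (simp add: sq_int_def)

lemma sq_int_bound:
  assumes "sq_int M g" "f \<in> borel_measurable M" "\<And>x. x \<in> space M \<Longrightarrow> \<bar>f x\<bar> \<le> c * \<bar>g x\<bar>"
  shows "sq_int M f"
  unfolding sq_int_def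
proof
  show "integrable M (\<lambda>x. (f x)\<^sup>2)"
  proof (rule Bochner_Integration.integrable_bound)
    show "integrable M (\<lambda>x. c\<^sup>2 * (g x)\<^sup>2)" using assms(1) by (simp add: sq_int_def)
    show "(\<lambda>x. (f x)\<^sup>2) \<in> borel_measurable M" using assms(2) by (rule borel_measurable_power)
    have "(f x)\<^sup>2 \<le> c\<^sup>2 * (g x)\<^sup>2" if "x \<in> space M" for x
      using power_mono[OF assms(3)[OF that], of 2] by (simp add: power_mult_distrib)
    then show "AE x in M. norm ((f x)\<^sup>2) \<le> norm (c\<^sup>2 * (g x)\<^sup>2)"
      by (intro AE_I2) (auto simp: abs_mult)
  qed
qed fact

lemma sq_int_add:
  assumes "sq_int M f" "sq_int M g"
  shows "sq_int M (\<lambda>x. f x + g x)"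
  unfolding sq_int_def
proof
  show m: "(\<lambda>x. f x + g x) \<in> borel_measurable M"
    using assms by (auto simp: sq_int_def)
  show "integrable M (\<lambda>x. (f x + g x)\<^sup>2)"
  proof (rule Bochner_Integration.integrable_bound)
    show "integrable M (\<lambda>x. 2 * ((f x)\<^sup>2 + (g x)\<^sup>2))" using assms by (simp add: sq_int_def)
    show "(\<lambda>x. (f x + g x)\<^sup>2) \<in> borel_measurable M" using m by (rule borel_measurable_power)
    have "(f x + g x)\<^sup>2 \<le> 2 * ((f x)\<^sup>2 + (g x)\<^sup>2)" for x
      using zero_le_power2[of "f x - g x"] by (simp add: power2_eq_square algebra_simps)
    then show "AE x in M. norm ((f x + g x)\<^sup>2) \<le> norm (2 * ((f x)\<^sup>2 + (g x)\<^sup>2))"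
      by (intro AE_I2) (auto simp: abs_mult)
  qed
qed

lemma sq_int_cmult: "sq_int M f \<Longrightarrow> sq_int M (\<lambda>x. c * f x)"
  by (rule sq_int_bound[where c = "\<bar>c\<bar>" and g = f]) (auto simp: sq_int_def abs_mult)

lemma sq_int_diff: "sq_int M f \<Longrightarrow> sq_int M g \<Longrightarrow> sq_int M (\<lambda>x. f x - g x)"
  using sq_int_add[of M f "\<lambda>x. -1 * g x"] sq_int_cmult[of M g "-1"] by simp

lemma l2_cmult: "l2 M (\<lambda>x. c * f x) = \<bar>c\<bar> * l2 M f"
  by (simp add: l2_def power_mult_distrib real_sqrt_mult)

lemma l2_minus_commute: "l2 M (\<lambda>x. f x - g x) = l2 M (\<lambda>x. g x - f x)"
  by (simp add: l2_def power2_commute)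

text \<open>Young's inequality with the weights \<open>b / a\<close> and \<open>a / b\<close> gives
  \<open>(a + b)\<^sup>2\<close> when \<open>a\<close> and \<open>b\<close> are the two norms. Both
  are enlarged by \<open>e / 2\<close> because a norm may vanish.\<close>

lemma l2_triangle:
  assumes f: "sq_int M f" and g: "sq_int M g"
  shows "l2 M (\<lambda>x. f x + g x) \<le> l2 M f + l2 M g"
proof (rule field_le_epsilon)
  fix e :: real assume e: "e > 0"
  define a b where "a = l2 M f + e / 2" and "b = l2 M g + e / 2"
  have ab: "a > 0" "b > 0" "l2 M f \<le> a" "l2 M g \<le> b" using e by (auto simp: a_def b_def add_nonneg_pos)
  have "(LINT x|M. (f x + g x)\<^sup>2) \<le> (LINT x|M. (1 + b / a) * (f x)\<^sup>2 + (1 + a / b) * (g x)\<^sup>2)"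
  proof (rule integral_mono)
    show "integrable M (\<lambda>x. (f x + g x)\<^sup>2)" using sq_int_add[OF f g] by (simp add: sq_int_def)
    show "integrable M (\<lambda>x. (1 + b / a) * (f x)\<^sup>2 + (1 + a / b) * (g x)\<^sup>2)"
      using f g by (auto simp: sq_int_def)
    fix x
    have "0 \<le> (b * f x - a * g x)\<^sup>2 / (a * b)" using ab by simp
    also have "\<dots> = (1 + b / a) * (f x)\<^sup>2 + (1 + a / b) * (g x)\<^sup>2 - (f x + g x)\<^sup>2"
      using ab by (simp add: field_simps power2_eq_square)
    finally show "(f x + g x)\<^sup>2 \<le> (1 + b / a) * (f x)\<^sup>2 + (1 + a / b) * (g x)\<^sup>2" by simp
  qed
  also have "\<dots> = (1 + b / a) * (l2 M f)\<^sup>2 + (1 + a / b) * (l2 M g)\<^sup>2"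
    using f g unfolding l2_power2 by (subst Bochner_Integration.integral_add) (auto simp: sq_int_def)
  also have "\<dots> \<le> (1 + b / a) * a\<^sup>2 + (1 + a / b) * b\<^sup>2"
    using ab by (intro add_mono mult_left_mono power_mono) auto
  also have "\<dots> = (a + b)\<^sup>2" using ab by (simp add: field_simps power2_eq_square)
  finally have "l2 M (\<lambda>x. f x + g x) \<le> a + b"
    unfolding l2_def using ab real_le_lsqrt by (auto intro: real_le_lsqrt)
  then show "l2 M (\<lambda>x. f x + g x) \<le> l2 M f + l2 M g + e" by (simp add: a_def b_def)
qed

lemma l2_triangle_diff:
  assumes "sq_int M f" "sq_int M g" "sq_int M h"
  shows "l2 M (\<lambda>x. f x - h x) \<le> l2 M (\<lambda>x. f x - g x) + l2 M (\<lambda>x. g x - h x)"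
  using l2_triangle[OF sq_int_diff[OF assms(1,2)] sq_int_diff[OF assms(2,3)]] by simp

lemma l2_le_add_diff:
  assumes "sq_int M f" "sq_int M g"
  shows "l2 M f \<le> l2 M g + l2 M (\<lambda>x. f x - g x)"
  using l2_triangle[OF assms(2) sq_int_diff[OF assms]] by simp

lemma ennreal_l2_sq:
  assumes "sq_int M f"
  shows "(\<integral>\<^sup>+x. ennreal ((f x)\<^sup>2) \<partial>M) = ennreal ((l2 M f)\<^sup>2)"
  using assms unfolding l2_power2 by (intro nn_integral_eq_integral) (auto simp: sq_int_def)

text \<open>Turns one bound on a nonnegative integral into integrability and a norm bound together,
  for functions whose integrability is not known beforehand.\<close>

lemma sq_int_leI:
  assumes "f \<in> borel_measurable M" "(\<integral>\<^sup>+x. ennreal ((f x)\<^sup>2) \<partial>M) \<le> ennreal (c\<^sup>2)" "c \<ge> 0"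
  shows "sq_int M f" "l2 M f \<le> c"
proof -
  show s: "sq_int M f"
    unfolding sq_int_def
    using assms by (auto simp: integrable_iff_bounded intro: le_less_trans)
  have "(l2 M f)\<^sup>2 \<le> c\<^sup>2"
    using assms(2) by (simp add: ennreal_l2_sq[OF s])
  then show "l2 M f \<le> c" using assms(3) by (rule power2_le_imp_le)
qed

lemma l2_dominated_convergence:
  assumes g: "sq_int M g" and m: "\<And>i. s i \<in> borel_measurable M" "f \<in> borel_measurable M"
    and lim: "\<And>x. x \<in> space M \<Longrightarrow> (\<lambda>i. s i x) \<longlonglongrightarrow> f x"
    and bound: "\<And>i x. x \<in> space M \<Longrightarrow> \<bar>s i x - f x\<bar> \<le> g x"
  shows "(\<lambda>i. l2 M (\<lambda>x. s i x - f x)) \<longlonglongrightarrow> 0"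
proof -
  have "(\<lambda>i. LINT x|M. (s i x - f x)\<^sup>2) \<longlonglongrightarrow> (LINT x|M. 0)"
  proof (rule integral_dominated_convergence[where w = "\<lambda>x. (g x)\<^sup>2"])
    show "integrable M (\<lambda>x. (g x)\<^sup>2)" using g by (simp add: sq_int_def)
    show "AE x in M. (\<lambda>i. (s i x - f x)\<^sup>2) \<longlonglongrightarrow> 0"
    proof (rule AE_I2)
      fix x assume "x \<in> space M"
      from lim[OF this] have "(\<lambda>i. (s i x - f x)\<^sup>2) \<longlonglongrightarrow> (f x - f x)\<^sup>2" by (intro tendsto_intros)
      then show "(\<lambda>i. (s i x - f x)\<^sup>2) \<longlonglongrightarrow> 0" by simp
    qed
    show "AE x in M. norm ((s i x - f x)\<^sup>2) \<le> (g x)\<^sup>2" for i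
      using power_mono[OF bound, of _ i 2] by (intro AE_I2) auto
  qed (use m in auto)
  then have "(\<lambda>i. sqrt (LINT x|M. (s i x - f x)\<^sup>2)) \<longlonglongrightarrow> sqrt 0"
    by (intro tendsto_real_sqrt) simp
  then show ?thesis by (simp add: l2_def)
qed

text \<open>A rapidly Cauchy subsequence converges almost everywhere; Fatou's lemma identifies its limit as
  the \<open>L\<^sup>2\<close> limit of the whole sequence.\<close>

lemma l2_complete:
  fixes f :: "nat \<Rightarrow> 'a \<Rightarrow> real"
  assumes f: "\<And>n. sq_int M (f n)"
    and cauchy: "\<And>e. e > 0 \<Longrightarrow> \<exists>N. \<forall>m\<ge>N. \<forall>n\<ge>N. l2 M (\<lambda>x. f m x - f n x) < e"
  shows "\<exists>w. sq_int M w \<and> (\<lambda>n. l2 M (\<lambda>x. f n x - w x)) \<longlonglongrightarrow> 0"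
proof -
  have "\<exists>N. \<forall>m\<ge>N. \<forall>n\<ge>N. l2 M (\<lambda>x. f m x - f n x) < (1/2) ^ k" for k :: nat
    by (rule cauchy) simp
  then obtain N where N: "\<And>k m n. m \<ge> N k \<Longrightarrow> n \<ge> N k \<Longrightarrow> l2 M (\<lambda>x. f m x - f n x) < (1/2) ^ k"
    by metis
  \<comment> \<open>The sum dominates every \<open>N j\<close> with \<open>j \<le> k\<close>, which
    replaces monotonicity of \<open>N\<close>.\<close>
  define r where "r k = (\<Sum>j\<le>k. N j) + k" for k
  have rN: "r j \<ge> N k" if "j \<ge> k" for j k
    unfolding r_def using that by (intro trans_le_add1 member_le_sum) auto
  have r_ge: "r k \<ge> k" for k by (simp add: r_def)
  define g where "g k x = f (r (Suc k)) x - f (r k) x" for k x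
  have g: "sq_int M (g k)" for k unfolding g_def by (intro sq_int_diff f)
  have gl: "l2 M (g k) \<le> (1/2) ^ k" for k
    unfolding g_def by (rule less_imp_le, rule N) (auto intro: rN)
  have gm [measurable]: "g k \<in> borel_measurable M" for k using g sq_int_measurable by blast
  have fm [measurable]: "f k \<in> borel_measurable M" for k using f sq_int_measurable by blast
  \<comment> \<open>The weight \<open>2 ^ k\<close> is affordable because
    \<open>2 ^ k * ((1/2) ^ k)\<^sup>2\<close> is summable, and it pays off pointwise: where the
    weighted sum is finite, \<open>\<bar>g k x\<bar>\<close> decays like
    \<open>(sqrt (1/2)) ^ k\<close>, so the telescoping series converges absolutely.\<close>
  have "(\<integral>\<^sup>+x. (\<Sum>k. ennreal (2 ^ k * (g k x)\<^sup>2)) \<partial>M) = (\<Sum>k. \<integral>\<^sup>+x. ennreal (2 ^ k * (g k x)\<^sup>2) \<partial>M)"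
    by (rule nn_integral_suminf) measurable
  also have "\<dots> = (\<Sum>k. ennreal (2 ^ k * (l2 M (g k))\<^sup>2))"
  proof (rule suminf_cong)
    fix k
    have "(\<integral>\<^sup>+x. ennreal (2 ^ k * (g k x)\<^sup>2) \<partial>M) = (\<integral>\<^sup>+x. ennreal (2 ^ k) * ennreal ((g k x)\<^sup>2) \<partial>M)"
      by (intro nn_integral_cong) (simp add: ennreal_mult)
    also have "\<dots> = ennreal (2 ^ k) * (\<integral>\<^sup>+x. ennreal ((g k x)\<^sup>2) \<partial>M)"
      by (rule nn_integral_cmult) measurable
    also have "\<dots> = ennreal (2 ^ k * (l2 M (g k))\<^sup>2)"
      by (simp only: ennreal_l2_sq[OF g]) (simp add: ennreal_mult)
    finally show "(\<integral>\<^sup>+x. ennreal (2 ^ k * (g k x)\<^sup>2) \<partial>M) = ennreal (2 ^ k * (l2 M (g k))\<^sup>2)" .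
  qed
  also have "\<dots> \<le> (\<Sum>k. ennreal ((1/2) ^ k))"
  proof (intro suminf_le ennreal_leI)
    fix k
    have "2 ^ k * (l2 M (g k))\<^sup>2 \<le> 2 ^ k * ((1/2) ^ k)\<^sup>2"
      using gl by (intro mult_left_mono power_mono) auto
    also have "\<dots> = (1/2) ^ k"
      by (simp add: power2_eq_square power_one_over)
    finally show "2 ^ k * (l2 M (g k))\<^sup>2 \<le> (1/2) ^ k" .
  qed auto
  also have "\<dots> < \<infinity>"
    by (subst suminf_ennreal2) (auto intro!: summable_geometric)
  finally have "AE x in M. (\<Sum>k. ennreal (2 ^ k * (g k x)\<^sup>2)) \<noteq> \<infinity>"
    by (intro nn_integral_PInf_AE) auto
  then have conv: "AE x in M. convergent (\<lambda>k. f (r k) x)"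
  proof (rule AE_mp, intro AE_I2 impI)
    fix x assume "(\<Sum>k. ennreal (2 ^ k * (g k x)\<^sup>2)) \<noteq> \<infinity>"
    then have S: "summable (\<lambda>k. 2 ^ k * (g k x)\<^sup>2)"
      by (intro summable_suminf_not_top) auto
    define s where "s = (\<Sum>k. 2 ^ k * (g k x)\<^sup>2)"
    have "\<bar>g k x\<bar> \<le> sqrt s * (sqrt (1/2)) ^ k" for k
    proof -
      have "2 ^ k * (g k x)\<^sup>2 = (\<Sum>j\<in>{k}. 2 ^ j * (g j x)\<^sup>2)" by simp
      also have "\<dots> \<le> s" unfolding s_def by (rule sum_le_suminf[OF S]) auto
      finally have "(g k x)\<^sup>2 \<le> s * (1/2) ^ k" by (simp add: field_simps power_one_over)
      then have "sqrt ((g k x)\<^sup>2) \<le> sqrt (s * (1/2) ^ k)" by (rule real_sqrt_le_mono)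
      then show ?thesis by (simp only: real_sqrt_abs real_sqrt_mult real_sqrt_power[of "1/2"])
    qed
    moreover have "summable (\<lambda>k. sqrt s * (sqrt (1/2)) ^ k)"
      by (intro summable_mult summable_geometric) (simp add: real_sqrt_divide)
    ultimately have "summable (\<lambda>k. g k x)"
      by - (rule summable_comparison_test'[where N = 0 and g = "\<lambda>k. sqrt s * (sqrt (1/2)) ^ k"], auto)
    then have "convergent (\<lambda>k. \<Sum>j<k. g j x)" by (simp only: summable_iff_convergent)
    then have "convergent (\<lambda>k. f (r 0) x + (\<Sum>j<k. g j x))"
      by (intro convergent_add convergent_const)
    moreover have "f (r 0) x + (\<Sum>j<k. g j x) = f (r k) x" for k
      by (induction k) (auto simp: g_def)
    ultimately show "convergent (\<lambda>k. f (r k) x)" by simp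
  qed
  define w where "w x = lim (\<lambda>k. f (r k) x)" for x
  have wm [measurable]: "w \<in> borel_measurable M"
    unfolding w_def by measurable
  \<comment> \<open>Fatou along \<open>f n - f (r j)\<close> yields the rate at \<open>n\<close>
    and, at the same time, square integrability of \<open>f n - w\<close>, from which that of
    \<open>w\<close> follows.\<close>
  have close: "sq_int M (\<lambda>x. f n x - w x) \<and> l2 M (\<lambda>x. f n x - w x) \<le> (1/2) ^ k" if n: "n \<ge> N k" for n k
  proof -
    have "(\<integral>\<^sup>+x. ennreal ((f n x - w x)\<^sup>2) \<partial>M) = (\<integral>\<^sup>+x. liminf (\<lambda>j. ennreal ((f n x - f (r j) x)\<^sup>2)) \<partial>M)"
    proof (rule nn_integral_cong_AE, use conv in \<open>rule AE_mp\<close>, intro AE_I2 impI)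
      fix x assume "convergent (\<lambda>k. f (r k) x)"
      then have "(\<lambda>k. f (r k) x) \<longlonglongrightarrow> w x" by (simp add: w_def convergent_LIMSEQ_iff)
      then have "(\<lambda>j. ennreal ((f n x - f (r j) x)\<^sup>2)) \<longlonglongrightarrow> ennreal ((f n x - w x)\<^sup>2)"
        by (intro tendsto_intros)
      from lim_imp_Liminf[OF _ this] show "ennreal ((f n x - w x)\<^sup>2) = liminf (\<lambda>j. ennreal ((f n x - f (r j) x)\<^sup>2))"
        by simp
    qed
    also have "\<dots> \<le> liminf (\<lambda>j. (\<integral>\<^sup>+x. ennreal ((f n x - f (r j) x)\<^sup>2) \<partial>M))"
      by (rule nn_integral_liminf) measurable
    also have "\<dots> \<le> ennreal (((1/2) ^ k)\<^sup>2)"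
    proof -
      have "(\<integral>\<^sup>+x. ennreal ((f n x - f (r j) x)\<^sup>2) \<partial>M) \<le> ennreal (((1/2) ^ k)\<^sup>2)" if "j \<ge> k" for j
        unfolding ennreal_l2_sq[OF sq_int_diff[OF f f]]
        using N[OF n rN[OF that]] by (intro ennreal_leI power_mono) auto
      then have ev: "\<forall>\<^sub>F j in sequentially. (\<integral>\<^sup>+x. ennreal ((f n x - f (r j) x)\<^sup>2) \<partial>M) \<le> ennreal (((1/2) ^ k)\<^sup>2)"
        using eventually_sequentially by blast
      from Liminf_mono[OF ev] show ?thesis by (simp add: Liminf_const)
    qed
    finally show ?thesis
      using sq_int_leI[of "\<lambda>x. f n x - w x" M "(1/2) ^ k"] by auto
  qed
  have "sq_int M w"
    using sq_int_diff[OF f conjunct1[OF close[OF order_refl]], of "N 0" 0] by simp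
  moreover have "(\<lambda>n. l2 M (\<lambda>x. f n x - w x)) \<longlonglongrightarrow> 0"
  proof (rule LIMSEQ_I)
    fix e :: real assume "e > 0"
    then obtain k :: nat where k: "(1/2) ^ k < e" using real_arch_pow_inv[of e "1/2"] by auto
    show "\<exists>n0. \<forall>n\<ge>n0. norm (l2 M (\<lambda>x. f n x - w x) - 0) < e"
      using close k by (intro exI[of _ "N k"]) (auto intro: le_less_trans)
  qed
  ultimately show ?thesis by blast
qed

text \<open>Membership in the L^2 closure of the bounded continuous functions. Continuity is
  required on the whole type and a bound is recorded, because mollifiers are later applied to the
  approximant and must converge under a uniform bound.\<close>

definition cont_approx :: "'a::metric_space measure \<Rightarrow> ('a \<Rightarrow> real) \<Rightarrow> bool" where
  "cont_approx N f \<longleftrightarrow> sq_int N f \<and>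
     (\<forall>e>0. \<exists>g. continuous_on UNIV g \<and> bounded (range g) \<and> sq_int N g \<and> l2 N (\<lambda>x. f x - g x) < e)"

lemma cont_approx_lim:
  assumes "\<And>i. cont_approx N (s i)" "sq_int N f" "(\<lambda>i. l2 N (\<lambda>x. s i x - f x)) \<longlonglongrightarrow> 0"
  shows "cont_approx N f"
  unfolding cont_approx_def
proof (intro conjI allI impI)
  fix e :: real assume e: "e > 0"
  from LIMSEQ_D[OF assms(3), of "e/2"] e obtain i where i: "l2 N (\<lambda>x. s i x - f x) < e / 2" by auto
  obtain g where g: "continuous_on UNIV g" "bounded (range g)" "sq_int N g" "l2 N (\<lambda>x. s i x - g x) < e/2"
    using assms(1)[of i] e unfolding cont_approx_def by (meson half_gt_zero)
  have "l2 N (\<lambda>x. f x - g x) < e"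
    using l2_triangle_diff[OF assms(2) _ g(3), of "s i"] assms(1)[of i] i g(4)
    by (auto simp: cont_approx_def l2_minus_commute[of N f])
  with g show "\<exists>g. continuous_on UNIV g \<and> bounded (range g) \<and> sq_int N g \<and> l2 N (\<lambda>x. f x - g x) < e"
    by blast
qed fact

lemma cont_approx_add:
  assumes "cont_approx N f" "cont_approx N h"
  shows "cont_approx N (\<lambda>x. f x + h x)"
  unfolding cont_approx_def
proof (intro conjI allI impI)
  show "sq_int N (\<lambda>x. f x + h x)" using assms by (auto simp: cont_approx_def intro: sq_int_add)
  fix e :: real assume "e > 0"
  then have e: "e / 2 > 0" by simp
  obtain g where g: "continuous_on UNIV g" "bounded (range g)" "sq_int N g" "l2 N (\<lambda>x. f x - g x) < e/2"
    using assms(1) e unfolding cont_approx_def by blast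
  obtain k where k: "continuous_on UNIV k" "bounded (range k)" "sq_int N k" "l2 N (\<lambda>x. h x - k x) < e/2"
    using assms(2) e unfolding cont_approx_def by blast
  have "l2 N (\<lambda>x. (f x + h x) - (g x + k x)) < e"
    using l2_triangle[of N "\<lambda>x. f x - g x" "\<lambda>x. h x - k x"] assms g(3,4) k(3,4)
    by (auto simp: cont_approx_def sq_int_diff algebra_simps)
  moreover have "bounded (range (\<lambda>x. g x + k x))"
    using g(2) k(2) by (rule bounded_plus_comp)
  ultimately show "\<exists>g. continuous_on UNIV g \<and> bounded (range g) \<and> sq_int N g \<and> l2 N (\<lambda>x. f x + h x - g x) < e"
    using g k by (intro exI[of _ "\<lambda>x. g x + k x"]) (auto intro: continuous_intros sq_int_add)
qed

lemma cont_approx_cmult: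
  assumes "cont_approx N f"
  shows "cont_approx N (\<lambda>x. c * f x)"
  unfolding cont_approx_def
proof (intro conjI allI impI)
  show "sq_int N (\<lambda>x. c * f x)" using assms by (auto simp: cont_approx_def intro: sq_int_cmult)
  fix e :: real assume "e > 0"
  then have e: "e / (\<bar>c\<bar> + 1) > 0" by (simp add: add_nonneg_pos)
  obtain g where g: "continuous_on UNIV g" "bounded (range g)" "sq_int N g" "l2 N (\<lambda>x. f x - g x) < e/(\<bar>c\<bar> + 1)"
    using assms(1) e unfolding cont_approx_def by blast
  have "l2 N (\<lambda>x. c * f x - c * g x) = \<bar>c\<bar> * l2 N (\<lambda>x. f x - g x)"
    using l2_cmult[of N c "\<lambda>x. f x - g x"] by (simp add: right_diff_distrib)
  also have "\<dots> \<le> (\<bar>c\<bar> + 1) * l2 N (\<lambda>x. f x - g x)" by (intro mult_right_mono) auto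
  also have "\<dots> < e" using g(4) by (simp add: field_simps add_nonneg_pos)
  finally have "l2 N (\<lambda>x. c * f x - c * g x) < e" .
  moreover have "bounded (range (\<lambda>x. c * g x))"
    using bounded_scaling[OF g(2), of c] by (simp add: image_image)
  ultimately show "\<exists>g. continuous_on UNIV g \<and> bounded (range g) \<and> sq_int N g \<and> l2 N (\<lambda>x. c * f x - g x) < e"
    using g by (intro exI[of _ "\<lambda>x. c * g x"]) (auto intro: continuous_intros sq_int_cmult)
qed

lemma (in finite_measure) sq_int_bounded:
  assumes "f \<in> borel_measurable M" "\<And>x. x \<in> space M \<Longrightarrow> \<bar>f x\<bar> \<le> B"
  shows "sq_int M f"
  by (rule sq_int_bound[where c = B and g = "\<lambda>_. 1"]) (use assms in \<open>auto simp: sq_int_def\<close>)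

lemma cont_approx_continuous:
  assumes fin: "finite_measure M" and "f \<in> borel_measurable M" "continuous_on UNIV f" "bounded (range f)"
  shows "cont_approx M f"
proof -
  from assms(4) obtain B where "\<And>x. \<bar>f x\<bar> \<le> B" by (auto simp: bounded_iff)
  then have "sq_int M f" using assms(2) by (intro finite_measure.sq_int_bounded[OF fin])
  then show ?thesis using assms unfolding cont_approx_def by (auto intro!: exI[of _ f] simp: l2_def)
qed

text \<open>Dynkin induction from the open sets, which are stable under intersection. An open set is
  reached by truncated multiples of the distance to its complement, a disjoint union through finite
  partial unions; finiteness of the measure makes a constant a dominating function in both
  limits.\<close>

lemma cont_approx_indicator:
  assumes fin: "finite_measure N" and sets: "sets N = sets (restrict_space borel \<Omega>)" 
    and B: "B \<in> sets (borel :: 'a::metric_space measure)"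
  shows "cont_approx N (indicator B)"
proof -
  interpret finite_measure N by fact
  have bm: "f \<in> borel_measurable N" if "f \<in> borel_measurable borel" for f :: "'a \<Rightarrow> real"
    unfolding measurable_cong_sets[OF sets refl] by (rule measurable_restrict_space1) fact
  have sq: "sq_int N (indicator A)" if "A \<in> sets borel" for A
    by (rule sq_int_bounded[where B = 1], rule bm) (use that in \<open>auto simp: indicator_def\<close>)
  have one: "sq_int N (\<lambda>_. 1)"
    by (rule sq_int_bounded[where B = 1]) auto
  from B have B': "B \<in> sigma_sets UNIV {S. open S}" by (simp add: borel_def)
  have st: "Int_stable {S::'a set. open S}" by (auto simp: Int_stable_def)
  have "{S::'a set. open S} \<subseteq> Pow UNIV" by auto
  from st this B' show ?thesis
  proof (induction rule: sigma_sets_induct_disjoint)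
    fix U :: "'a set" assume "U \<in> {S. open S}"
    then have U: "open U" by simp
    show "cont_approx N (indicator U)"
    \<comment> \<open>The distance to the empty set is \<open>0\<close> by convention, so the full
      space needs its own case.\<close>
    proof (cases "U = UNIV")
      case True
      have "cont_approx N (\<lambda>_. 1)" by (rule cont_approx_continuous[OF fin]) auto
      with True show ?thesis by (simp add: indicator_def)
    next
      case False
      define g where "g n x = min 1 (real n * infdist x (- U))" for n x
      have gc: "continuous_on UNIV (g n)" for n
        unfolding g_def by (intro continuous_intros)
      have gb: "0 \<le> g n x" "g n x \<le> 1" for n x
        by (auto simp: g_def infdist_nonneg)
      have gm: "g n \<in> borel_measurable N" for n
        by (intro bm borel_measurable_continuous_onI gc)
      have ga: "cont_approx N (g n)" for n
        by (rule cont_approx_continuous[OF fin]) (use gm gc gb in \<open>auto simp: bounded_iff intro!: exI[of _ 1]\<close>)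
      have "(\<lambda>n. l2 N (\<lambda>x. g n x - indicator U x)) \<longlonglongrightarrow> 0"
      proof (rule l2_dominated_convergence[where g = "\<lambda>_. 1"])
        fix x
        show "(\<lambda>n. g n x) \<longlonglongrightarrow> indicator U x"
        proof (cases "x \<in> U")
          case True
          then have pos: "infdist x (- U) > 0"
            using infdist_pos_not_in_closed[of "- U" x] U False by auto
          obtain n0 where n0: "1 < real n0 * infdist x (- U)" 
            using ex_less_of_nat_mult[OF pos, of 1] by auto
          have "g n x = 1" if "n \<ge> n0" for n
          proof -
            have "real n0 * infdist x (- U) \<le> real n * infdist x (- U)"
              using that pos by (intro mult_right_mono) auto
            with n0 show ?thesis by (simp add: g_def)
          qed
          then have "\<forall>\<^sub>F n in sequentially. g n x = 1" using eventually_sequentially by blast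
          then show ?thesis using True by (simp add: tendsto_eventually)
        next
          case False
          then have "g n x = 0" for n by (simp add: g_def)
          with False show ?thesis by simp
        qed
        show "\<bar>g n x - indicator U x\<bar> \<le> 1" for n
          using gb[of n x] by (auto simp: indicator_def)
      qed (use gm sq one U in \<open>auto simp: sq_int_def\<close>)
      from cont_approx_lim[OF ga _ this] sq U show ?thesis by simp
    qed
  next
    have "(indicator {} :: 'a \<Rightarrow> real) = (\<lambda>_. 0)" by auto
    then show "cont_approx N (indicator {})"
      using cont_approx_cmult[of N _ 0] cont_approx_continuous[OF fin, of "\<lambda>_. 0"] by (simp add: indicator_def)
  next
    fix A :: "'a set" assume A: "A \<in> sigma_sets UNIV {S. open S}" "cont_approx N (indicator A)"
    have "cont_approx N (\<lambda>x. 1 + (- 1) * indicator A x)"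
      by (intro cont_approx_add cont_approx_cmult A) 
         (use cont_approx_continuous[OF fin, of "\<lambda>_. 1"] in auto)
    moreover have "(\<lambda>x. 1 + (- 1) * indicator A x) = (indicator (UNIV - A) :: 'a \<Rightarrow> real)"
      by (auto simp: indicator_def fun_eq_iff)
    ultimately show "cont_approx N (indicator (UNIV - A))" by simp
  next
    fix A :: "nat \<Rightarrow> 'a set"
    assume A: "disjoint_family A" "range A \<subseteq> sigma_sets UNIV {S. open S}" "\<And>i. cont_approx N (indicator (A i))"
    have Am: "A i \<in> sets borel" for i using A(2) by (auto simp: borel_def)
    have ca: "cont_approx N (indicator (\<Union>i<n. A i))" for n
    proof (induction n)
      case 0
      show ?case using cont_approx_continuous[OF fin, of "\<lambda>_. 0"] by (simp add: indicator_def)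
    next
      case (Suc n)
      have "cont_approx N (\<lambda>x. indicator (\<Union>i<n. A i) x + indicator (A n) x)"
        by (intro cont_approx_add Suc A)
      moreover have "(\<lambda>x. indicator (\<Union>i<n. A i) x + indicator (A n) x) = (indicator (\<Union>i<Suc n. A i) :: 'a \<Rightarrow> real)"
      proof
        fix x
        have "(\<Union>i<n. A i) \<inter> A n = {}"
          using A(1) by (auto simp: disjoint_family_on_def dest: less_imp_neq)
        then show "indicator (\<Union>i<n. A i) x + indicator (A n) x = (indicator (\<Union>i<Suc n. A i) x :: real)"
          unfolding lessThan_Suc UN_insert by (auto simp: indicator_def)
      qed
      ultimately show ?case by simp
    qed
    have "(\<lambda>n. l2 N (\<lambda>x. indicator (\<Union>i<n. A i) x - indicator (\<Union>i. A i) x)) \<longlonglongrightarrow> 0"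
    proof (rule l2_dominated_convergence[where g = "\<lambda>_. 1"])
      fix x
      show "(\<lambda>n. indicator (\<Union>i<n. A i) x) \<longlonglongrightarrow> (indicator (\<Union>i. A i) x :: real)"
        by (rule LIMSEQ_indicator_UN)
      show "\<bar>indicator (\<Union>i<n. A i) x - indicator (\<Union>i. A i) x\<bar> \<le> (1::real)" for n
        by (auto simp: indicator_def)
    next
      show "(indicator (\<Union>i<n. A i) :: 'a \<Rightarrow> real) \<in> borel_measurable N" for n 
        by (rule bm) (use Am in auto)
      show "(indicator (\<Union>i. A i) :: 'a \<Rightarrow> real) \<in> borel_measurable N" 
        by (rule bm) (use Am in auto)
    qed (rule one)
    from cont_approx_lim[OF ca _ this] sq Am show "cont_approx N (indicator (\<Union>i. A i))" by auto
  qed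
qed

text \<open>Simple functions are linear combinations of indicators. The approximating sequence
  satisfies \<open>\<bar>F i x\<bar> \<le> 2 * \<bar>f x\<bar>\<close>, hence
  \<open>3 * \<bar>f x\<bar>\<close> dominates the differences.\<close>

lemma cont_approx_sq_int:
  fixes f :: "'a::metric_space \<Rightarrow> real"
  assumes fin: "finite_measure N" and sets: "sets N = sets (restrict_space borel \<Omega>)" and f: "sq_int N f"
  shows "cont_approx N f"
proof -
  interpret finite_measure N by fact
  have simp: "cont_approx N s" if s: "simple_function N s" for s :: "'a \<Rightarrow> real"
  proof -
    have ind: "cont_approx N (indicator A)" if "A \<in> sets N" for A
    proof -
      from that obtain B where B: "B \<in> sets borel" "A = \<Omega> \<inter> B"
        unfolding sets by (auto simp: sets_restrict_space)
      have sp: "space N = \<Omega>" using sets_eq_imp_space_eq[OF sets] by (simp add: space_restrict_space)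
      have eq: "indicator A x = (indicator B x :: real)" if "x \<in> space N" for x
        using that sp B by (auto simp: indicator_def)
      have B': "cont_approx N (indicator B)" by (rule cont_approx_indicator[OF fin sets B(1)])
      have "(indicator A :: 'a \<Rightarrow> real) \<in> borel_measurable N" using that by simp
      moreover have "(LINT x|N. (indicator A x - g x)\<^sup>2) = (LINT x|N. (indicator B x - g x)\<^sup>2)" for g :: "'a \<Rightarrow> real"
        by (intro Bochner_Integration.integral_cong) (auto simp: eq)
      moreover have "integrable N (\<lambda>x. (indicator A x :: real)\<^sup>2) = integrable N (\<lambda>x. (indicator B x :: real)\<^sup>2)"
        by (intro Bochner_Integration.integrable_cong) (auto simp: eq)
      ultimately show ?thesis using B' by (simp add: cont_approx_def sq_int_def l2_def)
    qed
    have sum: "cont_approx N (\<lambda>x. \<Sum>y\<in>Y. y * indicator (s -` {y} \<inter> space N) x)" if "finite Y" for Y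
      using that
    proof (induction Y)
      case empty
      show ?case using cont_approx_continuous[OF fin, of "\<lambda>_. 0"] by simp
    next
      case (insert y Y)
      have "cont_approx N (\<lambda>x. y * indicator (s -` {y} \<inter> space N) x + (\<Sum>y\<in>Y. y * indicator (s -` {y} \<inter> space N) x))"
        by (intro cont_approx_add cont_approx_cmult ind insert.IH simple_functionD(2)[OF s])
      then show ?case by (simp only: sum.insert[OF insert.hyps])
    qed
    have eq: "s x = (\<Sum>y\<in>s ` space N. y * indicator (s -` {y} \<inter> space N) x)" if "x \<in> space N" for x
      by (rule trans[OF simple_function_indicator_representation_banach[OF s that]])
        (intro sum.cong refl, simp only: real_scaleR_def mult.commute)
    let ?s = "\<lambda>x. \<Sum>y\<in>s ` space N. y * indicator (s -` {y} \<inter> space N) x"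
    have c: "cont_approx N ?s" by (rule sum[OF simple_functionD(1)[OF s]])
    have "s \<in> borel_measurable N" using s by (rule borel_measurable_simple_function)
    moreover have "(LINT x|N. (s x - g x)\<^sup>2) = (LINT x|N. (?s x - g x)\<^sup>2)" for g :: "'a \<Rightarrow> real"
      by (intro Bochner_Integration.integral_cong refl arg_cong2[where f = power] arg_cong2[where f = minus] eq) auto
    moreover have "integrable N (\<lambda>x. (s x)\<^sup>2) = integrable N (\<lambda>x. (?s x)\<^sup>2)"
      by (intro Bochner_Integration.integrable_cong refl arg_cong2[where f = power] eq) auto
    ultimately show ?thesis using c by (simp add: cont_approx_def sq_int_def l2_def)
  qed
  from f have fm: "f \<in> borel_measurable N" by (simp add: sq_int_def)
  from borel_measurable_implies_sequence_metric[OF fm, of 0] obtain F where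
    F: "\<And>i. simple_function N (F i)" "\<And>x. x \<in> space N \<Longrightarrow> (\<lambda>i. F i x) \<longlonglongrightarrow> f x"
     "\<And>i x. x \<in> space N \<Longrightarrow> dist (F i x) 0 \<le> 2 * dist (f x) 0" by blast
  have "(\<lambda>i. l2 N (\<lambda>x. F i x - f x)) \<longlonglongrightarrow> 0"
  proof (rule l2_dominated_convergence[where g = "\<lambda>x. 3 * \<bar>f x\<bar>"])
    show "sq_int N (\<lambda>x. 3 * \<bar>f x\<bar>)" using fm by (intro sq_int_bound[OF f, where c = 3]) auto
    show "\<bar>F i x - f x\<bar> \<le> 3 * \<bar>f x\<bar>" if "x \<in> space N" for i x using F(3)[OF that, of i] by simp
  qed (use F(2) fm in \<open>auto intro: borel_measurable_simple_function[OF F(1)]\<close>)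
  from cont_approx_lim[OF simp[OF F(1)] f this] show ?thesis .
qed


section \<open>Simplices and their facets\<close>

lemma span_Rn: "span (unit_vec ` {..<d}) = Rn d"
proof
  show "span (unit_vec ` {..<d}) \<subseteq> Rn d"
    by (rule span_minimal) (auto simp: Rn_subspace)
  show "Rn d \<subseteq> span (unit_vec ` {..<d})"
  proof
    fix x assume "x \<in> Rn d"
    from Rn_expand[OF this] show "x \<in> span (unit_vec ` {..<d})"
      by (metis (no_types, lifting) imageI span_base span_scale span_sum)
  qed
qed

lemma affine_Rn: "affine (Rn d)"
  using Rn_subspace by (rule subspace_imp_affine)

text \<open>A vector outside the span would give \<open>d + 1\<close> independent vectors inside the
  span of \<open>d\<close> unit vectors.\<close>

lemma independent_span_Rn:
  assumes "independent V" "V \<subseteq> Rn d" "card V = d" "finite V"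
  shows "span V = Rn d"
proof
  show "span V \<subseteq> Rn d" by (rule span_minimal) (use assms Rn_subspace in auto)
  show "Rn d \<subseteq> span V"
  proof
    fix x assume x: "x \<in> Rn d"
    show "x \<in> span V"
    proof (rule ccontr)
      assume nx: "x \<notin> span V"
      then have "independent (insert x V)" using assms(1) by (simp add: independent_insert)
      moreover have "insert x V \<subseteq> span (unit_vec ` {..<d})" using x assms(2) by (simp add: span_Rn)
      ultimately have "card (insert x V) \<le> card (unit_vec ` {..<d})"
        using independent_span_bound[of "unit_vec ` {..<d}"] by blast
      also have "\<dots> \<le> d" using card_image_le[of "{..<d}" unit_vec] by simp
      moreover have "x \<notin> V" using nx span_base by blast
      ultimately show False using assms(3,4) by simp
    qed
  qed
qed

lemma affine_hull_eq_Rn: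
  assumes P: "P \<subseteq> Rn d" "card P = d + 1" "\<not> affine_dependent P"
  shows "affine hull P = Rn d"
proof
  show "affine hull P \<subseteq> Rn d" by (rule hull_minimal) (use P affine_Rn in auto)
  have fin: "finite P" using P(2) by (intro card_ge_0_finite) simp
  obtain a where a: "a \<in> P" using P(2) by force
  let ?V = "(\<lambda>x. -a + x) ` (P - {a})"
  have "independent ?V" using P(3) affine_dependent_iff_dependent2[OF a] by blast
  moreover have "card ?V = d" using P(2) a fin by (subst card_image) auto
  moreover have "?V \<subseteq> Rn d" using P(1) a by (auto simp: subset_iff)
  ultimately have V: "span ?V = Rn d" using fin by (intro independent_span_Rn) auto
  show "Rn d \<subseteq> affine hull P"
  proof
    fix x assume x: "x \<in> Rn d"
    have "x - a \<in> span ?V" unfolding V using x a P(1) by (intro Rn_closure) auto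
    then show "x \<in> affine hull P" unfolding affine_hull_span2[OF a]
      by (intro image_eqI[of _ _ "x - a"]) auto
  qed
qed

text \<open>Steinitz exchange after one point of each set is translated to the origin. Applied in
  both directions it shows that a facet, whose dimension is prescribed by an abstract affine basis,
  has exactly \<open>d\<close> vertices.\<close>

lemma affine_basis_card_le:
  assumes S: "\<not> affine_dependent S" "finite S" and T: "\<not> affine_dependent T" "finite T" "T \<noteq> {}" "S \<noteq> {}"
    and sub: "T \<subseteq> affine hull S"
  shows "card T \<le> card S"
proof -
  obtain s t where s: "s \<in> S" and t: "t \<in> T" using T by blast
  let ?V = "(\<lambda>x. -s + x) ` (S - {s})" and ?W = "(\<lambda>x. -t + x) ` (T - {t})"
  have W: "independent ?W" using T(1) affine_dependent_iff_dependent2[OF t] by blast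
  have in_span: "x - s \<in> span ?V" if "x \<in> T" for x
    using sub that unfolding affine_hull_span2[OF s] by force
  have "?W \<subseteq> span ?V"
  proof
    fix w assume "w \<in> ?W"
    then obtain x where "x \<in> T" and w: "w = - t + x" by blast
    then have "(x - s) - (t - s) \<in> span ?V" by (intro span_diff in_span t)
    moreover have "(x - s) - (t - s) = - t + x" by simp
    ultimately show "w \<in> span ?V" unfolding w by (simp only:)
  qed
  from independent_span_bound[OF _ W this] have "card ?W \<le> card ?V" using S by simp
  moreover have "card ?V = card S - 1" using s S by (subst card_image) auto
  moreover have "card ?W = card T - 1" using t T by (subst card_image) auto
  moreover have "card S > 0" "card T > 0" using S T by auto
  ultimately show ?thesis by linarith
qed

text \<open>Gram-Schmidt in the direction space of the hull, with \<open>b\<close> as origin. The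
  lemma guarantees that the \<open>SOME\<close> in \<open>surface_measure\<close> selects a genuine
  isometry.\<close>

lemma ex_isometry_onto_affine_hull:
  assumes B: "\<not> affine_dependent B" "card B = Suc k"
  shows "\<exists>\<phi>. isometry_onto k (affine hull B) \<phi>"
proof -
  have fin: "finite B" using B(2) by (intro card_ge_0_finite) simp
  obtain b where b: "b \<in> B" using B(2) by force
  let ?V = "(\<lambda>x. -b + x) ` (B - {b})"
  have V: "independent ?V" using B(1) affine_dependent_iff_dependent2[OF b] by blast
  have cV: "card ?V = k" "finite ?V" using B(2) b fin by (auto simp: card_image)
  obtain C0 where C0: "finite C0" "card C0 \<le> card ?V" "span C0 = span ?V" "pairwise orthogonal C0"
    using basis_orthogonal[OF cV(2)] by blast
  \<comment> \<open>The orthogonal spanning set may contain \<open>0\<close>, which has to go before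
    normalising; comparison with the independent set \<open>?V\<close> then shows that exactly
    \<open>k\<close> vectors remain.\<close>
  define C where "C = C0 - {0}"
  have C: "finite C" "card C \<le> k" "span C = span ?V" "pairwise orthogonal C" "0 \<notin> C"
  proof -
    show "finite C" "0 \<notin> C" using C0(1) by (auto simp: C_def)
    show "pairwise orthogonal C" by (rule pairwise_subset[OF C0(4)]) (auto simp: C_def)
    show "span C = span ?V" unfolding C_def span_delete_0 by (rule C0(3))
    have "card C \<le> card C0" unfolding C_def by (rule card_mono) (use C0 in auto)
    then show "card C \<le> k" using C0(2) cV by simp
  qed
  have "card ?V \<le> card C" 
  proof -
    have "?V \<subseteq> span C" unfolding C(3) by (rule span_superset)
    from independent_span_bound[OF C(1) V this] show ?thesis by blast
  qed
  then have "card C = k" using C cV by simp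
  then obtain e where e: "bij_betw e {..<k} C"
    using ex_bij_betw_nat_finite[OF C(1)] by (auto simp: atLeast0LessThan)
  have e0: "e i \<noteq> 0" if "i < k" for i using e C(5) that by (auto simp: bij_betw_def)
  define c where "c i = e i /\<^sub>R norm (e i)" for i
  have nc: "norm (c i) = 1" if "i < k" for i using e0[OF that] by (simp add: c_def)
  have orth: "orthogonal (c i) (c j)" if "i < k" "j < k" "i \<noteq> j" for i j
  proof -
    have "e i \<in> C" "e j \<in> C" "e i \<noteq> e j" using e that by (auto simp: bij_betw_def inj_on_def)
    then show ?thesis using C(4) by (auto simp: c_def pairwise_def orthogonal_def)
  qed
  define \<phi> where "\<phi> x = b + (\<Sum>i<k. coord x i *\<^sub>R c i)" for x
  have "isometry_onto k (affine hull B) \<phi>"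
    unfolding isometry_onto_def
  proof (intro conjI ballI)
    fix x y assume xy: "x \<in> Rn k" "y \<in> Rn k"
    have "\<phi> x - \<phi> y = (\<Sum>i<k. coord (x - y) i *\<^sub>R c i)"
      by (simp add: \<phi>_def sum_subtractf scaleR_diff_left)
    also have "(norm (\<Sum>i<k. coord (x - y) i *\<^sub>R c i))\<^sup>2 = (\<Sum>i<k. (norm (coord (x - y) i *\<^sub>R c i))\<^sup>2)"
      by (rule norm_sum_Pythagorean) (use orth in \<open>auto simp: pairwise_def orthogonal_def\<close>)
    also have "\<dots> = (\<Sum>i<k. (coord (x - y) i)\<^sup>2)"
      by (intro sum.cong) (auto simp: nc)
    finally have "norm (\<phi> x - \<phi> y) = sqrt (\<Sum>i<k. (coord (x - y) i)\<^sup>2)" 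
      by (simp add: real_sqrt_unique)
    then show "dist (\<phi> x) (\<phi> y) = dist x y"
      using norm_Rn[of "x - y" k] xy by (simp add: dist_norm)
  next
    have cs: "c i \<in> span C" if "i < k" for i
      using e that unfolding c_def by (intro span_scale span_base) (auto simp: bij_betw_def)
    show "\<phi> ` Rn k = affine hull B"
    proof safe
      fix x assume "x \<in> Rn k"
      have "(\<Sum>i<k. coord x i *\<^sub>R c i) \<in> span ?V"
        unfolding C(3)[symmetric] by (intro span_sum span_scale cs) auto
      then show "\<phi> x \<in> affine hull B" unfolding affine_hull_span2[OF b] \<phi>_def by auto
    next
      fix y assume "y \<in> affine hull B"
      then obtain v where v: "v \<in> span C" "y = b + v" unfolding affine_hull_span2[OF b] C(3) by auto
      then obtain u where u: "v = (\<Sum>w\<in>C. u w *\<^sub>R w)" using span_finite[OF C(1)] by auto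
      define x where "x = (\<Sum>i<k. (u (e i) * norm (e i)) *\<^sub>R unit_vec i)"
      have x: "x \<in> Rn k" unfolding x_def by (intro Rn_sum Rn_closure) auto
      have cx: "coord x i = u (e i) * norm (e i)" if "i < k" for i
        using that by (simp add: x_def coord_sum if_distrib cong: if_cong)
      have "v = (\<Sum>i<k. u (e i) *\<^sub>R e i)" unfolding u by (rule sum.reindex_bij_betw[OF e, symmetric])
      also have "\<dots> = (\<Sum>i<k. coord x i *\<^sub>R c i)"
        by (intro sum.cong) (auto simp: cx c_def e0)
      finally have "y = \<phi> x" using v by (simp add: \<phi>_def)
      with x show "y \<in> \<phi> ` Rn k" by blast
    qed
  qed
  then show ?thesis by blast
qed

text \<open>By polarisation \<open>\<psi>\<close> preserves inner products, since it preserves norms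
  and distances; expanding the squared norm of the additivity or homogeneity defect then gives
  \<open>0\<close>. The isometry in the surface measure is an arbitrary choice known only through
  distances, and this recovers its linear structure.\<close>

lemma isometry_onto_affine:
  assumes iso: "isometry_onto k H \<phi>"
  defines "\<psi> \<equiv> \<lambda>x. \<phi> x - \<phi> 0"
  shows "\<And>x. x \<in> Rn k \<Longrightarrow> norm (\<psi> x) = norm x"
    and "\<And>x y. x \<in> Rn k \<Longrightarrow> y \<in> Rn k \<Longrightarrow> \<psi> (x + y) = \<psi> x + \<psi> y"
    and "\<And>x c. x \<in> Rn k \<Longrightarrow> \<psi> (c *\<^sub>R x) = c *\<^sub>R \<psi> x"
proof -
  have d: "norm (\<psi> x - \<psi> y) = norm (x - y)" if "x \<in> Rn k" "y \<in> Rn k" for x y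
    using iso that by (auto simp: isometry_onto_def \<psi>_def dist_norm)
  show n: "norm (\<psi> x) = norm x" if "x \<in> Rn k" for x
    using d[OF that, of 0] by (simp add: \<psi>_def)
  have i: "\<psi> x \<bullet> \<psi> y = x \<bullet> y" if "x \<in> Rn k" "y \<in> Rn k" for x y
  proof -
    have "(norm (\<psi> x - \<psi> y))\<^sup>2 = (norm (x - y))\<^sup>2" using d[OF that] by simp
    moreover have "(norm (\<psi> x))\<^sup>2 = (norm x)\<^sup>2" "(norm (\<psi> y))\<^sup>2 = (norm y)\<^sup>2" using n that by auto
    ultimately show ?thesis
      by (simp add: power2_norm_eq_inner inner_diff_left inner_diff_right inner_commute)
  qed
  show "\<psi> (x + y) = \<psi> x + \<psi> y" if "x \<in> Rn k" "y \<in> Rn k" for x y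
  proof -
    have "(norm (\<psi> (x + y) - \<psi> x - \<psi> y))\<^sup>2 = (norm (x + y - x - y))\<^sup>2"
      unfolding power2_norm_eq_inner using that
      by (simp add: inner_diff_left inner_diff_right inner_add_left inner_add_right i)
    then show ?thesis by (simp add: algebra_simps)
  qed
  show "\<psi> (c *\<^sub>R x) = c *\<^sub>R \<psi> x" if "x \<in> Rn k" for x c
  proof -
    have "(norm (\<psi> (c *\<^sub>R x) - c *\<^sub>R \<psi> x))\<^sup>2 = (norm (c *\<^sub>R x - c *\<^sub>R x))\<^sup>2"
      unfolding power2_norm_eq_inner using that
      by (simp add: inner_diff_left inner_diff_right i)
    then show ?thesis by simp
  qed
qed

text \<open>\<open>\<kappa> p + m p \<bullet> x\<close> is the barycentric coordinate of \<open>x\<close> at the vertex \<open>p\<close>.\<close>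

lemma ex_barycentric:
  assumes P: "P \<subseteq> Rn d" "card P = d + 1" "\<not> affine_dependent P"
  shows "\<exists>m \<kappa>. (\<forall>p\<in>P. m p \<in> Rn d) \<and>
    (\<forall>x\<in>Rn d. (\<Sum>p\<in>P. \<kappa> p + m p \<bullet> x) = 1 \<and> (\<Sum>p\<in>P. (\<kappa> p + m p \<bullet> x) *\<^sub>R p) = x) \<and>
    (\<forall>u. sum u P = 1 \<longrightarrow> (\<forall>p\<in>P. \<kappa> p + m p \<bullet> (\<Sum>q\<in>P. u q *\<^sub>R q) = u p))"
proof -
  have fin: "finite P" using P(2) by (intro card_ge_0_finite) simp
  have "\<exists>u. sum u P = 1 \<and> (\<Sum>v\<in>P. u v *\<^sub>R v) = x" if "x \<in> Rn d" for x
    using that affine_hull_eq_Rn[OF P] affine_hull_finite[OF fin] by auto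
  then obtain \<beta> where \<beta>: "\<And>x. x \<in> Rn d \<Longrightarrow> sum (\<beta> x) P = 1" "\<And>x. x \<in> Rn d \<Longrightarrow> (\<Sum>v\<in>P. \<beta> x v *\<^sub>R v) = x"
    by metis
  have uniq: "\<beta> x p = u p" if "x \<in> Rn d" "sum u P = 1" "(\<Sum>v\<in>P. u v *\<^sub>R v) = x" "p \<in> P" for x u p
  proof -
    have "sum (\<lambda>v. \<beta> x v - u v) P = 0" "(\<Sum>v\<in>P. (\<beta> x v - u v) *\<^sub>R v) = 0"
      using that \<beta> by (auto simp: sum_subtractf scaleR_diff_left)
    then show ?thesis using affine_dependent_explicit_finite[OF fin] P(3) that(4) by fastforce
  qed
  \<comment> \<open>Barycentric coordinates are affine functions, so \<open>m p\<close> is a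
    gradient: its entries are the increments from the origin to the unit vectors.\<close>
  define m where "m p = (\<Sum>i<d. (\<beta> (unit_vec i) p - \<beta> 0 p) *\<^sub>R unit_vec i)" for p
  define \<kappa> where "\<kappa> p = \<beta> 0 p" for p
  have mx: "\<kappa> p + m p \<bullet> x = \<beta> x p" if x: "x \<in> Rn d" and p: "p \<in> P" for x p
  proof -
    \<comment> \<open>The affine interpolant of the values at \<open>0\<close> and at the unit
      vectors. Its weights again sum to one and represent \<open>x\<close>, so uniqueness identifies
      it with \<open>\<beta> x\<close>.\<close>
    let ?u = "\<lambda>p. \<beta> 0 p + (\<Sum>i<d. coord x i * (\<beta> (unit_vec i) p - \<beta> 0 p))"
    have "\<beta> x p = ?u p"
    proof (rule uniq[OF x _ _ p])
      have "sum ?u P = sum (\<beta> 0) P + (\<Sum>i<d. coord x i * (sum (\<beta> (unit_vec i)) P - sum (\<beta> 0) P))"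
        unfolding sum.distrib by (subst sum.swap) (simp add: sum_distrib_left sum_subtractf right_diff_distrib)
      then show "sum ?u P = 1" by (simp add: \<beta>)
      have "(\<Sum>v\<in>P. ?u v *\<^sub>R v) = (\<Sum>v\<in>P. \<beta> 0 v *\<^sub>R v) + (\<Sum>i<d. coord x i *\<^sub>R ((\<Sum>v\<in>P. \<beta> (unit_vec i) v *\<^sub>R v) - (\<Sum>v\<in>P. \<beta> 0 v *\<^sub>R v)))"
        unfolding scaleR_add_left sum.distrib scaleR_sum_left
        by (subst sum.swap) (simp add: scaleR_sum_right sum_subtractf scaleR_diff_left scaleR_diff_right right_diff_distrib)
      also have "\<dots> = x" using Rn_expand[OF x] by (simp add: \<beta>)
      finally show "(\<Sum>v\<in>P. ?u v *\<^sub>R v) = x" .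
    qed
    also have "\<dots> = \<kappa> p + m p \<bullet> x"
      by (simp add: m_def \<kappa>_def inner_sum_left mult.commute)
    finally show ?thesis by simp
  qed
  show ?thesis
  proof (intro exI conjI ballI allI impI)
    show "m p \<in> Rn d" for p unfolding m_def by (intro Rn_sum Rn_closure) auto
    show "(\<Sum>p\<in>P. \<kappa> p + m p \<bullet> x) = 1" if "x \<in> Rn d" for x using mx \<beta> that by simp
    show "(\<Sum>p\<in>P. (\<kappa> p + m p \<bullet> x) *\<^sub>R p) = x" if "x \<in> Rn d" for x using mx \<beta> that by simp
    fix u p assume u: "sum u P = (1::real)" and p: "p \<in> P"
    have "(\<Sum>q\<in>P. u q *\<^sub>R q) \<in> Rn d" using P(1) by (intro Rn_sum Rn_closure) auto
    then show "\<kappa> p + m p \<bullet> (\<Sum>q\<in>P. u q *\<^sub>R q) = u p" using mx uniq u p by simp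
  qed
qed

text \<open>Barycentric coordinates enter as data. They turn the closed simplex, its interior and
  its facets into explicit systems of linear equations and inequalities.\<close>

locale bary_simplex =
  fixes d :: nat and P :: "fvec set" and m :: "fvec \<Rightarrow> fvec" and \<kappa> :: "fvec \<Rightarrow> real" and \<tau> :: "fvec set"
  assumes P: "P \<subseteq> Rn d" "card P = d + 1" "\<not> affine_dependent P"
    and m_Rn: "\<And>p. p \<in> P \<Longrightarrow> m p \<in> Rn d"
    and bary_sum: "\<And>x. x \<in> Rn d \<Longrightarrow> (\<Sum>p\<in>P. \<kappa> p + m p \<bullet> x) = 1"
    and bary_comb: "\<And>x. x \<in> Rn d \<Longrightarrow> (\<Sum>p\<in>P. (\<kappa> p + m p \<bullet> x) *\<^sub>R p) = x"
    and bary_unique: "\<And>u p. sum u P = 1 \<Longrightarrow> p \<in> P \<Longrightarrow> \<kappa> p + m p \<bullet> (\<Sum>q\<in>P. u q *\<^sub>R q) = u p"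
    and \<tau>_def: "\<tau> = rel_interior (convex hull P)"
begin

definition "\<beta> p x = \<kappa> p + m p \<bullet> x"
definition "K = convex hull P"

lemma finite_P: "finite P" using P(2) by (intro card_ge_0_finite) simp

lemma \<beta>_line: "\<beta> p (x + t *\<^sub>R (y - x)) = (1 - t) * \<beta> p x + t * \<beta> p y"
  by (simp add: \<beta>_def inner_add_right inner_diff_right algebra_simps)

lemma \<beta>_vertex: "p \<in> P \<Longrightarrow> q \<in> P \<Longrightarrow> \<beta> p q = (if p = q then 1 else 0)"
  using bary_unique[of "\<lambda>r. if r = q then 1 else 0" p] finite_P
  by (simp add: \<beta>_def if_distrib[of "\<lambda>c. c *\<^sub>R _"] cong: if_cong)

lemma K_eq: "K = {x \<in> Rn d. \<forall>p\<in>P. \<beta> p x \<ge> 0}"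
proof safe
  fix x assume "x \<in> K"
  then obtain u where u: "\<And>p. p \<in> P \<Longrightarrow> 0 \<le> u p" "sum u P = 1" "x = (\<Sum>p\<in>P. u p *\<^sub>R p)"
    unfolding K_def convex_hull_finite[OF finite_P] by auto
  show "x \<in> Rn d" unfolding u(3) using P(1) by (intro Rn_sum Rn_closure) auto
  show "\<beta> p x \<ge> 0" if "p \<in> P" for p using bary_unique[OF u(2) that] u(1)[OF that] u(3) by (simp add: \<beta>_def)
next
  fix x assume "x \<in> Rn d" "\<forall>p\<in>P. \<beta> p x \<ge> 0"
  then show "x \<in> K" unfolding K_def convex_hull_finite[OF finite_P]
    using bary_sum[of x] bary_comb[of x] by (auto simp: \<beta>_def intro!: exI[of _ "\<lambda>p. \<kappa> p + m p \<bullet> x"])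
qed

lemma K_subset: "K \<subseteq> Rn d" by (auto simp: K_eq)
lemma compact_K: "compact K" unfolding K_def by (rule finite_imp_compact_convex_hull[OF finite_P])
lemma vertex_K: "p \<in> P \<Longrightarrow> p \<in> K" unfolding K_def by (rule hull_inc)

lemma affine_hull_K: "affine hull K = Rn d"
  unfolding K_def by (simp add: affine_hull_eq_Rn[OF P])

text \<open>Strict inequalities cut out a relatively open subset of \<open>K\<close>, which gives
  one inclusion. Conversely, if \<open>\<beta> p x = 0\<close>, then a small move from
  \<open>x\<close> away from the vertex \<open>p\<close> makes this coordinate negative and leaves
  \<open>K\<close>, whereas a relative interior point allows such a move.\<close>

lemma \<tau>_eq: "\<tau> = {x \<in> Rn d. \<forall>p\<in>P. \<beta> p x > 0}" (is "_ = ?O")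
proof
  have "open (\<Inter>p\<in>P. {x. \<beta> p x > 0})"
    unfolding \<beta>_def by (intro open_INT finite_P ballI open_Collect_less continuous_intros)
  moreover have "?O = Rn d \<inter> (\<Inter>p\<in>P. {x. \<beta> p x > 0})" by auto
  ultimately have "openin (top_of_set (affine hull K)) ?O"
    unfolding affine_hull_K by (metis openin_open_Int)
  then show "?O \<subseteq> \<tau>" unfolding \<tau>_def K_def[symmetric] by (intro rel_interior_maximal) (auto simp: K_eq less_imp_le)
  show "\<tau> \<subseteq> ?O"
  proof
    fix x assume x: "x \<in> \<tau>"
    then have xK: "x \<in> K" using rel_interior_subset \<tau>_def K_def by blast
    from x obtain e where e: "e > 0" "ball x e \<inter> Rn d \<subseteq> K"
      unfolding \<tau>_def K_def[symmetric] mem_rel_interior_ball affine_hull_K by blast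
    have "\<beta> p x > 0" if p: "p \<in> P" for p
    proof (rule ccontr)
      assume "\<not> \<beta> p x > 0"
      then have b0: "\<beta> p x = 0" using xK p by (force simp: K_eq)
      define s where "s = e / (2 * (norm (p - x) + 1))"
      have np: "norm (p - x) + 1 > 0" by (simp add: add_nonneg_pos)
      have s: "s > 0" "s * norm (p - x) < e"
      proof -
        show "s > 0" using e np by (simp add: s_def)
        have "s * norm (p - x) \<le> s * (norm (p - x) + 1)" using \<open>s > 0\<close> by simp
        also have "\<dots> = e / 2" using np unfolding s_def by (simp only: times_divide_eq_left) (simp add: field_simps)
        finally show "s * norm (p - x) < e" using e by simp
      qed
      have "x + (- s) *\<^sub>R (p - x) \<in> ball x e \<inter> Rn d"
        using s subsetD[OF K_subset xK] subsetD[OF P(1) p] by (simp add: dist_norm del: scaleR_minus_left)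
      then have "x + (- s) *\<^sub>R (p - x) \<in> K" using e(2) by blast
      then have "\<beta> p (x + (- s) *\<^sub>R (p - x)) \<ge> 0" using p unfolding K_eq by blast
      then show False unfolding \<beta>_line using s b0 \<beta>_vertex[OF p p] by simp
    qed
    then show "x \<in> ?O" using xK K_subset by auto
  qed
qed

lemma \<tau>_K: "\<tau> \<subseteq> K" by (auto simp: \<tau>_eq K_eq less_imp_le)

lemma openin_\<tau>: "openin (top_of_set (Rn d)) \<tau>"
  using openin_rel_interior[of K] unfolding affine_hull_K by (simp add: \<tau>_def K_def)

lemma ex_center: "\<exists>c. c \<in> \<tau>"
proof -
  \<comment> \<open>The barycentre: all \<open>d + 1\<close> vertices get the same positive
    weight.\<close>
  let ?u = "\<lambda>p::fvec. 1 / (real d + 1)"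
  have u1: "sum ?u P = 1" using P(2) by simp
  have "(\<Sum>p\<in>P. ?u p *\<^sub>R p) \<in> \<tau>"
    using bary_unique[OF u1] P(1) by (auto simp: \<tau>_eq \<beta>_def intro!: Rn_sum Rn_closure)
  then show ?thesis by blast
qed

text \<open>A proper contraction towards an interior point mixes in the positive coordinates of
  \<open>c\<close>. This fact yields the closure and the convexity of \<open>\<tau>\<close>, and
  later that its boundary is a null set.\<close>

lemma shrink: "c \<in> \<tau> \<Longrightarrow> x \<in> K \<Longrightarrow> 0 \<le> s \<Longrightarrow> s < 1 \<Longrightarrow> c + s *\<^sub>R (x - c) \<in> \<tau>"
  by (auto simp: \<tau>_eq K_eq \<beta>_line intro!: add_pos_nonneg mult_pos_pos)

lemma closure_\<tau>: "closure \<tau> = K"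
proof
  show "closure \<tau> \<subseteq> K" by (rule closure_minimal[OF \<tau>_K compact_imp_closed[OF compact_K]])
  show "K \<subseteq> closure \<tau>"
  proof
    fix x assume x: "x \<in> K"
    obtain c where c: "c \<in> \<tau>" using ex_center by blast
    show "x \<in> closure \<tau>"
      unfolding closure_sequential
    proof (intro exI conjI allI)
      show "c + (1 - inverse (real (Suc n))) *\<^sub>R (x - c) \<in> \<tau>" for n
        using c x by (intro shrink) (auto simp: field_simps)
      have "(\<lambda>n. c + (1 - inverse (real (Suc n))) *\<^sub>R (x - c)) \<longlonglongrightarrow> c + (1 - 0) *\<^sub>R (x - c)"
        by (intro tendsto_intros LIMSEQ_inverse_real_of_nat)
      then show "(\<lambda>n. c + (1 - inverse (real (Suc n))) *\<^sub>R (x - c)) \<longlonglongrightarrow> x" by simp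
    qed
  qed
qed

lemma bounded_\<tau>: "bounded \<tau>"
  using compact_imp_bounded[OF compact_K] \<tau>_K bounded_subset by blast

lemma convex_\<tau>: "convex \<tau>"
  unfolding convex_alt
proof (intro ballI allI impI)
  fix x y u assume xy: "x \<in> \<tau>" "y \<in> \<tau>" and u: "0 \<le> (u::real) \<and> u \<le> 1"
  show "(1 - u) *\<^sub>R x + u *\<^sub>R y \<in> \<tau>"
  proof (cases "u = 1")
    case True with xy show ?thesis by simp
  next
    case False
    with shrink[of x y u] xy u \<tau>_K have "x + u *\<^sub>R (y - x) \<in> \<tau>" by auto
    then show ?thesis by (simp add: algebra_simps)
  qed
qed

text \<open>A vertex \<open>p\<close> with positive weight in a point \<open>x \<noteq> p\<close> is
  an endpoint of an open segment of \<open>K\<close> through \<open>x\<close>, so the face property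
  puts \<open>p\<close> into \<open>F\<close>. Hence \<open>x\<close> is a convex combination of
  vertices in \<open>F\<close>.\<close>

lemma face_eq:
  assumes F: "F face_of K"
  shows "F = convex hull (F \<inter> P)"
proof
  show "convex hull (F \<inter> P) \<subseteq> F"
    using F by (intro hull_minimal) (auto simp: face_of_def)
  show "F \<subseteq> convex hull (F \<inter> P)"
  proof
    fix x assume x: "x \<in> F"
    then have xK: "x \<in> K" using F by (auto simp: face_of_def)
    then have xR: "x \<in> Rn d" using K_subset by auto
    have sup: "p \<in> F" if p: "p \<in> P" "\<beta> p x \<noteq> 0" for p
    proof (cases "x = p")
      case False
      have b: "\<beta> p x > 0" using xK p by (force simp: K_eq)
      \<comment> \<open>Full weight at \<open>p\<close> would make all other weights vanish and
        force \<open>x = p\<close>.\<close>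
      have "\<beta> p x \<noteq> 1"
      proof
        assume b1: "\<beta> p x = 1"
        have "(\<Sum>q\<in>P. \<beta> q x) = \<beta> p x + (\<Sum>q\<in>P-{p}. \<beta> q x)" by (rule sum.remove) (use finite_P p in auto)
        then have "(\<Sum>q\<in>P-{p}. \<beta> q x) = 0" using bary_sum[OF xR] b1 by (simp add: \<beta>_def)
        then have z: "\<forall>q\<in>P-{p}. \<beta> q x = 0"
          using xK finite_P by (subst (asm) sum_nonneg_eq_0_iff) (auto simp: K_eq)
        have "x = (\<Sum>q\<in>P. \<beta> q x *\<^sub>R q)" using bary_comb[OF xR] by (simp add: \<beta>_def)
        also have "\<dots> = \<beta> p x *\<^sub>R p + (\<Sum>q\<in>P-{p}. \<beta> q x *\<^sub>R q)" by (rule sum.remove) (use finite_P p in auto)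
        finally show False using z b1 False by simp
      qed
      moreover have "\<beta> p x \<le> 1"
      proof -
        have "\<beta> p x \<le> (\<Sum>q\<in>P. \<beta> q x)" using xK p finite_P by (intro member_le_sum) (auto simp: K_eq)
        then show ?thesis using bary_sum[OF xR] by (simp add: \<beta>_def)
      qed
      ultimately have b1: "\<beta> p x < 1" by simp
      \<comment> \<open>The ray from \<open>p\<close> through \<open>x\<close> loses its weight at
        \<open>p\<close> exactly at this parameter, so \<open>y\<close> is the point where it meets
        the side of \<open>K\<close> opposite to \<open>p\<close>.\<close>
      define t where "t = 1 / (1 - \<beta> p x)"
      define y where "y = p + t *\<^sub>R (x - p)"
      have t: "t > 0" using b1 by (simp add: t_def)
      have tb: "t * \<beta> p x = t - 1" using b1 by (simp add: t_def field_simps)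
      have yK: "y \<in> K"
        unfolding K_eq
      proof (intro CollectI conjI ballI)
        show "y \<in> Rn d" using xR P(1) p by (auto simp: y_def)
        show "\<beta> q y \<ge> 0" if q: "q \<in> P" for q
          using xK q p t tb by (cases "q = p") (auto simp: y_def \<beta>_line \<beta>_vertex K_eq)
      qed
      have "x = p + (1 - \<beta> p x) *\<^sub>R (y - p)" using b1 by (simp add: y_def t_def)
      then have "x = (1 - (1 - \<beta> p x)) *\<^sub>R p + (1 - \<beta> p x) *\<^sub>R y" by (simp add: algebra_simps)
      moreover have "p \<noteq> y" using False t by (simp add: y_def)
      ultimately have "x \<in> open_segment p y"
        unfolding in_segment using b b1 by (intro conjI exI[of _ "1 - \<beta> p x"]) auto
      then show ?thesis using face_ofD[OF F] vertex_K[OF p(1)] yK x by blast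
    qed (use x in simp)
    have z: "\<beta> p x = 0" if "p \<in> P - F \<inter> P" for p using sup that by blast
    have s1: "(\<Sum>p\<in>F\<inter>P. \<beta> p x) = 1"
      using bary_sum[OF xR] z by (subst sum.mono_neutral_left[OF finite_P]) (auto simp: \<beta>_def)
    have s2: "(\<Sum>p\<in>F\<inter>P. \<beta> p x *\<^sub>R p) = x"
      using bary_comb[OF xR] z by (subst sum.mono_neutral_left[OF finite_P]) (auto simp: \<beta>_def)
    show "x \<in> convex hull (F \<inter> P)"
      unfolding convex_hull_finite[OF finite_subset[OF Int_lower2 finite_P]]
      using s1 s2 xK by (intro CollectI exI[of _ "\<lambda>p. \<beta> p x"]) (auto simp: K_eq)
  qed
qed

text \<open>The facet is the hull of its vertices and shares its affine hull with the
  \<open>d\<close> independent points of \<open>B\<close>, so it contains all vertices but one. That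
  vertex is the apex \<open>a\<close>, and vanishing of its weight describes both the facet and its
  hyperplane.\<close>

lemma facet_eq:
  assumes F: "simplex_facet d \<tau> F" and d: "d \<ge> 1"
  shows "\<exists>a\<in>P. F = {x \<in> K. \<beta> a x = 0} \<and> affine hull F = {x \<in> Rn d. \<beta> a x = 0}"
proof -
  from F obtain B where F': "F face_of K" and B: "affine hull B = affine hull F" "\<not> affine_dependent B" "card B = d"
    unfolding simplex_facet_def closure_\<tau> by blast
  define Q where "Q = F \<inter> P"
  have FQ: "F = convex hull Q" using face_eq[OF F'] by (simp add: Q_def)
  have Qf: "finite Q" using finite_P by (simp add: Q_def)
  have Qi: "\<not> affine_dependent Q" using P(3) by (rule affine_independent_subset) (simp add: Q_def)
  have hull: "affine hull B = affine hull Q" using B FQ by simp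
  have Bf: "finite B" "B \<noteq> {}" using B(3) d by (auto intro: card_ge_0_finite)
  have Qn: "Q \<noteq> {}" using hull Bf by (metis affine_hull_eq_empty)
  have "card Q = d"
    using affine_basis_card_le[OF Qi Qf B(2) Bf Qn] affine_basis_card_le[OF B(2) Bf(1) Qi Qf Qn Bf(2)]
      hull hull_subset[of Q affine] hull_subset[of B affine] B(3) by auto
  then have "card (P - Q) = 1" using P(2) by (subst card_Diff_subset[OF Qf]) (auto simp: Q_def)
  then obtain a where a: "P - Q = {a}" by (auto simp: card_1_singleton_iff)
  then have aP: "a \<in> P" and Q: "Q = P - {a}" by (auto simp: Q_def)
  have split: "(\<Sum>p\<in>P. f p) = f a + (\<Sum>p\<in>Q. f p)" for f :: "fvec \<Rightarrow> 'z::comm_monoid_add"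
    unfolding Q by (rule sum.remove[OF finite_P aP])
  have comb: "(\<Sum>p\<in>Q. \<beta> p x) = 1 \<and> (\<Sum>p\<in>Q. \<beta> p x *\<^sub>R p) = x" if "x \<in> Rn d" "\<beta> a x = 0" for x
    using bary_sum[OF that(1)] bary_comb[OF that(1)] split[of "\<lambda>p. \<beta> p x"] split[of "\<lambda>p. \<beta> p x *\<^sub>R p"] that(2)
    by (simp add: \<beta>_def)
  have zero: "\<beta> a (\<Sum>p\<in>Q. u p *\<^sub>R p) = 0" if "sum u Q = 1" for u
  proof -
    \<comment> \<open>Extension by weight \<open>0\<close> at the apex makes uniqueness of
      barycentric coordinates applicable.\<close>
    let ?u = "\<lambda>p. if p = a then 0 else u p"
    have "sum ?u P = 1" unfolding split using that by (simp add: Q if_distrib cong: if_cong)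
    from bary_unique[OF this aP] have "\<beta> a (\<Sum>q\<in>P. ?u q *\<^sub>R q) = 0" by (simp add: \<beta>_def)
    also have "(\<Sum>q\<in>P. ?u q *\<^sub>R q) = (\<Sum>p\<in>Q. u p *\<^sub>R p)"
      unfolding split by (simp add: Q)
    finally show ?thesis .
  qed
  have Rn_Q: "(\<Sum>p\<in>Q. u p *\<^sub>R p) \<in> Rn d" for u using P(1) by (intro Rn_sum Rn_closure) (auto simp: Q)
  have "F = {x \<in> K. \<beta> a x = 0}"
  proof safe
    fix x assume x: "x \<in> F"
    then show "x \<in> K" using F' by (auto simp: face_of_def)
    from x show "\<beta> a x = 0" unfolding FQ convex_hull_finite[OF Qf] using zero by auto
  next
    fix x assume x: "x \<in> K" "\<beta> a x = 0"
    then show "x \<in> F" unfolding FQ convex_hull_finite[OF Qf]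
      using comb[of x] by (intro CollectI exI[of _ "\<lambda>p. \<beta> p x"]) (auto simp: K_eq Q)
  qed
  moreover have "affine hull F = {x \<in> Rn d. \<beta> a x = 0}"
    unfolding FQ affine_hull_convex_hull affine_hull_finite[OF Qf]
  proof safe
    fix u :: "fvec \<Rightarrow> real" assume "sum u Q = 1"
    then show "\<beta> a (\<Sum>v\<in>Q. u v *\<^sub>R v) = 0" by (rule zero)
  next
    fix x assume "x \<in> Rn d" "\<beta> a x = 0"
    with comb[of x] show "\<exists>u. sum u Q = 1 \<and> (\<Sum>v\<in>Q. u v *\<^sub>R v) = x" by blast
  qed (rule Rn_Q)
  ultimately show ?thesis using aP by blast
qed

end

text \<open>The data of a simplex seen as a cone of height \<open>D\<close> over the facet \<open>F\<close> with apex \<open>a\<close>. The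
  hyperplane \<open>H\<close> of \<open>F\<close> passes through \<open>q\<close> and has the unit normal \<open>n\<close> pointing to \<open>a\<close>; the ball
  with center \<open>c\<close> and radius \<open>r\<close> serves as an inscribed ball.\<close>

locale cone_simplex =
  fixes d :: nat and \<tau> F K H :: "fvec set" and a n q c :: fvec and D r :: real
  assumes d: "d \<ge> 1"
    and K_def: "K = closure \<tau>" and H_def: "H = affine hull F"
    and compact_K: "compact K" and K_Rn: "K \<subseteq> Rn d" and \<tau>_K: "\<tau> \<subseteq> K"
    and openin_\<tau>: "openin (top_of_set (Rn d)) \<tau>" and convex_\<tau>: "convex \<tau>"
    and r: "r > 0" and ball_\<tau>: "ball c r \<inter> Rn d \<subseteq> \<tau>" and c\<tau>: "c \<in> \<tau>"
    and shrink: "\<And>x s. x \<in> K \<Longrightarrow> 0 \<le> s \<Longrightarrow> s < 1 \<Longrightarrow> c + s *\<^sub>R (x - c) \<in> \<tau>"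
    and compact_F: "compact F" and F_H: "F \<subseteq> H"
    and H_eq: "H = {x \<in> Rn d. n \<bullet> x = n \<bullet> q}" and q: "q \<in> Rn d"
    and n: "norm n = 1" "n \<in> Rn d" and D: "D > 0"
    and a: "a \<in> K" "n \<bullet> a = n \<bullet> q + D"
    and slab: "\<And>x. x \<in> K \<Longrightarrow> n \<bullet> q \<le> n \<bullet> x \<and> n \<bullet> x \<le> n \<bullet> q + D"
    and cone: "\<And>y t. y \<in> H \<Longrightarrow> 0 < t \<Longrightarrow> t \<le> 1 \<Longrightarrow> a + t *\<^sub>R (y - a) \<in> K \<longleftrightarrow> y \<in> F"
    and inradius_D: "inradius d \<tau> \<le> D"
    and diam: "\<And>x. x \<in> K \<Longrightarrow> norm (x - a) \<le> diameter \<tau>"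
    and isometry: "\<exists>\<phi>. isometry_onto (d - 1) H \<phi>"

text \<open>The coordinate \<open>\<beta> a\<close> is \<open>0\<close> on the facet,
  \<open>1\<close> at the apex, and has gradient \<open>m a\<close>. Hence the unit normal is the
  normalised gradient and the height is the reciprocal of its norm.\<close>

lemma ex_cone_simplex:
  assumes \<tau>: "open_simplex d \<tau>" and F: "simplex_facet d \<tau> F" and d: "d \<ge> 1"
  shows "\<exists>K H a n q c D r. cone_simplex d \<tau> F K H a n q c D r"
proof -
  from \<tau> obtain P where P: "P \<subseteq> Rn d" "card P = d + 1" "\<not> affine_dependent P" "\<tau> = rel_interior (convex hull P)"
    unfolding open_simplex_def by blast
  from ex_barycentric[OF P(1-3)] obtain m \<kappa> where
    m: "\<And>p. p \<in> P \<Longrightarrow> m p \<in> Rn d" "\<And>x. x \<in> Rn d \<Longrightarrow> (\<Sum>p\<in>P. \<kappa> p + m p \<bullet> x) = 1"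
    "\<And>x. x \<in> Rn d \<Longrightarrow> (\<Sum>p\<in>P. (\<kappa> p + m p \<bullet> x) *\<^sub>R p) = x"
    "\<And>u p. sum u P = 1 \<Longrightarrow> p \<in> P \<Longrightarrow> \<kappa> p + m p \<bullet> (\<Sum>q\<in>P. u q *\<^sub>R q) = u p"
    by blast
  interpret bary_simplex d P m \<kappa> \<tau>
    by unfold_locales (fact P m)+
  from facet_eq[OF F d] obtain a where aP: "a \<in> P" and F_eq: "F = {x \<in> K. \<beta> a x = 0}"
    and H_eq: "affine hull F = {x \<in> Rn d. \<beta> a x = 0}" by blast
  from F obtain B where B: "affine hull B = affine hull F" "\<not> affine_dependent B" "card B = d"
    unfolding simplex_facet_def by blast
  \<comment> \<open>A second vertex, available because \<open>d \<ge> 1\<close>; it serves as base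
    point of the hyperplane.\<close>
  obtain q where qP: "q \<in> P" "q \<noteq> a"
  proof -
    have "card (P - {a}) = d" using P(2) aP by simp
    then have "P - {a} \<noteq> {}" using d by (metis card.empty not_one_le_zero)
    with that show ?thesis by blast
  qed
  have ba: "\<beta> a a = 1" and bq: "\<beta> a q = 0" using \<beta>_vertex aP qP by auto
  have m0: "m a \<noteq> 0" using ba bq by (auto simp: \<beta>_def)
  define D where "D = 1 / norm (m a)"
  define n where "n = D *\<^sub>R m a"
  have D: "D > 0" using m0 by (simp add: D_def)
  have nn: "norm n = 1" using m0 by (simp add: n_def D_def)
  have nx: "n \<bullet> x = n \<bullet> q + D * \<beta> a x" for x
  proof -
    have "n \<bullet> y = D * \<beta> a y - D * \<kappa> a" for y by (simp add: n_def \<beta>_def algebra_simps)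
    from this[of x] this[of q] show ?thesis by (simp add: bq)
  qed
  have nR: "n \<in> Rn d" using m_Rn[OF aP] by (simp add: n_def)
  obtain c where c: "c \<in> \<tau>" using ex_center by blast
  then obtain r where r: "r > 0" "ball c r \<inter> Rn d \<subseteq> \<tau>"
    using openin_\<tau> unfolding openin_contains_ball by blast
  have b01: "0 \<le> \<beta> a x \<and> \<beta> a x \<le> 1" if x: "x \<in> K" for x
  proof
    show "0 \<le> \<beta> a x" using x aP by (auto simp: K_eq)
    have "\<beta> a x \<le> (\<Sum>q\<in>P. \<beta> q x)" using x aP finite_P by (intro member_le_sum) (auto simp: K_eq)
    then show "\<beta> a x \<le> 1" using bary_sum[of x] K_subset x by (auto simp: \<beta>_def)
  qed
  have slab: "n \<bullet> q \<le> n \<bullet> x \<and> n \<bullet> x \<le> n \<bullet> q + D" if "x \<in> K" for x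
    using b01[OF that] D unfolding nx[of x] by (simp add: mult_left_le)
  \<comment> \<open>From the centre of an inscribed ball one can go any distance below
    \<open>s\<close> along \<open>n\<close> inside \<open>K\<close>, and \<open>K\<close> lies in a
    slab of width \<open>D\<close>. The ball is open, hence the limiting argument by
    \<open>dense_le\<close>.\<close>
  have inr: "s \<le> D" if s: "0 < s" "x \<in> Rn d" "ball x s \<inter> Rn d \<subseteq> \<tau>" for s x
  proof (rule dense_le)
    fix t assume t: "t < s"
    show "t \<le> D"
    proof (cases "t > 0")
      case True
      have in1: "x + t *\<^sub>R n \<in> K" "x \<in> K"
        using s t True nn nR \<tau>_K by (auto simp: subset_iff dist_norm)
      have "n \<bullet> (x + t *\<^sub>R n) = n \<bullet> x + t" using nn by (simp add: inner_add_right dot_square_norm)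
      with slab[OF in1(1)] slab[OF in1(2)] show ?thesis by linarith
    qed (use D in simp)
  qed
  show ?thesis
  proof (intro exI, unfold_locales)
    show "K = closure \<tau>" by (simp add: closure_\<tau>)
    show "affine hull F = affine hull F" ..
    show "compact F" unfolding F_eq \<beta>_def
    proof -
      have "closed {x. \<kappa> a + m a \<bullet> x = 0}" by (intro closed_Collect_eq continuous_intros)
      from compact_Int_closed[OF compact_K this] show "compact {x \<in> K. \<kappa> a + m a \<bullet> x = 0}"
        by (simp add: Int_def)
    qed
    show "F \<subseteq> affine hull F" by (rule hull_subset)
    show "affine hull F = {x \<in> Rn d. n \<bullet> x = n \<bullet> q}" unfolding H_eq using D by (subst nx) auto
    show "q \<in> Rn d" using qP P(1) by auto
    show "a \<in> K" by (rule vertex_K[OF aP])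
    show "n \<bullet> a = n \<bullet> q + D" unfolding nx[of a] ba by simp
    show "a + t *\<^sub>R (y - a) \<in> K \<longleftrightarrow> y \<in> F" if y: "y \<in> affine hull F" and t: "0 < t" "t \<le> 1" for y t
    proof -
      have y': "y \<in> Rn d" "\<beta> a y = 0" using y unfolding H_eq by auto
      have "a + t *\<^sub>R (y - a) \<in> Rn d" using y' aP P(1) by auto
      moreover have "(\<forall>p\<in>P. \<beta> p (a + t *\<^sub>R (y - a)) \<ge> 0) \<longleftrightarrow> (\<forall>p\<in>P. \<beta> p y \<ge> 0)"
      proof (intro ball_cong refl)
        fix p assume p: "p \<in> P"
        show "\<beta> p (a + t *\<^sub>R (y - a)) \<ge> 0 \<longleftrightarrow> \<beta> p y \<ge> 0"
          using t y' unfolding \<beta>_line \<beta>_vertex[OF p aP] by (auto simp: zero_le_mult_iff)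
      qed
      ultimately show ?thesis unfolding F_eq using y' by (simp add: K_eq)
    qed
    show "inradius d \<tau> \<le> D"
      unfolding inradius_def
    proof (rule cSup_least)
      show "{r. 0 < r \<and> (\<exists>x\<in>Rn d. ball x r \<inter> Rn d \<subseteq> \<tau>)} \<noteq> {}" using r c \<tau>_K K_subset by blast
    qed (use inr in blast)
    show "norm (x - a) \<le> diameter \<tau>" if "x \<in> K" for x
      using diameter_bounded_bound[OF compact_imp_bounded[OF compact_K] that vertex_K[OF aP]]
        diameter_closure[OF bounded_\<tau>] by (simp add: closure_\<tau> dist_norm)
    show "\<exists>\<phi>. isometry_onto (d - 1) (affine hull F) \<phi>"
      using ex_isometry_onto_affine_hull[OF B(2), of "d - 1"] B d by simp
    show "\<And>x s. x \<in> K \<Longrightarrow> 0 \<le> s \<Longrightarrow> s < 1 \<Longrightarrow> c + s *\<^sub>R (x - c) \<in> \<tau>" by (rule shrink[OF c])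
  qed (fact d compact_K K_subset \<tau>_K openin_\<tau> convex_\<tau> r c nn nR D slab)+
qed


section \<open>The trace inequality for smooth functions\<close>

text \<open>The derivatives are a separate argument \<open>g\<close>, so that a difference of two
  functions is covered with the differences of their derivatives, without computing
  \<open>partial\<close> of a difference.\<close>

definition c1 :: "nat \<Rightarrow> (fvec \<Rightarrow> real) \<Rightarrow> (nat \<Rightarrow> fvec \<Rightarrow> real) \<Rightarrow> bool" where
  "c1 d u g \<longleftrightarrow> continuous_on (Rn d) u \<and> (\<forall>i<d. continuous_on (Rn d) (g i)) \<and>
     (\<forall>i<d. \<forall>x\<in>Rn d. ((\<lambda>t. u (x + t *\<^sub>R unit_vec i)) has_real_derivative g i x) (at 0))"

lemma c1_diff:
  assumes "c1 d u g" "c1 d v h"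
  shows "c1 d (\<lambda>x. u x - v x) (\<lambda>i x. g i x - h i x)"
  using assms unfolding c1_def by (auto intro!: continuous_intros derivative_intros)

lemma c1_coord_derivative:
  assumes "c1 d u g" "i < d" "x \<in> Rn d"
  shows "((\<lambda>t. u (x + t *\<^sub>R unit_vec i)) has_real_derivative g i (x + t *\<^sub>R unit_vec i)) (at t)"
proof -
  have "((\<lambda>s. u ((x + t *\<^sub>R unit_vec i) + s *\<^sub>R unit_vec i)) has_real_derivative g i (x + t *\<^sub>R unit_vec i)) (at 0)"
    using assms by (auto simp: c1_def)
  then have "((\<lambda>s. u (x + (s + t) *\<^sub>R unit_vec i)) has_real_derivative g i (x + t *\<^sub>R unit_vec i)) (at 0)"
    by (simp add: scaleR_add_left add_ac)
  then show ?thesis using DERIV_shift[of "\<lambda>s. u (x + s *\<^sub>R unit_vec i)" _ 0 t] by simp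
qed

lemma continuous_at_lines:
  fixes g :: "fvec \<Rightarrow> real"
  assumes "continuous_on (Rn d) g" "x \<in> Rn d" "v \<in> Rn d" "w \<in> Rn d"
  shows "continuous (at p) (\<lambda>p::real \<times> real. g (x + fst p *\<^sub>R v + snd p *\<^sub>R w))"
proof -
  have "continuous_on UNIV (\<lambda>p::real \<times> real. g (x + fst p *\<^sub>R v + snd p *\<^sub>R w))"
    by (rule continuous_on_compose2[OF assms(1)]) (use assms in \<open>auto intro!: continuous_intros\<close>)
  then show ?thesis using continuous_on_eq_continuous_at[OF open_UNIV] by blast
qed

text \<open>Induction on the number \<open>j\<close> of coordinates that \<open>v\<close> may use.
  With \<open>v = w + b *\<^sub>R unit_vec j\<close>, the induction hypothesis handles
  \<open>w\<close>, continuity of \<open>g j\<close> makes the function of the two parameters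
  jointly differentiable, and the chain rule along \<open>(t, t * b)\<close> finishes.\<close>

lemma c1_directional_derivative:
  assumes u: "c1 d u g" and j: "j \<le> d" and v: "v \<in> Rn j" and x: "x \<in> Rn d"
  shows "((\<lambda>t. u (x + t *\<^sub>R v)) has_real_derivative (\<Sum>i<j. coord v i * g i (x + t *\<^sub>R v))) (at t)"
  using j v x
proof (induction j arbitrary: v x t)
  case 0
  then show ?case by simp
next
  case (Suc j)
  define b where "b = coord v j"
  define w where "w = v - b *\<^sub>R unit_vec j"
  have w: "w \<in> Rn j" using Suc.prems(2) by (auto simp: w_def b_def Rn_def le_Suc_eq)
  have wd: "w \<in> Rn d" using w Rn_mono[of j d] Suc.prems(1) by auto
  have vw: "v = w + b *\<^sub>R unit_vec j" by (simp add: w_def)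
  have wj: "coord w i = coord v i" if "i < j" for i using that by (simp add: w_def)
  define f where "f s r = u (x + s *\<^sub>R w + r *\<^sub>R unit_vec j)" for s r
  define G where "G s r = (\<Sum>i<j. coord v i * g i (x + s *\<^sub>R w + r *\<^sub>R unit_vec j))" for s r
  have xs: "x + s *\<^sub>R w + r *\<^sub>R unit_vec j = (x + r *\<^sub>R unit_vec j) + s *\<^sub>R w" for s r by simp
  have "((\<lambda>(s, r). f s r) has_derivative
     (\<lambda>(ts, tr). G t (t * b) * ts + blinfun_mult_left (g j (x + t *\<^sub>R w + (t * b) *\<^sub>R unit_vec j)) tr)) (at (t, t * b) within UNIV \<times> UNIV)"
  proof (rule has_derivative_partialsI[where fy = "\<lambda>s r. blinfun_mult_left (g j (x + s *\<^sub>R w + r *\<^sub>R unit_vec j))"])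
    show "((\<lambda>s. f s (t * b)) has_derivative (\<lambda>ts. G t (t * b) * ts)) (at t within UNIV)"
      using Suc.IH[OF _ w, of "x + (t * b) *\<^sub>R unit_vec j" t] Suc.prems
      unfolding f_def G_def xs has_field_derivative_def by (simp add: wj)
    show "((\<lambda>r. f s r) has_derivative blinfun_apply (blinfun_mult_left (g j (x + s *\<^sub>R w + r *\<^sub>R unit_vec j)))) (at r within UNIV)" for s r
      using c1_coord_derivative[OF u, of j "x + s *\<^sub>R w" r] Suc.prems wd
      unfolding f_def has_field_derivative_def mult.commute[of "g j _"]
      by (simp add: blinfun_mult_left.rep_eq)
    show "continuous (at (t, t * b) within UNIV \<times> UNIV) (\<lambda>(s, r). blinfun_mult_left (g j (x + s *\<^sub>R w + r *\<^sub>R unit_vec j)))"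
      unfolding split_beta UNIV_Times_UNIV
      by (rule bounded_linear.continuous[OF bounded_linear_blinfun_mult_left], rule continuous_at_lines)
        (use u Suc.prems wd in \<open>auto simp: c1_def\<close>)
  qed auto
  then have D: "((\<lambda>(s, r). f s r) has_derivative
     (\<lambda>(ts, tr). G t (t * b) * ts + g j (x + t *\<^sub>R w + (t * b) *\<^sub>R unit_vec j) * tr)) (at (t, t * b))"
    by (simp add: mult.commute)
  have E: "((\<lambda>t. (t, t * b)) has_derivative (\<lambda>h. (h, h * b))) (at t)"
    by (auto intro!: derivative_eq_intros)
  have "((\<lambda>t. f t (t * b)) has_derivative (\<lambda>h. G t (t * b) * h + g j (x + t *\<^sub>R w + (t * b) *\<^sub>R unit_vec j) * (h * b))) (at t)"
    using has_derivative_compose[OF E D] by simp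
  moreover have "(\<lambda>h. G t (t * b) * h + g j (x + t *\<^sub>R w + (t * b) *\<^sub>R unit_vec j) * (h * b)) =
    (\<lambda>h. (\<Sum>i<Suc j. coord v i * g i (x + t *\<^sub>R v)) * h)"
    by (simp add: G_def vw fun_eq_iff algebra_simps b_def[symmetric] wj[symmetric])
       (simp add: w_def b_def)
  ultimately have "((\<lambda>t. f t (t * b)) has_real_derivative (\<Sum>i<Suc j. coord v i * g i (x + t *\<^sub>R v))) (at t)"
    unfolding has_field_derivative_def by simp
  moreover have "(\<lambda>t. f t (t * b)) = (\<lambda>t. u (x + t *\<^sub>R v))"
    by (simp add: f_def vw algebra_simps)
  ultimately show ?case by simp
qed

context cone_simplex
begin

text \<open>\<open>\<phi>\<close> is literally the choice made in \<open>surface_measure\<close>,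
  and \<open>S\<close> is the surface measure before completion, whose nonnegative integrals pull
  back along \<open>\<phi>\<close> to \<open>Rn k\<close>.\<close>

definition "\<phi> = (SOME \<phi>. isometry_onto (d - 1) H \<phi>)"
definition "k = d - 1"
definition "S = distr (lborel_Rn k) (restrict_space borel H) \<phi>"

lemma d_Suc: "d = Suc k" using d by (simp add: k_def)

lemma Rn_d: "Rn d = Rn (Suc k)" using d_Suc by (rule arg_cong)
lemma lborel_Rn_d: "lborel_Rn d = lborel_Rn (Suc k)" using d_Suc by (rule arg_cong)

lemma \<phi>_iso: "isometry_onto k H \<phi>"
  unfolding \<phi>_def k_def using isometry by (rule someI_ex)

lemma surface_measure_eq: "surface_measure d F = completion S"
  unfolding surface_measure_def S_def \<phi>_def k_def unfolding H_def ..

lemma H_Rn: "H \<subseteq> Rn d" by (auto simp: H_eq)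

lemma \<phi>_H: "x \<in> Rn k \<Longrightarrow> \<phi> x \<in> H" using \<phi>_iso by (auto simp: isometry_onto_def)
lemma \<phi>_Rn: "x \<in> Rn k \<Longrightarrow> \<phi> x \<in> Rn d" using \<phi>_H H_Rn by auto

lemma \<phi>_onto: "y \<in> H \<Longrightarrow> \<exists>z\<in>Rn k. \<phi> z = y"
  using \<phi>_iso unfolding isometry_onto_def by (metis imageE)

lemma continuous_on_\<phi>: "continuous_on (Rn k) \<phi>"
  unfolding continuous_on_iff
proof (intro ballI allI impI)
  fix x :: fvec and e :: real assume "x \<in> Rn k" "0 < e"
  then show "\<exists>d>0. \<forall>x'\<in>Rn k. dist x' x < d \<longrightarrow> dist (\<phi> x') (\<phi> x) < e"
    using \<phi>_iso by (intro exI[of _ e]) (auto simp: isometry_onto_def)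
qed

lemma measurable_coord_\<phi>: "(\<lambda>x. coord (\<phi> x) i) \<in> borel_measurable (lborel_Rn k)"
  by (intro continuous_on_imp_measurable_Rn continuous_on_coord continuous_on_\<phi>)

lemma measurable_\<phi>_Rn: "\<phi> \<in> lborel_Rn k \<rightarrow>\<^sub>M lborel_Rn d"
  by (rule measurable_into_Rn) (auto simp: \<phi>_Rn measurable_coord_\<phi>)

lemma measurable_\<phi>: "\<phi> \<in> lborel_Rn k \<rightarrow>\<^sub>M restrict_space borel H"
proof (rule measurable_restrict_space2)
  show "\<phi> \<in> space (lborel_Rn k) \<rightarrow> H" using \<phi>_H by auto
  have "\<phi> \<in> lborel_Rn k \<rightarrow>\<^sub>M restrict_space borel (Rn d)"
    using measurable_\<phi>_Rn unfolding measurable_cong_sets[OF refl sets_lborel_Rn] .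
  then show "\<phi> \<in> borel_measurable (lborel_Rn k)" by (rule measurable_restrict_space2_iff[THEN iffD1, THEN conjunct1])
qed

lemma nn_integral_S:
  assumes "f \<in> borel_measurable (restrict_space borel H)"
  shows "(\<integral>\<^sup>+x. f x \<partial>S) = (\<integral>\<^sup>+z. f (\<phi> z) \<partial>lborel_Rn k)"
  unfolding S_def by (rule nn_integral_distr[OF measurable_\<phi>]) (use assms in simp)

lemma K_sets: "K \<in> sets (lborel_Rn d)"
  unfolding sets_lborel_Rn sets_restrict_space
  by (rule image_eqI[of _ _ K]) (use borel_closed[OF compact_imp_closed[OF compact_K]] K_Rn in auto)

lemma F_sets_Rn: "F \<in> sets (lborel_Rn d)"
  unfolding sets_lborel_Rn sets_restrict_space
  by (rule image_eqI[of _ _ F]) (use borel_closed[OF compact_imp_closed[OF compact_F]] F_H H_Rn in auto)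

lemma F_sets: "F \<in> sets S"
  unfolding S_def sets_distr sets_restrict_space
  by (rule image_eqI[of _ _ F]) (use borel_closed[OF compact_imp_closed[OF compact_F]] F_H in auto)

lemma \<tau>_sets: "\<tau> \<in> sets (lborel_Rn d)"
proof -
  obtain U where "open U" "\<tau> = Rn d \<inter> U" using openin_\<tau> by (auto simp: openin_open)
  then show ?thesis unfolding sets_lborel_Rn sets_restrict_space by auto
qed

text \<open>The linear part of \<open>\<phi>\<close> extends to a linear isometry \<open>U\<close>
  of \<open>Rn d\<close> that sends the last unit vector to the normal \<open>n\<close>. Invariance
  under \<open>U\<close> reduces slicing parallel to \<open>H\<close> to splitting off the last
  coordinate.\<close>

lemma nn_integral_slices:
  assumes g: "g \<in> borel_measurable (lborel_Rn d)"
  shows "(\<integral>\<^sup>+x. g x \<partial>lborel_Rn d) = (\<integral>\<^sup>+s. \<integral>\<^sup>+z. g (\<phi> z + s *\<^sub>R n) \<partial>lborel_Rn k \<partial>lborel)"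
proof -
  define \<psi> where "\<psi> x = \<phi> x - \<phi> 0" for x
  have \<psi>: "norm (\<psi> x) = norm x" "\<psi> (x + y) = \<psi> x + \<psi> y" if "x \<in> Rn k" "y \<in> Rn k" for x y
    using isometry_onto_affine(1,2)[OF \<phi>_iso] that by (auto simp: \<psi>_def)
  define pr where "pr x = x - coord x k *\<^sub>R unit_vec k" for x
  have pr: "pr x \<in> Rn k" if "x \<in> Rn d" for x
    using that unfolding Rn_d by (auto simp: pr_def Rn_def le_Suc_eq)
  have pr_add: "pr (x + y) = pr x + pr y" for x y by (simp add: pr_def algebra_simps)
  define U where "U x = \<psi> (pr x) + coord x k *\<^sub>R n" for x
  have \<phi>n: "n \<bullet> \<psi> x = 0" if "x \<in> Rn k" for x
    using \<phi>_H[OF that] \<phi>_H[of 0] by (simp add: \<psi>_def H_eq inner_diff_right)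
  have \<psi>R: "\<psi> x \<in> Rn d" if "x \<in> Rn k" for x using \<phi>_Rn that by (simp add: \<psi>_def)
  have UR: "U x \<in> Rn d" if "x \<in> Rn d" for x using that pr \<psi>R n by (simp add: U_def)
  have onto: "\<exists>x\<in>Rn d. U x = y" if y: "y \<in> Rn d" for y
  proof -
    have nn: "n \<bullet> n = 1" using n by (simp add: dot_square_norm)
    \<comment> \<open>Removing the normal component of \<open>y\<close> and adding the base point
      \<open>\<phi> 0\<close> lands in \<open>H\<close>, the range of \<open>\<phi>\<close>.\<close>
    have "y - (n \<bullet> y) *\<^sub>R n + \<phi> 0 \<in> H"
      using y n(2) \<phi>_H[of 0] nn by (simp add: H_eq inner_add_right inner_diff_right)
    then obtain z where z: "z \<in> Rn k" "\<phi> z = y - (n \<bullet> y) *\<^sub>R n + \<phi> 0"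
      using \<phi>_onto by blast
    have zk: "coord z k = 0" using z by (simp add: Rn_def)
    have "U (z + (n \<bullet> y) *\<^sub>R unit_vec k) = y"
      by (simp add: U_def pr_def zk \<psi>_def z(2))
    moreover have "z + (n \<bullet> y) *\<^sub>R unit_vec k \<in> Rn d" using z unfolding Rn_d by (simp add: Rn_Suc)
    ultimately show ?thesis by blast
  qed
  have add: "U (x + y) = U x + U y" if "x \<in> Rn d" "y \<in> Rn d" for x y
    unfolding U_def pr_add using \<psi>(2)[OF pr pr] that by (simp add: algebra_simps)
  have norm: "norm (U x) = norm x" if x: "x \<in> Rn d" for x
  proof -
    have o1: "orthogonal (\<psi> (pr x)) (coord x k *\<^sub>R n)"
      using \<phi>n[OF pr[OF x]] by (simp add: orthogonal_def inner_commute)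
    have o2: "orthogonal (pr x) (coord x k *\<^sub>R unit_vec k)"
      using pr[OF x] by (simp add: orthogonal_def Rn_def)
    have "(norm (U x))\<^sup>2 = (norm (pr x))\<^sup>2 + (coord x k)\<^sup>2"
      unfolding U_def norm_add_Pythagorean[OF o1] using n \<psi>(1)[OF pr[OF x] pr[OF x]] by simp
    also have "\<dots> = (norm (pr x + coord x k *\<^sub>R unit_vec k))\<^sup>2"
      unfolding norm_add_Pythagorean[OF o2] by simp
    also have "pr x + coord x k *\<^sub>R unit_vec k = x" by (simp add: pr_def)
    finally show ?thesis by simp
  qed
  have pr_m: "pr \<in> lborel_Rn d \<rightarrow>\<^sub>M lborel_Rn k"
  proof (rule measurable_into_Rn)
    show "pr x \<in> Rn k" if "x \<in> space (lborel_Rn d)" for x using pr that by simp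
    show "(\<lambda>x. coord (pr x) i) \<in> borel_measurable (lborel_Rn d)" for i
      using measurable_coord_Rn by (auto simp: pr_def)
  qed
  have Um: "U \<in> lborel_Rn d \<rightarrow>\<^sub>M lborel_Rn d"
  proof (rule measurable_into_Rn)
    fix i
    have "(\<lambda>x. coord (\<phi> (pr x)) i - coord (\<phi> 0) i + coord x k * coord n i) \<in> borel_measurable (lborel_Rn d)"
      by (intro borel_measurable_add borel_measurable_diff borel_measurable_times borel_measurable_const
          measurable_compose[OF pr_m measurable_coord_\<phi>] measurable_coord_Rn)
    then show "(\<lambda>x. coord (U x) i) \<in> borel_measurable (lborel_Rn d)" by (simp add: U_def \<psi>_def)
  qed (use UR in auto)
  have \<phi>0: "\<phi> 0 \<in> Rn d" using \<phi>_Rn by simp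
  have gm: "(\<lambda>x. g (\<phi> 0 + x)) \<in> borel_measurable (lborel_Rn d)"
    by (rule measurable_compose[OF measurable_translate_Rn[OF \<phi>0] g])
  have gUm: "(\<lambda>x. g (\<phi> 0 + U x)) \<in> borel_measurable (lborel_Rn d)"
    by (rule measurable_compose[OF Um gm])
  interpret sigma_finite_measure "lborel_Rn k" by (rule sigma_finite_lborel_Rn)
  interpret pair_sigma_finite "lborel_Rn k" "lborel :: real measure"
    by standard
  have "(\<lambda>p. \<phi> (fst p) + snd p *\<^sub>R n) \<in> lborel_Rn k \<Otimes>\<^sub>M lborel \<rightarrow>\<^sub>M lborel_Rn d"
  proof (rule measurable_into_Rn)
    fix i
    have "(\<lambda>p. coord (\<phi> (fst p)) i + snd p * coord n i) \<in> borel_measurable (lborel_Rn k \<Otimes>\<^sub>M lborel)"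
      by (intro borel_measurable_add borel_measurable_times borel_measurable_const
          measurable_compose[OF measurable_fst measurable_coord_\<phi>]) simp
    then show "(\<lambda>p. coord (\<phi> (fst p) + snd p *\<^sub>R n) i) \<in> borel_measurable (lborel_Rn k \<Otimes>\<^sub>M lborel)" by simp
  qed (use \<phi>_Rn n in \<open>auto simp: space_pair_measure\<close>)
  from measurable_compose[OF this g]
  have pm: "(\<lambda>(z, s). g (\<phi> z + s *\<^sub>R n)) \<in> borel_measurable (lborel_Rn k \<Otimes>\<^sub>M lborel)"
    by (simp add: split_beta)
  have "(\<integral>\<^sup>+x. g x \<partial>lborel_Rn d) = (\<integral>\<^sup>+x. g (\<phi> 0 + x) \<partial>lborel_Rn d)"
    by (rule nn_integral_translate_Rn[OF \<phi>0 g, symmetric])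
  also have "\<dots> = (\<integral>\<^sup>+x. g (\<phi> 0 + U x) \<partial>lborel_Rn d)"
    by (rule nn_integral_linear_isometry_Rn[OF UR onto add norm Um gm, symmetric])
  also have "\<dots> = (\<integral>\<^sup>+x. \<integral>\<^sup>+s. g (\<phi> 0 + U (x + s *\<^sub>R unit_vec k)) \<partial>lborel \<partial>lborel_Rn k)"
    using gUm unfolding lborel_Rn_d by (rule nn_integral_lborel_Rn_Suc)
  also have "\<dots> = (\<integral>\<^sup>+z. \<integral>\<^sup>+s. g (\<phi> z + s *\<^sub>R n) \<partial>lborel \<partial>lborel_Rn k)"
  proof (rule nn_integral_cong)
    fix z assume "z \<in> space (lborel_Rn k)"
    then have "coord z k = 0" by (simp add: Rn_def)
    then have "\<phi> 0 + U (z + s *\<^sub>R unit_vec k) = \<phi> z + s *\<^sub>R n" for s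
      by (simp add: U_def pr_def \<psi>_def)
    then show "(\<integral>\<^sup>+s. g (\<phi> 0 + U (z + s *\<^sub>R unit_vec k)) \<partial>lborel) = (\<integral>\<^sup>+s. g (\<phi> z + s *\<^sub>R n) \<partial>lborel)"
      by simp
  qed
  also have "\<dots> = (\<integral>\<^sup>+s. \<integral>\<^sup>+z. g (\<phi> z + s *\<^sub>R n) \<partial>lborel_Rn k \<partial>lborel)"
    by (rule Fubini'[symmetric]) (rule pm)
  finally show ?thesis .
qed

lemma measurable_cone_map: "(\<lambda>p. a + snd p *\<^sub>R (\<phi> (fst p) - a)) \<in> lborel_Rn k \<Otimes>\<^sub>M lborel \<rightarrow>\<^sub>M lborel_Rn d"
proof (rule measurable_into_Rn)
  fix i
  have "(\<lambda>p. coord a i + snd p * (coord (\<phi> (fst p)) i - coord a i)) \<in> borel_measurable (lborel_Rn k \<Otimes>\<^sub>M lborel)"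
    by (intro borel_measurable_add borel_measurable_diff borel_measurable_times borel_measurable_const
        measurable_compose[OF measurable_fst measurable_coord_\<phi>]) simp
  then show "(\<lambda>p. coord (a + snd p *\<^sub>R (\<phi> (fst p) - a)) i) \<in> borel_measurable (lborel_Rn k \<Otimes>\<^sub>M lborel)" by simp
next
  show "a + snd p *\<^sub>R (\<phi> (fst p) - a) \<in> Rn d" if "p \<in> space (lborel_Rn k \<Otimes>\<^sub>M lborel)" for p
    using \<phi>_Rn subsetD[OF K_Rn a(1)] that by (auto simp: space_pair_measure)
qed

text \<open>Conical coordinates about the apex: the slice of \<open>K\<close> at height
  \<open>D - D * t\<close> over the facet is the facet contracted by \<open>t\<close> towards
  \<open>a\<close>, which scales \<open>k\<close>-dimensional measure by \<open>t ^ k\<close>; the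
  height variable contributes the factor \<open>D\<close>.\<close>

lemma nn_integral_cone:
  assumes f: "f \<in> borel_measurable (lborel_Rn d)"
  shows "(\<integral>\<^sup>+x. f x * indicator K x \<partial>lborel_Rn d) = ennreal D *
    (\<integral>\<^sup>+z. indicator F (\<phi> z) * (\<integral>\<^sup>+t. ennreal (t ^ k) * f (a + t *\<^sub>R (\<phi> z - a)) * indicator {0<..1} t \<partial>lborel) \<partial>lborel_Rn k)"
proof -
  define g where "g x = f x * indicator K x" for x
  have gm: "g \<in> borel_measurable (lborel_Rn d)" unfolding g_def
    by (intro borel_measurable_times_ennreal f borel_measurable_indicator K_sets)
  interpret sigma_finite_measure "lborel_Rn k" by (rule sigma_finite_lborel_Rn)
  interpret pair_sigma_finite "lborel_Rn k" "lborel :: real measure" by standard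
  have aR: "a \<in> Rn d" using a K_Rn by auto
  \<comment> \<open>The foot of the perpendicular from the apex. In the parameter space of
    \<open>\<phi>\<close> the contraction towards \<open>a\<close> becomes the homothety with centre
    \<open>x0\<close>.\<close>
  have "a - D *\<^sub>R n \<in> H" using a aR n by (simp add: H_eq inner_diff_right dot_square_norm)
  then obtain x0 where x0: "x0 \<in> Rn k" "\<phi> x0 = a - D *\<^sub>R n" using \<phi>_onto by blast
  have slice: "(\<integral>\<^sup>+z. g (\<phi> z + (D - D * t) *\<^sub>R n) \<partial>lborel_Rn k) =
     (\<integral>\<^sup>+z. ennreal (t ^ k) * f (a + t *\<^sub>R (\<phi> z - a)) * indicator F (\<phi> z) \<partial>lborel_Rn k)"
    if t: "t \<in> {0<..1}" for t
  proof -
    have gm': "(\<lambda>z. g (\<phi> z + (D - D * t) *\<^sub>R n)) \<in> borel_measurable (lborel_Rn k)"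
    proof (rule measurable_compose[OF _ gm], rule measurable_into_Rn)
      fix i
      have "(\<lambda>z. coord (\<phi> z) i + (D - D * t) * coord n i) \<in> borel_measurable (lborel_Rn k)"
        by (intro borel_measurable_add borel_measurable_const measurable_coord_\<phi>)
      then show "(\<lambda>z. coord (\<phi> z + (D - D * t) *\<^sub>R n) i) \<in> borel_measurable (lborel_Rn k)" by simp
    qed (use \<phi>_Rn n in auto)
    have x0': "x0 - t *\<^sub>R x0 \<in> Rn k" using x0 by simp
    have "(\<integral>\<^sup>+z. g (\<phi> z + (D - D * t) *\<^sub>R n) \<partial>lborel_Rn k)
        = (\<integral>\<^sup>+z. g (\<phi> ((x0 - t *\<^sub>R x0) + z) + (D - D * t) *\<^sub>R n) \<partial>lborel_Rn k)"
      by (rule nn_integral_translate_Rn[OF x0' gm', symmetric])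
    also have "\<dots> = ennreal (\<bar>t\<bar> ^ k) * (\<integral>\<^sup>+z. g (\<phi> ((x0 - t *\<^sub>R x0) + t *\<^sub>R z) + (D - D * t) *\<^sub>R n) \<partial>lborel_Rn k)"
      by (rule nn_integral_scale_Rn) 
        (use t measurable_compose[OF measurable_translate_Rn[OF x0'] gm'] in auto)
    also have "\<dots> = ennreal (t ^ k) * (\<integral>\<^sup>+z. f (a + t *\<^sub>R (\<phi> z - a)) * indicator F (\<phi> z) \<partial>lborel_Rn k)"
    proof (intro arg_cong2[where f = "(*)"] nn_integral_cong)
      show "ennreal (\<bar>t\<bar> ^ k) = ennreal (t ^ k)" using t by simp
      fix z assume "z \<in> space (lborel_Rn k)"
      then have z: "z \<in> Rn k" by simp
      have "\<phi> ((x0 - t *\<^sub>R x0) + t *\<^sub>R z) - \<phi> 0 = (\<phi> x0 - \<phi> 0) + t *\<^sub>R (\<phi> z - \<phi> 0) - t *\<^sub>R (\<phi> x0 - \<phi> 0)"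
      proof -
        note aff = isometry_onto_affine[OF \<phi>_iso]
        have "\<phi> ((x0 - t *\<^sub>R x0) + t *\<^sub>R z) - \<phi> 0 = \<phi> (x0 + t *\<^sub>R (z - x0)) - \<phi> 0"
          by (simp add: algebra_simps)
        also have "\<dots> = (\<phi> x0 - \<phi> 0) + t *\<^sub>R (\<phi> (z - x0) - \<phi> 0)"
          using aff(2)[of x0 "t *\<^sub>R (z - x0)"] aff(3)[of "z - x0" t] z x0 by simp
        also have "\<phi> (z - x0) - \<phi> 0 = (\<phi> z - \<phi> 0) - (\<phi> x0 - \<phi> 0)"
          using aff(2)[of "z - x0" x0] z x0 by simp
        finally show ?thesis by (simp add: scaleR_diff_right)
      qed
      then have *: "\<phi> ((x0 - t *\<^sub>R x0) + t *\<^sub>R z) + (D - D * t) *\<^sub>R n = a + t *\<^sub>R (\<phi> z - a)"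
        using x0(2) by (simp add: algebra_simps)
      show "g (\<phi> ((x0 - t *\<^sub>R x0) + t *\<^sub>R z) + (D - D * t) *\<^sub>R n) = f (a + t *\<^sub>R (\<phi> z - a)) * indicator F (\<phi> z)"
        unfolding * g_def using cone[OF \<phi>_H[OF z], of t] t by (simp add: indicator_def)
    qed
    also have "\<dots> = (\<integral>\<^sup>+z. ennreal (t ^ k) * (f (a + t *\<^sub>R (\<phi> z - a)) * indicator F (\<phi> z)) \<partial>lborel_Rn k)"
    proof (rule nn_integral_cmult[symmetric])
      have "(\<lambda>z. (z, t)) \<in> lborel_Rn k \<rightarrow>\<^sub>M lborel_Rn k \<Otimes>\<^sub>M lborel" by (rule measurable_Pair2') simp
      from measurable_compose[OF this measurable_compose[OF measurable_cone_map f]]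
      have "(\<lambda>z. f (a + t *\<^sub>R (\<phi> z - a))) \<in> borel_measurable (lborel_Rn k)" by simp
      then show "(\<lambda>z. f (a + t *\<^sub>R (\<phi> z - a)) * indicator F (\<phi> z)) \<in> borel_measurable (lborel_Rn k)"
        by (rule borel_measurable_times_ennreal[OF _ measurable_compose[OF measurable_\<phi>_Rn borel_measurable_indicator[OF F_sets_Rn]]])
    qed
    finally show ?thesis by (simp only: mult.assoc)
  qed
  have "(\<integral>\<^sup>+x. f x * indicator K x \<partial>lborel_Rn d) = (\<integral>\<^sup>+s. \<integral>\<^sup>+z. g (\<phi> z + s *\<^sub>R n) \<partial>lborel_Rn k \<partial>lborel)"
    using nn_integral_slices[OF gm] by (simp add: g_def)
  \<comment> \<open>The height is \<open>D - D * t\<close>, so that \<open>t = 1\<close> is the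
    facet and \<open>t = 0\<close> the apex.\<close>
  also have "\<dots> = ennreal \<bar>- D\<bar> * (\<integral>\<^sup>+t. \<integral>\<^sup>+z. g (\<phi> z + (D + (- D) * t) *\<^sub>R n) \<partial>lborel_Rn k \<partial>lborel)"
  proof (rule nn_integral_real_affine)
    have "(\<lambda>p. \<phi> (snd p) + fst p *\<^sub>R n) \<in> lborel \<Otimes>\<^sub>M lborel_Rn k \<rightarrow>\<^sub>M lborel_Rn d"
    proof (rule measurable_into_Rn)
      fix i
      have "(\<lambda>p. coord (\<phi> (snd p)) i + fst p * coord n i) \<in> borel_measurable (lborel \<Otimes>\<^sub>M lborel_Rn k)"
        by (intro borel_measurable_add borel_measurable_times borel_measurable_const
            measurable_compose[OF measurable_snd measurable_coord_\<phi>]) simp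
      then show "(\<lambda>p. coord (\<phi> (snd p) + fst p *\<^sub>R n) i) \<in> borel_measurable (lborel \<Otimes>\<^sub>M lborel_Rn k)" by simp
    qed (use \<phi>_Rn n in \<open>auto simp: space_pair_measure\<close>)
    from measurable_compose[OF this gm]
    have "(\<lambda>(s, z). g (\<phi> z + s *\<^sub>R n)) \<in> borel_measurable (lborel \<Otimes>\<^sub>M lborel_Rn k)"
      by (simp add: split_beta)
    from sigma_finite_measure.borel_measurable_nn_integral[OF sigma_finite_lborel_Rn this]
    show "(\<lambda>s. \<integral>\<^sup>+z. g (\<phi> z + s *\<^sub>R n) \<partial>lborel_Rn k) \<in> borel_measurable borel" by simp
  qed (use D in simp)
  also have "(\<integral>\<^sup>+t. \<integral>\<^sup>+z. g (\<phi> z + (D + (- D) * t) *\<^sub>R n) \<partial>lborel_Rn k \<partial>lborel) =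
    (\<integral>\<^sup>+t. \<integral>\<^sup>+z. indicator F (\<phi> z) * (ennreal (t ^ k) * f (a + t *\<^sub>R (\<phi> z - a)) * indicator {0<..1} t) \<partial>lborel_Rn k \<partial>lborel)"
  \<comment> \<open>The slice \<open>t = 0\<close> is discarded as a null set: there every
    \<open>y\<close> is contracted to the apex and membership in \<open>K\<close> no longer detects
    \<open>F\<close>.\<close>
  proof (rule nn_integral_cong_AE, use AE_lborel_singleton[of 0] in \<open>rule AE_mp\<close>, intro AE_I2 impI)
    fix t :: real assume t0: "t \<noteq> 0"
    show "(\<integral>\<^sup>+z. g (\<phi> z + (D + (- D) * t) *\<^sub>R n) \<partial>lborel_Rn k) =
      (\<integral>\<^sup>+z. indicator F (\<phi> z) * (ennreal (t ^ k) * f (a + t *\<^sub>R (\<phi> z - a)) * indicator {0<..1} t) \<partial>lborel_Rn k)"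
    proof (cases "t \<in> {0<..1}")
      case True
      then show ?thesis using slice[OF True] by (simp add: mult.commute)
    next
      case False
      \<comment> \<open>Outside the unit interval the slice lies beyond the slab that contains
        \<open>K\<close>.\<close>
      have "g (\<phi> z + (D + (- D) * t) *\<^sub>R n) = 0" if z: "z \<in> Rn k" for z
      proof -
        have "\<phi> z + (D + (- D) * t) *\<^sub>R n \<notin> K"
        proof
          assume "\<phi> z + (D + (- D) * t) *\<^sub>R n \<in> K"
          from slab[OF this] have "0 \<le> D * (1 - t)" "D * (1 - t) \<le> D * 1"
            using \<phi>_H[OF z] n(1) by (auto simp: H_eq inner_add_right dot_square_norm algebra_simps)
          then have "t \<le> 1" "0 \<le> t" using D by (auto simp: zero_le_mult_iff)
          with t0 False show False by auto
        qed
        then show ?thesis by (simp add: g_def)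
      qed
      with False show ?thesis by (intro nn_integral_cong) simp
    qed
  qed
  also have "\<dots> = (\<integral>\<^sup>+z. \<integral>\<^sup>+t. indicator F (\<phi> z) * (ennreal (t ^ k) * f (a + t *\<^sub>R (\<phi> z - a)) * indicator {0<..1} t) \<partial>lborel \<partial>lborel_Rn k)"
  proof (rule Fubini')
    have "(\<lambda>p. indicator F (\<phi> (fst p)) * (ennreal (snd p ^ k) * f (a + snd p *\<^sub>R (\<phi> (fst p) - a)) * indicator {0<..1} (snd p))) 
      \<in> borel_measurable (lborel_Rn k \<Otimes>\<^sub>M lborel)"
      by (intro borel_measurable_times_ennreal measurable_compose[OF measurable_cone_map f]
        measurable_compose[OF measurable_fst measurable_compose[OF measurable_\<phi>_Rn borel_measurable_indicator[OF F_sets_Rn]]]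
        measurable_compose[OF measurable_snd]) measurable
    then show "(\<lambda>(z, t). indicator F (\<phi> z) * (ennreal (t ^ k) * f (a + t *\<^sub>R (\<phi> z - a)) * indicator {0<..1} t))
      \<in> borel_measurable (lborel_Rn k \<Otimes>\<^sub>M lborel)" by (simp add: split_beta)
  qed
  also have "\<dots> = (\<integral>\<^sup>+z. indicator F (\<phi> z) * (\<integral>\<^sup>+t. ennreal (t ^ k) * f (a + t *\<^sub>R (\<phi> z - a)) * indicator {0<..1} t \<partial>lborel) \<partial>lborel_Rn k)"
  proof (rule nn_integral_cong, rule nn_integral_cmult)
    fix z assume z: "z \<in> space (lborel_Rn k)"
    from measurable_compose[OF measurable_Pair1'[OF z] measurable_compose[OF measurable_cone_map f]]
    have "(\<lambda>t. f (a + t *\<^sub>R (\<phi> z - a))) \<in> borel_measurable lborel" by simp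
    then show "(\<lambda>t. ennreal (t ^ k) * f (a + t *\<^sub>R (\<phi> z - a)) * indicator {0<..1} t) \<in> borel_measurable lborel"
      by measurable
  qed
  finally show ?thesis using D by simp
qed

text \<open>Shrinking \<open>K\<close> by any factor below \<open>1\<close> moves it into \<open>\<tau>\<close>, so both have the same measure.\<close>

lemma AE_K_imp_\<tau>: "AE x in lborel_Rn d. x \<in> K \<longrightarrow> x \<in> \<tau>"
proof -
  have bK: "emeasure (lborel_Rn d) K < \<infinity>" by (rule emeasure_bounded_Rn[OF compact_imp_bounded[OF compact_K]])
  have b\<tau>: "emeasure (lborel_Rn d) \<tau> < \<infinity>"
    using emeasure_mono[OF \<tau>_K K_sets] bK by (rule le_less_trans)
  have le: "ennreal (s ^ d) * emeasure (lborel_Rn d) K \<le> emeasure (lborel_Rn d) \<tau>" if s: "0 < s" "s < 1" for s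
  proof -
    have cR: "c - s *\<^sub>R c \<in> Rn d" using c\<tau> \<tau>_K K_Rn by (auto simp: subset_iff)
    have im: "(indicator \<tau> :: fvec \<Rightarrow> ennreal) \<in> borel_measurable (lborel_Rn d)" by (rule borel_measurable_indicator[OF \<tau>_sets])
    have "emeasure (lborel_Rn d) K = (\<integral>\<^sup>+x. indicator K x \<partial>lborel_Rn d)" by (rule nn_integral_indicator[OF K_sets, symmetric])
    also have "\<dots> \<le> (\<integral>\<^sup>+x. indicator \<tau> ((c - s *\<^sub>R c) + s *\<^sub>R x) \<partial>lborel_Rn d)"
    proof (rule nn_integral_mono)
      fix x show "indicator K x \<le> (indicator \<tau> ((c - s *\<^sub>R c) + s *\<^sub>R x) :: ennreal)"
        using shrink[of x s] s by (auto simp: indicator_def algebra_simps)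
    qed
    finally have "ennreal (s ^ d) * emeasure (lborel_Rn d) K \<le> ennreal (s ^ d) * (\<integral>\<^sup>+x. indicator \<tau> ((c - s *\<^sub>R c) + s *\<^sub>R x) \<partial>lborel_Rn d)"
      by (intro mult_left_mono) auto
    also have "\<dots> = (\<integral>\<^sup>+x. indicator \<tau> ((c - s *\<^sub>R c) + x) \<partial>lborel_Rn d)"
      using nn_integral_scale_Rn[OF _ measurable_compose[OF measurable_translate_Rn[OF cR] im], of s] s by simp
    also have "\<dots> = (\<integral>\<^sup>+x. indicator \<tau> x \<partial>lborel_Rn d)" by (rule nn_integral_translate_Rn[OF cR im])
    also have "\<dots> = emeasure (lborel_Rn d) \<tau>" by (rule nn_integral_indicator[OF \<tau>_sets])
    finally show ?thesis .
  qed
  define mK m\<tau> where "mK = enn2real (emeasure (lborel_Rn d) K)" and "m\<tau> = enn2real (emeasure (lborel_Rn d) \<tau>)"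
  have eK: "emeasure (lborel_Rn d) K = ennreal mK" and e\<tau>: "emeasure (lborel_Rn d) \<tau> = ennreal m\<tau>"
    using bK b\<tau> by (auto simp: mK_def m\<tau>_def less_top)
  have nn: "0 \<le> mK" "0 \<le> m\<tau>" by (auto simp: mK_def m\<tau>_def)
  \<comment> \<open>Both measures are finite, so the inequality can be read in the reals and passes
    to the limit of contraction factors tending to \<open>1\<close>.\<close>
  have "(1 - inverse (real (Suc (Suc j)))) ^ d * mK \<le> m\<tau>" for j
  proof -
    let ?s = "1 - inverse (real (Suc (Suc j)))"
    have s: "0 < ?s" "?s < 1" by (auto simp: field_simps)
    have "ennreal (?s ^ d * mK) \<le> ennreal m\<tau>"
      using le[OF s] s nn unfolding eK e\<tau> by (simp add: ennreal_mult')
    then show ?thesis using nn by simp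
  qed
  moreover have "(\<lambda>j. (1 - inverse (real (Suc (Suc j)))) ^ d * mK) \<longlonglongrightarrow> (1 - 0) ^ d * mK"
    by (intro tendsto_intros LIMSEQ_Suc[OF LIMSEQ_inverse_real_of_nat])
  ultimately have "mK \<le> m\<tau>" using LIMSEQ_le_const2 by fastforce
  then have "emeasure (lborel_Rn d) K \<le> emeasure (lborel_Rn d) \<tau>" unfolding eK e\<tau> by (rule ennreal_leI)
  then have "emeasure (lborel_Rn d) (K - \<tau>) = 0"
    using emeasure_Diff[OF _ K_sets \<tau>_sets \<tau>_K] b\<tau> bK by (auto simp: diff_eq_0_iff_ennreal)
  then have "K - \<tau> \<in> null_sets (lborel_Rn d)" using K_sets \<tau>_sets by (auto intro: null_setsI)
  from AE_not_in[OF this] show ?thesis by eventually_elim auto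
qed

end

context cone_simplex
begin

definition "h = diameter \<tau>"

text \<open>The derivative of \<open>t ^ d * (u (x t))\<^sup>2\<close> produces
  \<open>real d * (u (x t))\<^sup>2\<close> and a mixed term. Young's inequality with weight
  \<open>real d\<close> splits the mixed term so that its first part has the size of the term
  already present; the distance from \<open>x t\<close> to the apex in the second part is at most
  the diameter.\<close>

lemma trace_pointwise:
  assumes u: "c1 d u g" and y: "y \<in> F"
  defines "p \<equiv> \<lambda>x. 2 * real d * (u x)\<^sup>2 + h\<^sup>2 / real d * (\<Sum>i<d. (g i x)\<^sup>2)"
  shows "ennreal ((u y)\<^sup>2) \<le> (\<integral>\<^sup>+t. ennreal (t ^ k) * ennreal (p (a + t *\<^sub>R (y - a))) * indicator {0<..1} t \<partial>lborel)"
proof -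
  have yH: "y \<in> H" using y F_H by auto
  have aR: "a \<in> Rn d" and yR: "y - a \<in> Rn d" using a K_Rn yH H_Rn by (auto simp: subset_iff)
  have d0: "real d > 0" using d by simp
  define x where "x t = a + t *\<^sub>R (y - a)" for t
  have xR: "x t \<in> Rn d" for t using aR yR by (simp add: x_def)
  have xK: "x t \<in> K" if "0 \<le> t" "t \<le> 1" for t
    using cone[OF yH, of t] y that a by (cases "t = 0") (auto simp: x_def)
  define G where "G t = t ^ Suc k * (u (x t))\<^sup>2" for t
  define w where "w t = (\<Sum>i<d. coord (y - a) i * g i (x t))" for t
  define q where "q t = t ^ k * p (x t)" for t
  have G': "(G has_real_derivative (t ^ k * (real d * (u (x t))\<^sup>2 + 2 * u (x t) * (t * w t)))) (at t)" for t
  proof -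
    have "((\<lambda>t. u (x t)) has_real_derivative w t) (at t)"
      unfolding x_def w_def by (rule c1_directional_derivative[OF u order_refl yR aR])
    from DERIV_mult[OF DERIV_pow[of "Suc k" t] DERIV_power[OF this, of 2]]
    have "(G has_real_derivative (real (Suc k) * t ^ k * (u (x t))\<^sup>2 + 2 * u (x t) * w t * t ^ Suc k)) (at t)"
      unfolding G_def by (simp add: ac_simps)
    moreover have "real d = real (Suc k)" by (rule arg_cong[OF d_Suc])
    ultimately show ?thesis by (simp add: algebra_simps)
  qed
  have le: "t ^ k * (real d * (u (x t))\<^sup>2 + 2 * u (x t) * (t * w t)) \<le> q t" if t: "0 \<le> t" "t \<le> 1" for t
    unfolding q_def
  proof (rule mult_left_mono)
    define \<gamma> where "\<gamma> = (\<Sum>i<d. g i (x t) *\<^sub>R unit_vec i)"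
    have \<gamma>: "\<gamma> \<in> Rn d" unfolding \<gamma>_def by (intro Rn_sum Rn_closure) auto
    have c\<gamma>: "coord \<gamma> i = g i (x t)" if "i < d" for i
      using that by (simp add: \<gamma>_def coord_sum if_distrib cong: if_cong)
    have n\<gamma>: "(norm \<gamma>)\<^sup>2 = (\<Sum>i<d. (g i (x t))\<^sup>2)"
      using c\<gamma> by (simp add: norm_Rn[OF \<gamma>] sum_nonneg)
    have "t * w t = (x t - a) \<bullet> \<gamma>"
    proof -
      have "(x t - a) \<bullet> \<gamma> = t * ((y - a) \<bullet> \<gamma>)" by (simp add: x_def)
      also have "(y - a) \<bullet> \<gamma> = w t" by (simp only: inner_Rn[OF yR] w_def) (simp add: c\<gamma>)
      finally show ?thesis by simp
    qed
    then have "\<bar>t * w t\<bar> \<le> norm (x t - a) * norm \<gamma>" using Cauchy_Schwarz_ineq2[of "x t - a" \<gamma>] by simp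
    also have "\<dots> \<le> h * norm \<gamma>"
      using diam[OF xK[OF t]] by (intro mult_right_mono) (auto simp: h_def)
    finally have "\<bar>t * w t\<bar>\<^sup>2 \<le> (h * norm \<gamma>)\<^sup>2" by (intro power_mono) auto
    then have w2: "(t * w t)\<^sup>2 \<le> h\<^sup>2 * (\<Sum>i<d. (g i (x t))\<^sup>2)" by (simp add: power_mult_distrib n\<gamma>)
    have "0 \<le> (real d * u (x t) - t * w t)\<^sup>2 / real d" by simp
    also have "\<dots> = real d * (u (x t))\<^sup>2 - 2 * u (x t) * (t * w t) + (t * w t)\<^sup>2 / real d"
      using d0 by (simp add: power2_eq_square field_simps)
    also have "(t * w t)\<^sup>2 / real d \<le> h\<^sup>2 * (\<Sum>i<d. (g i (x t))\<^sup>2) / real d"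
      using w2 d0 by (intro divide_right_mono) auto
    finally show "real d * (u (x t))\<^sup>2 + 2 * u (x t) * (t * w t) \<le> p (x t)"
      by (simp add: p_def)
  qed (use t in simp)
  have pc: "continuous_on (Rn d) p"
    unfolding p_def using u d0 by (auto simp: c1_def intro!: continuous_intros)
  have "continuous_on UNIV (\<lambda>t. p (x t))"
    by (rule continuous_on_compose2[OF pc]) (use xR in \<open>auto simp: x_def intro!: continuous_intros\<close>)
  then have qc: "continuous_on A q" for A
    unfolding q_def by (intro continuous_intros) (auto intro: continuous_on_subset)
  have p0: "p z \<ge> 0" for z unfolding p_def by (intro add_nonneg_nonneg mult_nonneg_nonneg sum_nonneg divide_nonneg_nonneg) auto
  \<comment> \<open>The antiderivative is taken on a larger interval so that it has two-sided
    derivatives at \<open>0\<close> and \<open>1\<close>.\<close>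
  obtain Q where Q: "\<And>t. t \<in> {-1..2} \<Longrightarrow> (Q has_vector_derivative q t) (at t within {-1..2})"
    using antiderivative_continuous[OF qc] by blast
  have Q': "(Q has_real_derivative q t) (at t)" if "0 \<le> t" "t \<le> 1" for t
  proof -
    have "t \<in> interior {-1..2}" using that by simp
    then show ?thesis using Q[of t] that at_within_interior[of t "{-1..2}"]
      by (simp add: has_real_derivative_iff_has_vector_derivative)
  qed
  have "(u y)\<^sup>2 = G 1 - G 0" by (simp add: G_def x_def)
  also have "\<dots> \<le> Q 1 - Q 0"
  proof -
    \<comment> \<open>Monotonicity of \<open>Q - G\<close> replaces integration of the derivative of
      \<open>G\<close>; only the continuous majorant \<open>q\<close> is integrated.\<close>
    have "Q 0 - G 0 \<le> Q 1 - G 1"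
    proof (rule DERIV_nonneg_imp_nondecreasing[of 0 1 "\<lambda>t. Q t - G t", simplified])
      fix t :: real assume t: "0 \<le> t" "t \<le> 1"
      show "\<exists>y. ((\<lambda>t. Q t - G t) has_real_derivative y) (at t) \<and> 0 \<le> y"
        using DERIV_diff[OF Q'[OF t] G'] le[OF t] by (intro exI conjI) auto
    qed
    then show ?thesis by simp
  qed
  finally have "ennreal ((u y)\<^sup>2) \<le> ennreal (Q 1 - Q 0)" by (rule ennreal_leI)
  also have "\<dots> = (\<integral>\<^sup>+t. ennreal (q t) * indicator {0..1} t \<partial>lborel)"
    by (rule nn_integral_FTC_Icc[symmetric])
      (use qc Q' p0 in \<open>auto simp: q_def intro: borel_measurable_continuous_onI has_field_derivative_at_within\<close>)
  also have "\<dots> = (\<integral>\<^sup>+t. ennreal (t ^ k) * ennreal (p (a + t *\<^sub>R (y - a))) * indicator {0<..1} t \<partial>lborel)"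
  proof (rule nn_integral_cong_AE, use AE_lborel_singleton[of 0] in \<open>rule AE_mp\<close>, intro AE_I2 impI)
    fix t :: real assume "t \<noteq> 0"
    then show "ennreal (q t) * indicator {0..1} t = ennreal (t ^ k) * ennreal (p (a + t *\<^sub>R (y - a))) * indicator {0<..1} t"
      using p0 by (auto simp: indicator_def q_def x_def ennreal_mult)
  qed
  finally show ?thesis .
qed

section \<open>Integrating the pointwise bound over the facet\<close>

lemma sq_int_indicator_\<tau>:
  assumes "continuous_on (Rn d) u"
  shows "sq_int (lborel_Rn d) (\<lambda>x. indicator \<tau> x * u x)"
proof -
  have "compact (u ` K)" by (rule compact_continuous_image[OF continuous_on_subset[OF assms K_Rn] compact_K])
  then obtain B where B: "\<And>x. x \<in> K \<Longrightarrow> \<bar>u x\<bar> \<le> B"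
    using compact_imp_bounded[of "u ` K"] by (auto simp: bounded_iff)
  have "integrable (lborel_Rn d) (indicator K :: fvec \<Rightarrow> real)"
    by (rule integrable_real_indicator[OF K_sets]) (rule emeasure_bounded_Rn[OF compact_imp_bounded[OF compact_K]])
  moreover have "(\<lambda>x. (indicator K x :: real)\<^sup>2) = indicator K" by (auto simp: indicator_def)
  ultimately have iK: "sq_int (lborel_Rn d) (indicator K)"
    unfolding sq_int_def using borel_measurable_indicator[OF K_sets] by simp
  show ?thesis
  proof (rule sq_int_bound[OF iK, where c = B])
    show "(\<lambda>x. indicator \<tau> x * u x) \<in> borel_measurable (lborel_Rn d)"
      by (rule borel_measurable_times[OF borel_measurable_indicator[OF \<tau>_sets] continuous_on_imp_measurable_Rn[OF assms]])
    show "\<bar>indicator \<tau> x * u x\<bar> \<le> B * \<bar>indicator K x\<bar>" for x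
      using B[of x] \<tau>_K by (auto simp: indicator_def)
  qed
qed

lemma measurable_on_H:
  assumes "continuous_on (Rn d) u"
  shows "u \<in> borel_measurable (restrict_space borel H)"
  by (rule borel_measurable_continuous_on_restrict[OF continuous_on_subset[OF assms H_Rn]])

text \<open>Integrated over \<open>F\<close>, the pointwise bound has the cone formula for
  \<open>K\<close> as its right-hand side, and \<open>K\<close> exceeds \<open>\<tau>\<close> by a
  null set. The squared form, with the partial derivatives kept separate, is what the Cauchy
  argument for traces applies to differences.\<close>

lemma trace_S:
  assumes u: "c1 d u g"
  defines "bnd \<equiv> 2 * real d / D * (l2 (lborel_Rn d) (\<lambda>x. indicator \<tau> x * u x))\<^sup>2
      + h\<^sup>2 / (real d * D) * (\<Sum>i<d. (l2 (lborel_Rn d) (\<lambda>x. indicator \<tau> x * g i x))\<^sup>2)"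
  shows "sq_int S (\<lambda>x. indicator F x * u x)" "(l2 S (\<lambda>x. indicator F x * u x))\<^sup>2 \<le> bnd"
proof -
  have d0: "real d > 0" using d by simp
  have uc: "continuous_on (Rn d) u" and gc: "\<And>i. i < d \<Longrightarrow> continuous_on (Rn d) (g i)"
    using u by (auto simp: c1_def)
  define p where "p x = 2 * real d * (u x)\<^sup>2 + h\<^sup>2 / real d * (\<Sum>i<d. (g i x)\<^sup>2)" for x
  have pc: "continuous_on (Rn d) p"
    unfolding p_def using uc gc d0 by (auto intro!: continuous_intros)
  have p0: "p z \<ge> 0" for z unfolding p_def by (intro add_nonneg_nonneg mult_nonneg_nonneg sum_nonneg divide_nonneg_nonneg) auto
  have pm: "p \<in> borel_measurable (lborel_Rn d)" by (rule continuous_on_imp_measurable_Rn[OF pc])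
  have pe: "(\<lambda>x. ennreal (p x)) \<in> borel_measurable (lborel_Rn d)" by (rule measurable_compose_rev[OF _ pm]) simp
  have um: "(\<lambda>x. indicator F x * u x) \<in> borel_measurable (restrict_space borel H)"
    using F_sets measurable_on_H[OF uc] unfolding S_def sets_distr
    by (intro borel_measurable_times borel_measurable_indicator)
  have um2: "(\<lambda>x. ennreal ((indicator F x * u x)\<^sup>2)) \<in> borel_measurable (restrict_space borel H)"
    by (rule measurable_compose_rev[OF _ um]) simp
  have umS: "(\<lambda>x. indicator F x * u x) \<in> borel_measurable S"
    using um by (simp add: S_def)
  have c0: "bnd \<ge> 0" using D d0 by (auto simp: bnd_def intro!: add_nonneg_nonneg mult_nonneg_nonneg sum_nonneg divide_nonneg_nonneg)
  have sqp: "(LINT x|lborel_Rn d. p x * indicator \<tau> x) = D * bnd" 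
     and ip: "integrable (lborel_Rn d) (\<lambda>x. p x * indicator \<tau> x)"
  proof -
    let ?I = "\<lambda>v x. (indicator \<tau> x * v x)\<^sup>2 :: real"
    have eq: "p x * indicator \<tau> x = 2 * real d * ?I u x + h\<^sup>2 / real d * (\<Sum>i<d. ?I (g i) x)" for x
      by (auto simp: p_def indicator_def)
    have iu: "integrable (lborel_Rn d) (?I u)" using sq_int_indicator_\<tau>[OF uc] by (simp add: sq_int_def)
    have ig: "integrable (lborel_Rn d) (?I (g i))" if "i < d" for i
      using sq_int_indicator_\<tau>[OF gc[OF that]] by (simp add: sq_int_def)
    show "integrable (lborel_Rn d) (\<lambda>x. p x * indicator \<tau> x)"
      unfolding eq using iu ig by (intro Bochner_Integration.integrable_add integrable_mult_right Bochner_Integration.integrable_sum) auto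
    have "(LINT x|lborel_Rn d. p x * indicator \<tau> x) =
       2 * real d * (LINT x|lborel_Rn d. ?I u x) + h\<^sup>2 / real d * (\<Sum>i<d. LINT x|lborel_Rn d. ?I (g i) x)"
    proof -
      have iS: "integrable (lborel_Rn d) (\<lambda>x. \<Sum>i<d. ?I (g i) x)"
        using ig by (intro Bochner_Integration.integrable_sum) auto
      show ?thesis
        unfolding eq Bochner_Integration.integral_add[OF integrable_mult_right[OF iu] integrable_mult_right[OF iS]]
        using ig by (simp add: Bochner_Integration.integral_sum)
    qed
    also have "\<dots> = D * bnd" using D by (simp add: bnd_def l2_power2 field_simps)
    finally show "(LINT x|lborel_Rn d. p x * indicator \<tau> x) = D * bnd" .
  qed
  have "ennreal D * (\<integral>\<^sup>+x. ennreal ((indicator F x * u x)\<^sup>2) \<partial>S) =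
    ennreal D * (\<integral>\<^sup>+z. ennreal ((indicator F (\<phi> z) * u (\<phi> z))\<^sup>2) \<partial>lborel_Rn k)"
    by (simp only: nn_integral_S[OF um2])
  also have "\<dots> \<le> ennreal D * (\<integral>\<^sup>+z. indicator F (\<phi> z) * (\<integral>\<^sup>+t. ennreal (t ^ k) * ennreal (p (a + t *\<^sub>R (\<phi> z - a))) * indicator {0<..1} t \<partial>lborel) \<partial>lborel_Rn k)"
    using trace_pointwise[OF u] by (intro mult_left_mono nn_integral_mono) (auto simp: indicator_def p_def)
  also have "\<dots> = (\<integral>\<^sup>+x. ennreal (p x) * indicator K x \<partial>lborel_Rn d)"
    by (rule nn_integral_cone[OF pe, symmetric])
  also have "\<dots> = (\<integral>\<^sup>+x. ennreal (p x * indicator \<tau> x) \<partial>lborel_Rn d)"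
  proof (rule nn_integral_cong_AE, use AE_K_imp_\<tau> in \<open>rule AE_mp\<close>, intro AE_I2 impI)
    fix x assume "x \<in> K \<longrightarrow> x \<in> \<tau>"
    then show "ennreal (p x) * indicator K x = ennreal (p x * indicator \<tau> x)"
      using \<tau>_K by (auto simp: indicator_def)
  qed
  also have "\<dots> = ennreal (D * bnd)"
    unfolding sqp[symmetric] by (rule nn_integral_eq_integral[OF ip]) (use p0 in auto)
  also have "\<dots> = ennreal D * ennreal bnd" using D c0 by (simp add: ennreal_mult)
  finally have "(\<integral>\<^sup>+x. ennreal ((indicator F x * u x)\<^sup>2) \<partial>S) \<le> ennreal bnd"
    using D by (subst (asm) ennreal_mult_le_mult_iff) auto
  then have le: "(\<integral>\<^sup>+x. ennreal ((indicator F x * u x)\<^sup>2) \<partial>S) \<le> ennreal ((sqrt bnd)\<^sup>2)"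
    using c0 by simp
  show "sq_int S (\<lambda>x. indicator F x * u x)" by (rule sq_int_leI[OF umS le]) (use c0 in simp)
  have "l2 S (\<lambda>x. indicator F x * u x) \<le> sqrt bnd" by (rule sq_int_leI[OF umS le]) (use c0 in simp)
  then have "(l2 S (\<lambda>x. indicator F x * u x))\<^sup>2 \<le> (sqrt bnd)\<^sup>2" by (intro power_mono) auto
  then show "(l2 S (\<lambda>x. indicator F x * u x))\<^sup>2 \<le> bnd" using c0 by simp
qed

end


section \<open>Smooth functions and mollification\<close>

definition smooth1 :: "(real \<Rightarrow> real) \<Rightarrow> bool" where
  "smooth1 f \<longleftrightarrow> (\<forall>n x. (deriv ^^ n) f differentiable at x)"

lemma smooth1_deriv: "smooth1 f \<Longrightarrow> smooth1 (deriv f)"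
  unfolding smooth1_def by (metis comp_apply funpow_Suc_right)

lemma smooth1_DERIV: "smooth1 f \<Longrightarrow> (f has_real_derivative deriv f x) (at x)"
  unfolding smooth1_def
  by (metis DERIV_imp_deriv eq_id_iff funpow_0 real_differentiable_def)

lemma smooth1_continuous: "smooth1 f \<Longrightarrow> continuous_on A f"
  using smooth1_DERIV by (meson DERIV_continuous continuous_at_imp_continuous_on)

text \<open>Smoothness follows from membership in a class closed under differentiation, so that
  higher derivatives need no formula.\<close>

lemma smooth1_coinduct:
  assumes "f \<in> X" "\<And>f. f \<in> X \<Longrightarrow> \<exists>f'\<in>X. \<forall>x. (f has_real_derivative f' x) (at x)"
  shows "smooth1 f"
proof -
  have d: "deriv f \<in> X" "f differentiable at x" if f: "f \<in> X" for f x
  proof -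
    from assms(2)[OF f] obtain f' where f': "f' \<in> X" "\<And>x. (f has_real_derivative f' x) (at x)" by blast
    then have "deriv f = f'" using DERIV_imp_deriv by blast
    with f' show "deriv f \<in> X" "f differentiable at x" by (auto simp: real_differentiable_def)
  qed
  have "(deriv ^^ n) f \<in> X" for n
    by (induction n) (use assms(1) d in auto)
  then show ?thesis using d by (simp add: smooth1_def)
qed

lemma smooth1_affine:
  assumes "smooth1 f"
  shows "smooth1 (\<lambda>t. c * f (a + b * t))"
proof (rule smooth1_coinduct)
  show "(\<lambda>t. c * f (a + b * t)) \<in> {\<lambda>t. c * f (a + b * t) | c f. smooth1 f}" using assms by blast
next
  fix g assume "g \<in> {\<lambda>t. c * f (a + b * t) | c f. smooth1 f}"
  then obtain c f where g: "g = (\<lambda>t. c * f (a + b * t))" and f: "smooth1 f" by blast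
  have "(g has_real_derivative (c * b) * deriv f (a + b * x)) (at x)" for x
  proof -
    have "((\<lambda>t. f (a + b * t)) has_real_derivative deriv f (a + b * x) * b) (at x)"
      by (rule DERIV_chain2[OF smooth1_DERIV[OF f]]) (auto intro!: derivative_eq_intros)
    then show ?thesis unfolding g by (auto intro!: derivative_eq_intros)
  qed
  then show "\<exists>f'\<in>{\<lambda>t. c * f (a + b * t) | c f. smooth1 f}. \<forall>x. (g has_real_derivative f' x) (at x)"
    using smooth1_deriv[OF f] by (intro bexI[of _ "\<lambda>t. (c * b) * deriv f (a + b * t)"]) auto
qed

text \<open>The span of the functions \<open>pexp p (1 + t) * pexp r (1 - t)\<close> is closed under differentiation,
  which makes the bump function with \<open>p = r = 1\<close> smooth.\<close>

definition pexp :: "real poly \<Rightarrow> real \<Rightarrow> real" where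
  "pexp p t = (if t > 0 then poly p (1 / t) * exp (- (1 / t)) else 0)"

lemma poly_exp_tendsto_0: "((\<lambda>s::real. poly p s * exp (- s)) \<longlongrightarrow> 0) at_top"
proof -
  have "((\<lambda>s. \<Sum>i\<le>degree p. coeff p i * (s ^ i / exp s)) \<longlongrightarrow> (\<Sum>i\<le>degree p. coeff p i * 0)) at_top"
    by (intro tendsto_intros tendsto_power_div_exp_0)
  then show ?thesis
    by (simp add: poly_altdef exp_minus divide_inverse[symmetric] sum_divide_distrib)
qed

text \<open>With s = 1/t the derivative of p(s) e^(-s) in t is s^2 (p(s) - p'(s)) e^(-s), again of
  the same shape. At \<open>t = 0\<close> the difference quotient on the right is
  \<open>pexp ([:0, 1:] * p)\<close>, which tends to \<open>0\<close> because the exponential beats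
  every polynomial; on the left it vanishes.\<close>

lemma pexp_DERIV:
  "(pexp p has_real_derivative pexp ([:0, 0, 1:] * (p - pderiv p)) t) (at t)"
proof (cases t "0::real" rule: linorder_cases)
  case less
  have "((\<lambda>_. 0) has_real_derivative 0) (at t)" by simp
  then have "(pexp p has_real_derivative 0) (at t)"
    by (rule has_field_derivative_transform_within_open[of _ _ _ "{..<0}"]) (use less in \<open>auto simp: pexp_def\<close>)
  then show ?thesis using less by (simp add: pexp_def)
next
  case greater
  have "((\<lambda>t. poly p (1 / t) * exp (- (1 / t))) has_real_derivative
      (poly (pderiv p) (1 / t) * (- 1 / t\<^sup>2)) * exp (- (1 / t)) + (exp (- (1 / t)) * (1 / t\<^sup>2)) * poly p (1 / t)) (at t)"
  proof (rule DERIV_mult)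
    show "((\<lambda>t. poly p (1 / t)) has_real_derivative poly (pderiv p) (1 / t) * (- 1 / t\<^sup>2)) (at t)"
      by (rule DERIV_chain2[OF poly_DERIV])
        (use greater in \<open>auto intro!: derivative_eq_intros simp: power2_eq_square\<close>)
    show "((\<lambda>t. exp (- (1 / t))) has_real_derivative exp (- (1 / t)) * (1 / t\<^sup>2)) (at t)"
      by (rule DERIV_chain2[OF DERIV_exp])
        (use greater in \<open>auto intro!: derivative_eq_intros simp: power2_eq_square\<close>)
  qed
  also have "(poly (pderiv p) (1 / t) * (- 1 / t\<^sup>2)) * exp (- (1 / t)) + (exp (- (1 / t)) * (1 / t\<^sup>2)) * poly p (1 / t)
     = pexp ([:0, 0, 1:] * (p - pderiv p)) t"
    using greater by (simp add: pexp_def power2_eq_square field_simps)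
  finally show ?thesis
    by (rule has_field_derivative_transform_within_open[of _ _ _ "{0<..}"]) (use greater in \<open>auto simp: pexp_def\<close>)
next
  case equal
  have "((\<lambda>y. pexp p y / y) \<longlongrightarrow> 0) (at 0)"
  proof (rule filterlim_split_at)
    have "\<forall>\<^sub>F y in at_left (0::real). y < 0" by (simp add: eventually_at_filter)
    then have "\<forall>\<^sub>F y in at_left (0::real). pexp p y / y = 0" by eventually_elim (simp add: pexp_def)
    then show "((\<lambda>y. pexp p y / y) \<longlongrightarrow> 0) (at_left 0)" by (rule tendsto_eventually)
    have "((\<lambda>y. poly ([:0, 1:] * p) (inverse y) * exp (- inverse y)) \<longlongrightarrow> 0) (at_right (0::real))"
      by (rule filterlim_compose[OF poly_exp_tendsto_0 filterlim_inverse_at_top_right])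
    moreover have "\<forall>\<^sub>F y in at_right (0::real). y > 0" by (simp add: eventually_at_filter)
    then have "\<forall>\<^sub>F y in at_right (0::real). poly ([:0, 1:] * p) (inverse y) * exp (- inverse y) = pexp p y / y"
      by eventually_elim (simp add: pexp_def field_simps)
    ultimately show "((\<lambda>y. pexp p y / y) \<longlongrightarrow> 0) (at_right 0)"
      by (rule Lim_transform_eventually)
  qed
  then show ?thesis using equal by (simp add: has_field_derivative_iff pexp_def)
qed

inductive_set bumps :: "(real \<Rightarrow> real) set" where
  base: "(\<lambda>t. pexp p (1 + t) * pexp r (1 - t)) \<in> bumps"
| add: "f \<in> bumps \<Longrightarrow> g \<in> bumps \<Longrightarrow> (\<lambda>t. f t + g t) \<in> bumps"

lemma bumps_deriv: "f \<in> bumps \<Longrightarrow> \<exists>f'\<in>bumps. \<forall>x. (f has_real_derivative f' x) (at x)"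
proof (induction rule: bumps.induct)
  case (base p r)
  define D where "D p = [:0, 0, 1:] * (p - pderiv p)" for p :: "real poly"
  note der = pexp_DERIV[folded D_def]
  \<comment> \<open>The sign from the inner function \<open>1 - t\<close> is absorbed into the
    polynomial, since the rules of \<open>bumps\<close> provide sums but no scalar
    multiples.\<close>
  have neg: "pexp (- p) t = - pexp p t" for p t by (simp add: pexp_def)
  have "((\<lambda>t. pexp p (1 + t) * pexp r (1 - t)) has_real_derivative
     pexp (D p) (1 + x) * pexp r (1 - x) + pexp p (1 + x) * pexp (- D r) (1 - x)) (at x)" for x
  proof -
    have 1: "((\<lambda>t. pexp p (1 + t)) has_real_derivative pexp (D p) (1 + x) * 1) (at x)"
      by (rule DERIV_chain2[OF der]) (auto intro!: derivative_eq_intros)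
    have 2: "((\<lambda>t. pexp r (1 - t)) has_real_derivative pexp (D r) (1 - x) * (- 1)) (at x)"
      by (rule DERIV_chain2[OF der]) (auto intro!: derivative_eq_intros)
    show ?thesis by (rule DERIV_cong[OF DERIV_mult[OF 1 2]]) (simp add: neg)
  qed
  then show ?case by (intro bexI[OF _ bumps.add[OF bumps.base bumps.base]]) blast
next
  case (add f g)
  then obtain f' g' where "f' \<in> bumps" "g' \<in> bumps" "\<And>x. (f has_real_derivative f' x) (at x)" "\<And>x. (g has_real_derivative g' x) (at x)"
    by blast
  then show ?case by (intro bexI[OF _ bumps.add[of f' g']]) (auto intro: derivative_intros)
qed

text \<open>The bump is positive on the open interval, so its integral is positive and may be
  divided out. The normalisation is a nonnegative integral because it is multiplied over the
  coordinates by Tonelli.\<close>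

lemma ex_bump:
  "\<exists>b. smooth1 b \<and> (\<forall>t. b t \<ge> 0) \<and> (\<forall>t. \<bar>t\<bar> \<ge> 1 \<longrightarrow> b t = 0) \<and> (\<integral>\<^sup>+t. ennreal (b t) \<partial>lborel) = 1"
proof -
  define b where "b t = pexp 1 (1 + t) * pexp 1 (1 - t)" for t
  have sm: "smooth1 b"
    by (rule smooth1_coinduct[OF _ bumps_deriv]) (unfold b_def, rule bumps.base)
  have nn: "b t \<ge> 0" for t by (simp add: b_def pexp_def)
  have z: "b t = 0" if "\<bar>t\<bar> \<ge> 1" for t using that by (auto simp: b_def pexp_def abs_if split: if_splits)
  have pos: "b t > 0" if "\<bar>t\<bar> < 1" for t using that by (simp add: b_def pexp_def abs_if split: if_splits)
  have "set_integrable lborel {-1..1} b"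
    using smooth1_continuous[OF sm] by (rule borel_integrable_atLeastAtMost'[OF continuous_on_subset]) auto
  moreover have "(\<lambda>t. indicator {-1..1} t *\<^sub>R b t) = b"
  proof
    fix t show "indicator {-1..1} t *\<^sub>R b t = b t"
      using z[of t] by (cases "\<bar>t\<bar> \<ge> 1") (auto simp: indicator_def)
  qed
  ultimately have int: "integrable lborel b" by (simp add: set_integrable_def)
  define I where "I = (LINT t|lborel. b t)"
  have "I \<noteq> 0"
  proof
    assume "I = 0"
    then have "AE t in lborel. b t = 0"
      using integral_nonneg_eq_0_iff_AE[OF int] nn by (auto simp: I_def)
    then have "AE t in lborel. t \<notin> {-1<..<1::real}" 
    proof (rule AE_mp, intro AE_I2 impI)
      fix t assume "b t = 0"
      with pos[of t] show "t \<notin> {-1<..<1}" by (auto simp: abs_less_iff)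
    qed
    then have "emeasure lborel {-1<..<1::real} = 0"
      by (subst (asm) AE_iff_measurable[of "{-1<..<1}"]) auto
    then show False by simp
  qed
  moreover have "I \<ge> 0" unfolding I_def by (rule Bochner_Integration.integral_nonneg) (rule nn)
  ultimately have I: "I > 0" by simp
  have "smooth1 (\<lambda>t. inverse I * b (0 + 1 * t))" by (rule smooth1_affine[OF sm])
  moreover have "(\<integral>\<^sup>+t. ennreal (inverse I * b t) \<partial>lborel) = ennreal (LINT t|lborel. inverse I * b t)"
    using int I nn by (intro nn_integral_eq_integral) auto
  moreover have "(LINT t|lborel. inverse I * b t) = 1" using I by (simp add: I_def[symmetric])
  ultimately show ?thesis
    using I nn z by (intro exI[of _ "\<lambda>t. inverse I * b t"]) auto
qed

definition smooth1c :: "(real \<Rightarrow> real) \<Rightarrow> bool" where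
  "smooth1c f \<longleftrightarrow> smooth1 f \<and> (\<exists>R. \<forall>t. \<bar>t\<bar> > R \<longrightarrow> f t = 0)"

text \<open>A function that vanishes on an open set has zero derivative there; the strict inequality
  in \<open>smooth1c\<close> makes the set open.\<close>

lemma smooth1c_deriv: 
  assumes "smooth1c f"
  shows "smooth1c (deriv f)"
proof -
  from assms obtain R where f: "smooth1 f" and R: "\<And>t. \<bar>t\<bar> > R \<Longrightarrow> f t = 0" by (auto simp: smooth1c_def)
  have "deriv f t = 0" if t: "\<bar>t\<bar> > R" for t
  proof -
    have op: "open {t::real. \<bar>t\<bar> > R}" by (intro open_Collect_less continuous_intros)
    have der: "((\<lambda>_. 0) has_real_derivative 0) (at t)" by simp
    have "(f has_real_derivative 0) (at t)"
      by (rule has_field_derivative_transform_within_open[OF der op]) (use t R in auto)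
    then show ?thesis by (rule DERIV_imp_deriv)
  qed
  with smooth1_deriv[OF f] show ?thesis by (auto simp: smooth1c_def)
qed

lemma smooth1c_bounded:
  assumes "smooth1c f"
  shows "\<exists>B. B \<ge> 0 \<and> (\<forall>t. \<bar>f t\<bar> \<le> B)"
proof -
  from assms obtain R where f: "smooth1 f" and R: "\<And>t. \<bar>t\<bar> > R \<Longrightarrow> f t = 0" by (auto simp: smooth1c_def)
  have "compact (f ` {-R..R})" by (rule compact_continuous_image[OF smooth1_continuous[OF f]]) simp
  then obtain B where B: "\<And>t. t \<in> {-R..R} \<Longrightarrow> \<bar>f t\<bar> \<le> B"
    using compact_imp_bounded by (fastforce simp: bounded_iff)
  have "\<bar>f t\<bar> \<le> max B 0" for t
  proof (cases "\<bar>t\<bar> > R")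
    case False
    then have "t \<in> {-R..R}" by auto
    from B[OF this] show ?thesis by simp
  qed (simp add: R)
  then show ?thesis by (intro exI[of _ "max B 0"]) simp
qed

text \<open>Members of \<open>X\<close> represent the iterated partial derivatives on
  \<open>Rn d\<close> only. This suffices because \<open>partial i\<close> with \<open>i < d\<close>
  at a point of \<open>Rn d\<close> sees no values outside \<open>Rn d\<close>.\<close>

lemma smooth_coinduct:
  assumes f: "f \<in> X"
    and cont: "\<And>f. f \<in> X \<Longrightarrow> continuous_on (Rn d) f"
    and der: "\<And>f i. f \<in> X \<Longrightarrow> i < d \<Longrightarrow> \<exists>f'\<in>X. \<forall>x\<in>Rn d. ((\<lambda>t. f (x + t *\<^sub>R unit_vec i)) has_real_derivative f' x) (at 0)"
  shows "smooth d f"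
proof -
  have *: "is \<in> lists {..<d} \<Longrightarrow> \<exists>g\<in>X. \<forall>x\<in>Rn d. foldr partial is f x = g x" for "is"
  proof (induction "is")
    case Nil
    show ?case using f by auto
  next
    case (Cons i js)
    from Cons.prems have i: "i < d" and "js \<in> lists {..<d}" by simp_all
    from Cons.IH[OF this(2)] obtain g where g: "g \<in> X" "\<And>x. x \<in> Rn d \<Longrightarrow> foldr partial js f x = g x" by blast
    from der[OF g(1) i] obtain g' where g': "g' \<in> X" "\<And>x. x \<in> Rn d \<Longrightarrow> ((\<lambda>t. g (x + t *\<^sub>R unit_vec i)) has_real_derivative g' x) (at 0)"
      by blast
    have "foldr partial (i # js) f x = g' x" if x: "x \<in> Rn d" for x
    proof -
      have "foldr partial (i # js) f x = deriv (\<lambda>t. g (x + t *\<^sub>R unit_vec i)) 0"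
        using x i g(2) by (simp add: partial_def)
      also have "\<dots> = g' x" by (rule DERIV_imp_deriv[OF g'(2)[OF x]])
      finally show ?thesis .
    qed
    with g' show ?case by blast
  qed
  show ?thesis
    unfolding smooth_def
  proof (intro ballI conjI allI impI)
    fix "is" assume "is \<in> lists {..<d}"
    from *[OF this] obtain g where g: "g \<in> X" "\<And>x. x \<in> Rn d \<Longrightarrow> foldr partial is f x = g x" by blast
    show "continuous_on (Rn d) (foldr partial is f)"
      using cont[OF g(1)] g(2) by (simp cong: continuous_on_cong)
    fix i x assume i: "i < d" and x: "x \<in> Rn d"
    from der[OF g(1) i] x obtain g' where "((\<lambda>t. g (x + t *\<^sub>R unit_vec i)) has_real_derivative g') (at 0)" by blast
    moreover have "(\<lambda>t. foldr partial is f (x + t *\<^sub>R unit_vec i)) = (\<lambda>t. g (x + t *\<^sub>R unit_vec i))"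
      using g(2) x i by simp
    ultimately show "(\<lambda>t. foldr partial is f (x + t *\<^sub>R unit_vec i)) differentiable at 0"
      by (auto simp: real_differentiable_def)
  qed
qed

text \<open>The conditions of \<open>smooth\<close> for lists of length at most one, which are all
  that the trace estimate uses.\<close>

lemma smooth_partial:
  assumes "smooth d u"
  shows "continuous_on (Rn d) u" "i < d \<Longrightarrow> continuous_on (Rn d) (partial i u)"
    "i < d \<Longrightarrow> x \<in> Rn d \<Longrightarrow> ((\<lambda>t. u (x + t *\<^sub>R unit_vec i)) has_real_derivative partial i u x) (at 0)"
proof -
  have *: "continuous_on (Rn d) (foldr partial is u)" if "is \<in> lists {..<d}" for "is"
    using assms that by (auto simp: smooth_def)
  show "continuous_on (Rn d) u" using *[of "[]"] by simp
  show "continuous_on (Rn d) (partial i u)" if "i < d" using *[of "[i]"] that by simp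
  show "((\<lambda>t. u (x + t *\<^sub>R unit_vec i)) has_real_derivative partial i u x) (at 0)" if "i < d" "x \<in> Rn d"
  proof -
    have "(\<lambda>t. foldr partial [] u (x + t *\<^sub>R unit_vec i)) differentiable at 0"
      using assms that unfolding smooth_def by blast
    then show ?thesis unfolding partial_def by (auto simp: real_differentiable_def dest: DERIV_imp_deriv)
  qed
qed

section \<open>Product kernels and differentiation under the integral\<close>

lemma prod_coord_DERIV:
  assumes g: "\<And>j. j < d \<Longrightarrow> smooth1 (g j)" and i: "i < d"
  shows "((\<lambda>t. \<Prod>j<d. g j (coord (x + t *\<^sub>R unit_vec i) j)) has_real_derivative
    (\<Prod>j<d. (g(i := deriv (g i))) j (coord (x + t *\<^sub>R unit_vec i) j))) (at t)"
proof -
  have split: "(\<Prod>j<d. f j) = f i * (\<Prod>j\<in>{..<d}-{i}. f j)" for f :: "nat \<Rightarrow> real"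
    by (rule prod.remove) (use i in auto)
  have 1: "((\<lambda>t. g i (coord x i + t)) has_real_derivative deriv (g i) (coord x i + t) * 1) (at t)"
    by (rule DERIV_chain2[OF smooth1_DERIV[OF g[OF i]]]) (auto intro!: derivative_eq_intros)
  have "(\<lambda>t. \<Prod>j<d. g j (coord (x + t *\<^sub>R unit_vec i) j)) = (\<lambda>t. g i (coord x i + t) * (\<Prod>j\<in>{..<d}-{i}. g j (coord x j)))"
    unfolding split by (rule ext) (auto intro!: arg_cong2[where f = "(*)"] prod.cong)
  moreover have "(\<Prod>j<d. (g(i := deriv (g i))) j (coord (x + t *\<^sub>R unit_vec i) j)) =
     deriv (g i) (coord x i + t) * (\<Prod>j\<in>{..<d}-{i}. g j (coord x j))"
    unfolding split by (auto intro!: arg_cong2[where f = "(*)"] prod.cong)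
  ultimately show ?thesis using DERIV_cmult_right[OF 1] by simp
qed

lemma prod_coord_continuous:
  assumes g: "\<And>j. j < d \<Longrightarrow> smooth1 (g j)"
  shows "continuous_on A (\<lambda>x. \<Prod>j<d. g j (coord x j))"
  by (intro continuous_on_prod continuous_on_compose2[OF smooth1_continuous[OF g, of _ UNIV]] continuous_intros) auto

lemma smooth_prod:
  assumes "\<And>j. j < d \<Longrightarrow> smooth1 (g j)"
  shows "smooth d (\<lambda>x. \<Prod>j<d. g j (coord x j))"
proof (rule smooth_coinduct[where X = "{\<lambda>x. \<Prod>j<d. g j (coord x j) | g. \<forall>j<d. smooth1 (g j)}"])
  show "(\<lambda>x. \<Prod>j<d. g j (coord x j)) \<in> {\<lambda>x. \<Prod>j<d. g j (coord x j) | g. \<forall>j<d. smooth1 (g j)}"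
    using assms by blast
next
  fix f assume "f \<in> {\<lambda>x. \<Prod>j<d. g j (coord x j) | g. \<forall>j<d. smooth1 (g j)}"
  then obtain g where f: "f = (\<lambda>x. \<Prod>j<d. g j (coord x j))" and g: "\<And>j. j < d \<Longrightarrow> smooth1 (g j)" by blast
  show "continuous_on (Rn d) f" unfolding f by (rule prod_coord_continuous[OF g])
  fix i assume i: "i < d"
  have "((\<lambda>t. f (x + t *\<^sub>R unit_vec i)) has_real_derivative (\<Prod>j<d. (g(i := deriv (g i))) j (coord x j))) (at 0)" for x
    using prod_coord_DERIV[OF g i, where x = x and t = 0] unfolding f by simp
  then show "\<exists>f'\<in>{\<lambda>x. \<Prod>j<d. g j (coord x j) | g. \<forall>j<d. smooth1 (g j)}.
      \<forall>x\<in>Rn d. ((\<lambda>t. f (x + t *\<^sub>R unit_vec i)) has_real_derivative f' x) (at 0)"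
    using g smooth1_deriv[OF g[OF i]]
    by (intro bexI[where x = "\<lambda>x. \<Prod>j<d. (g(i := deriv (g i))) j (coord x j)"] CollectI exI[where x = "g(i := deriv (g i))"]) auto
qed

text \<open>The mean value theorem bounds the difference quotients of \<open>k\<close> by
  \<open>B\<close>, so \<open>B * \<bar>V y\<bar>\<close> dominates; the limit is taken along
  sequences to bring in dominated convergence.\<close>

lemma DERIV_under_integral:
  fixes k k' :: "real \<Rightarrow> 'a \<Rightarrow> real"
  assumes V: "integrable M V"
    and der: "\<And>t y. y \<in> space M \<Longrightarrow> ((\<lambda>t. k t y) has_real_derivative k' t y) (at t)"
    and b: "\<And>t y. y \<in> space M \<Longrightarrow> \<bar>k t y\<bar> \<le> B" and b': "\<And>t y. y \<in> space M \<Longrightarrow> \<bar>k' t y\<bar> \<le> B"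
    and m: "\<And>t. k t \<in> borel_measurable M" and m': "\<And>t. k' t \<in> borel_measurable M"
  shows "((\<lambda>t. LINT y|M. V y * k t y) has_real_derivative (LINT y|M. V y * k' 0 y)) (at 0)"
proof -
  have Vm: "V \<in> borel_measurable M" using V by auto
  have int: "integrable M (\<lambda>y. V y * k t y)" for t
  proof (rule Bochner_Integration.integrable_bound)
    show "integrable M (\<lambda>y. B * \<bar>V y\<bar>)" using V by simp
    show "AE y in M. norm (V y * k t y) \<le> norm (B * \<bar>V y\<bar>)"
    proof (rule AE_I2)
      fix y assume y: "y \<in> space M"
      have "\<bar>V y * k t y\<bar> \<le> \<bar>V y\<bar> * B" using b[OF y] by (simp add: abs_mult mult_left_mono)
      also have "\<dots> \<le> \<bar>B * \<bar>V y\<bar>\<bar>" by (simp add: mult.commute)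
      finally show "norm (V y * k t y) \<le> norm (B * \<bar>V y\<bar>)" by simp
    qed
  qed (intro borel_measurable_times Vm m)
  show ?thesis
    unfolding has_field_derivative_iff tendsto_at_iff_sequentially
  proof (intro allI impI)
    fix X :: "nat \<Rightarrow> real" assume X0: "\<forall>i. X i \<in> UNIV - {0}" and X: "X \<longlonglongrightarrow> 0"
    have lim: "(\<lambda>n. LINT y|M. V y * ((k (X n) y - k 0 y) / X n)) \<longlonglongrightarrow> (LINT y|M. V y * k' 0 y)"
    proof (rule integral_dominated_convergence[where w = "\<lambda>y. B * \<bar>V y\<bar>"])
      show "integrable M (\<lambda>y. B * \<bar>V y\<bar>)" using V by simp
      show "AE y in M. (\<lambda>n. V y * ((k (X n) y - k 0 y) / X n)) \<longlonglongrightarrow> V y * k' 0 y"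
      proof (rule AE_I2)
        fix y assume y: "y \<in> space M"
        have "((\<lambda>h. (k h y - k 0 y) / (h - 0)) \<longlongrightarrow> k' 0 y) (at 0)"
          using der[OF y, of 0] by (simp add: has_field_derivative_iff)
        then have "((\<lambda>h. (k h y - k 0 y) / (h - 0)) \<circ> X) \<longlonglongrightarrow> k' 0 y"
          using X X0 unfolding tendsto_at_iff_sequentially by blast
        then show "(\<lambda>n. V y * ((k (X n) y - k 0 y) / X n)) \<longlonglongrightarrow> V y * k' 0 y"
          by (intro tendsto_intros) (simp add: o_def)
      qed
      show "AE y in M. norm (V y * ((k (X n) y - k 0 y) / X n)) \<le> B * \<bar>V y\<bar>" for n
      proof (rule AE_I2)
        fix y assume y: "y \<in> space M"
        have "norm (k (X n) y - k 0 y) \<le> B * norm (X n - 0)"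
          by (rule field_differentiable_bound[of UNIV "\<lambda>t. k t y" "\<lambda>t. k' t y" B])
            (use der[OF y] b'[OF y] in \<open>auto\<close>)
        then have "\<bar>(k (X n) y - k 0 y) / X n\<bar> \<le> B"
          using X0 by (simp add: divide_le_eq abs_divide)
        then have "\<bar>V y\<bar> * \<bar>(k (X n) y - k 0 y) / X n\<bar> \<le> \<bar>V y\<bar> * B"
          by (intro mult_left_mono) auto
        then show "norm (V y * ((k (X n) y - k 0 y) / X n)) \<le> B * \<bar>V y\<bar>"
          by (simp add: abs_mult mult.commute)
      qed
    qed (intro borel_measurable_times borel_measurable_divide borel_measurable_diff borel_measurable_const Vm m m')+
    have eq: "(LINT y|M. V y * ((k (X n) y - k 0 y) / X n)) = ((LINT y|M. V y * k (X n) y) - (LINT y|M. V y * k 0 y)) / (X n - 0)" for n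
    proof -
      have "(LINT y|M. V y * ((k (X n) y - k 0 y) / X n)) = (LINT y|M. (V y * k (X n) y - V y * k 0 y) / X n)"
        by (intro Bochner_Integration.integral_cong) (auto simp: algebra_simps diff_divide_distrib)
      also have "\<dots> = ((LINT y|M. V y * k (X n) y) - (LINT y|M. V y * k 0 y)) / X n"
        using int by simp
      finally show ?thesis by simp
    qed
    from lim show "((\<lambda>t. ((LINT y|M. V y * k t y) - (LINT y|M. V y * k 0 y)) / (t - 0)) \<circ> X) \<longlonglongrightarrow> (LINT y|M. V y * k' 0 y)"
      unfolding o_def eq .
  qed
qed

text \<open>All kernels \<open>y \<mapsto> \<Prod>\<^sub>j g j (A j + s * x j - y j)\<close> at once; the derivative in
  direction \<open>i\<close> replaces \<open>g i\<close> by its derivative and produces a factor \<open>s\<close>.\<close>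

definition mollify :: "nat \<Rightarrow> (fvec \<Rightarrow> real) \<Rightarrow> fvec \<Rightarrow> real \<Rightarrow> (nat \<Rightarrow> real \<Rightarrow> real) \<Rightarrow> fvec \<Rightarrow> real" where
  "mollify d V A s g x = (LINT y|lborel_Rn d. V y * (\<Prod>j<d. g j (coord (A + s *\<^sub>R x - y) j)))"

lemma prod_bounded:
  assumes "\<And>j. j < d \<Longrightarrow> smooth1c (g j)"
  shows "\<exists>B. B \<ge> 0 \<and> (\<forall>z::fvec. \<bar>\<Prod>j<d. g j (coord z j)\<bar> \<le> B)"
proof -
  obtain B where B: "\<And>j. j < d \<Longrightarrow> B j \<ge> 0 \<and> (\<forall>t. \<bar>g j t\<bar> \<le> B j)"
    using smooth1c_bounded[OF assms] by metis
  have "\<bar>\<Prod>j<d. g j (coord z j)\<bar> \<le> (\<Prod>j<d. B j)" for z :: fvec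
    unfolding abs_prod by (intro prod_mono) (use B in auto)
  moreover have "(\<Prod>j<d. B j) \<ge> 0" by (intro prod_nonneg) (use B in auto)
  ultimately show ?thesis by blast
qed

lemma mollify_kernel_measurable:
  assumes "\<And>j. j < d \<Longrightarrow> smooth1c (g j)"
  shows "(\<lambda>y. \<Prod>j<d. g j (coord (w - y) j)) \<in> borel_measurable (lborel_Rn d)"
proof (rule continuous_on_imp_measurable_Rn)
  have "continuous_on UNIV (\<lambda>x. \<Prod>j<d. g j (coord x j))"
    by (rule prod_coord_continuous) (use assms in \<open>auto simp: smooth1c_def\<close>)
  then show "continuous_on (Rn d) (\<lambda>y. \<Prod>j<d. g j (coord (w - y) j))"
    by (rule continuous_on_compose2) (auto intro!: continuous_intros)
qed

lemma mollify_DERIV: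
  assumes V: "integrable (lborel_Rn d) V" and g: "\<And>j. j < d \<Longrightarrow> smooth1c (g j)" and i: "i < d"
  shows "((\<lambda>t. mollify d V A s g (x + t *\<^sub>R unit_vec i)) has_real_derivative s * mollify d V A s (g(i := deriv (g i))) x) (at 0)"
proof -
  let ?g' = "g(i := deriv (g i))"
  have g': "smooth1c (?g' j)" if "j < d" for j using g that smooth1c_deriv[OF g[OF i]] by simp
  from prod_bounded[of d g] g obtain B1 where B1: "B1 \<ge> 0" "\<And>z. \<bar>\<Prod>j<d. g j (coord z j)\<bar> \<le> B1" by blast
  from prod_bounded[of d ?g'] g' obtain B2 where B2: "B2 \<ge> 0" "\<And>z. \<bar>\<Prod>j<d. ?g' j (coord z j)\<bar> \<le> B2" by blast
  define k where "k t y = (\<Prod>j<d. g j (coord ((A + s *\<^sub>R x - y) + (s * t) *\<^sub>R unit_vec i) j))" for t y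
  define k' where "k' t y = s * (\<Prod>j<d. ?g' j (coord ((A + s *\<^sub>R x - y) + (s * t) *\<^sub>R unit_vec i) j))" for t y
  have eq: "A + s *\<^sub>R (x + t *\<^sub>R unit_vec i) - y = (A + s *\<^sub>R x - y) + (s * t) *\<^sub>R unit_vec i" for t y
    by (simp add: algebra_simps)
  have eq2: "(A + s *\<^sub>R x - y) + (s * t) *\<^sub>R unit_vec i = (A + s *\<^sub>R x + (s * t) *\<^sub>R unit_vec i) - y" for t y
    by (simp add: algebra_simps)
  have "((\<lambda>t. LINT y|lborel_Rn d. V y * k t y) has_real_derivative (LINT y|lborel_Rn d. V y * k' 0 y)) (at 0)"
  proof (rule DERIV_under_integral[OF V, where B = "max B1 (\<bar>s\<bar> * B2)"])
    fix t y
    have sm: "smooth1 (g j)" if "j < d" for j using g[OF that] by (simp add: smooth1c_def)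
    have "((\<lambda>t. k t y) has_real_derivative (\<Prod>j<d. ?g' j (coord ((A + s *\<^sub>R x - y) + (s * t) *\<^sub>R unit_vec i) j)) * s) (at t)"
      unfolding k_def
      by (rule DERIV_chain2[OF prod_coord_DERIV[OF sm i]]) (auto intro!: derivative_eq_intros)
    then show "((\<lambda>t. k t y) has_real_derivative k' t y) (at t)" by (simp add: k'_def mult.commute)
    have "\<bar>k t y\<bar> \<le> B1" unfolding k_def by (rule B1(2))
    then show "\<bar>k t y\<bar> \<le> max B1 (\<bar>s\<bar> * B2)" by simp
    have "\<bar>k' t y\<bar> \<le> \<bar>s\<bar> * B2" unfolding k'_def abs_mult by (intro mult_left_mono B2) auto
    then show "\<bar>k' t y\<bar> \<le> max B1 (\<bar>s\<bar> * B2)" by simp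
  next
    show "k t \<in> borel_measurable (lborel_Rn d)" for t
      unfolding k_def eq2 by (rule mollify_kernel_measurable[OF g])
    show "k' t \<in> borel_measurable (lborel_Rn d)" for t
      unfolding k'_def eq2 by (rule borel_measurable_times[OF borel_measurable_const mollify_kernel_measurable[OF g']])
  qed
  then show ?thesis
    unfolding mollify_def k_def k'_def eq by (simp add: mult.left_commute[of _ s])
qed

lemma mollify_continuous:
  assumes V: "integrable (lborel_Rn d) V" and g: "\<And>j. j < d \<Longrightarrow> smooth1c (g j)"
  shows "continuous_on (Rn d) (mollify d V A s g)"
  unfolding continuous_on_sequentially
proof (intro allI ballI impI, elim conjE)
  fix X x assume x: "x \<in> Rn d" and X: "\<forall>n. X n \<in> Rn d" "X \<longlonglongrightarrow> x"
  from prod_bounded[of d g] g obtain B where B: "B \<ge> 0" "\<And>z. \<bar>\<Prod>j<d. g j (coord z j)\<bar> \<le> B" by blast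
  have Vm: "V \<in> borel_measurable (lborel_Rn d)" using V by auto
  have c: "continuous_on UNIV (\<lambda>z. \<Prod>j<d. g j (coord z j))"
    by (rule prod_coord_continuous) (use g in \<open>auto simp: smooth1c_def\<close>)
  have "(\<lambda>n. mollify d V A s g (X n)) \<longlonglongrightarrow> mollify d V A s g x"
    unfolding mollify_def
  proof (rule integral_dominated_convergence[where w = "\<lambda>y. B * \<bar>V y\<bar>"])
    show "integrable (lborel_Rn d) (\<lambda>y. B * \<bar>V y\<bar>)" using V by simp
    show "AE y in lborel_Rn d. (\<lambda>n. V y * (\<Prod>j<d. g j (coord (A + s *\<^sub>R X n - y) j))) \<longlonglongrightarrow>
        V y * (\<Prod>j<d. g j (coord (A + s *\<^sub>R x - y) j))"
    proof (intro AE_I2 tendsto_mult tendsto_const)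
      fix y
      have "(\<lambda>n. A + s *\<^sub>R X n - y) \<longlonglongrightarrow> A + s *\<^sub>R x - y" by (intro tendsto_intros X)
      from continuous_on_tendsto_compose[OF c this]
      show "(\<lambda>n. \<Prod>j<d. g j (coord (A + s *\<^sub>R X n - y) j)) \<longlonglongrightarrow> (\<Prod>j<d. g j (coord (A + s *\<^sub>R x - y) j))" by simp
    qed
    show "AE y in lborel_Rn d. norm (V y * (\<Prod>j<d. g j (coord (A + s *\<^sub>R X n - y) j))) \<le> B * \<bar>V y\<bar>" for n
    proof (rule AE_I2)
      fix y
      have "\<bar>V y\<bar> * \<bar>\<Prod>j<d. g j (coord (A + s *\<^sub>R X n - y) j)\<bar> \<le> \<bar>V y\<bar> * B"
        by (intro mult_left_mono B) auto
      then show "norm (V y * (\<Prod>j<d. g j (coord (A + s *\<^sub>R X n - y) j))) \<le> B * \<bar>V y\<bar>"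
        by (simp add: abs_mult mult.commute)
    qed
  qed (rule borel_measurable_times[OF Vm mollify_kernel_measurable[OF g]], assumption)+
  then show "(mollify d V A s g \<circ> X) \<longlonglongrightarrow> mollify d V A s g x" by (simp add: o_def)
qed

text \<open>The scalars in the invariant class collect the powers of \<open>s\<close> produced by
  repeated differentiation.\<close>

lemma mollify_smooth:
  assumes V: "integrable (lborel_Rn d) V" and g: "\<And>j. j < d \<Longrightarrow> smooth1c (g j)"
  shows "smooth d (mollify d V A s g)"
proof (rule smooth_coinduct[where X = "{\<lambda>x. c * mollify d V A s g x | c g. \<forall>j<d. smooth1c (g j)}"])
  show "mollify d V A s g \<in> {\<lambda>x. c * mollify d V A s g x | c g. \<forall>j<d. smooth1c (g j)}"
    using g by (intro CollectI exI[of _ 1] exI[of _ g]) auto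
next
  fix f assume "f \<in> {\<lambda>x. c * mollify d V A s g x | c g. \<forall>j<d. smooth1c (g j)}"
  then obtain c g where f: "f = (\<lambda>x. c * mollify d V A s g x)" and g: "\<And>j. j < d \<Longrightarrow> smooth1c (g j)" by blast
  show "continuous_on (Rn d) f" unfolding f by (intro continuous_intros mollify_continuous[OF V g])
  fix i assume i: "i < d"
  have "((\<lambda>t. f (x + t *\<^sub>R unit_vec i)) has_real_derivative (c * s) * mollify d V A s (g(i := deriv (g i))) x) (at 0)" for x
    using DERIV_cmult[OF mollify_DERIV[OF V g i, where A = A and s = s and x = x], where c = c] unfolding f by (simp add: mult.assoc)
  moreover have "\<forall>j<d. smooth1c ((g(i := deriv (g i))) j)" using g smooth1c_deriv[OF g[OF i]] by simp
  ultimately show "\<exists>f'\<in>{\<lambda>x. c * mollify d V A s g x | c g. \<forall>j<d. smooth1c (g j)}.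
      \<forall>x\<in>Rn d. ((\<lambda>t. f (x + t *\<^sub>R unit_vec i)) has_real_derivative f' x) (at 0)"
    by (intro bexI[where x = "\<lambda>x. (c * s) * mollify d V A s (g(i := deriv (g i))) x"] CollectI exI[where x = "c * s"] exI[where x = "g(i := deriv (g i))"]) auto
qed


section \<open>Approximation by mollification\<close>

lemma abs_integral_le:
  fixes f g :: "'a \<Rightarrow> real"
  assumes "integrable M f" "integrable M g" "\<And>x. x \<in> space M \<Longrightarrow> \<bar>f x\<bar> \<le> g x"
  shows "\<bar>LINT x|M. f x\<bar> \<le> (LINT x|M. g x)"
  by (rule order_trans[OF integral_abs_bound integral_mono]) (use assms in auto)

text \<open>A box is the continuous image of a lower-dimensional box times an interval. Boxes supply
  the compact supports of test functions; in \<open>fvec\<close> itself, closed and bounded does not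
  mean compact.\<close>

lemma compact_box_Rn: "compact {y \<in> Rn d. \<forall>j<d. coord y j \<in> {l j..u j}}"
proof (induction d)
  case 0
  have "{y \<in> Rn 0. \<forall>j<0. coord y j \<in> {l j..u j}} = {0}" by auto
  then show ?case by simp
next
  case (Suc d)
  let ?B = "\<lambda>d. {y \<in> Rn d. \<forall>j<d. coord y j \<in> {l j..u j}}"
  have "compact ((\<lambda>p. fst p + snd p *\<^sub>R unit_vec d) ` (?B d \<times> {l d..u d}))"
    by (intro compact_continuous_image compact_Times Suc continuous_intros) auto
  also have "(\<lambda>p. fst p + snd p *\<^sub>R unit_vec d) ` (?B d \<times> {l d..u d}) = ?B (Suc d)"
  proof safe
    fix y t assume "y \<in> Rn d" "\<forall>j<d. coord y j \<in> {l j..u j}" "t \<in> {l d..u d}"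
    then show "fst (y, t) + snd (y, t) *\<^sub>R unit_vec d \<in> Rn (Suc d)"
      "j < Suc d \<Longrightarrow> coord (fst (y, t) + snd (y, t) *\<^sub>R unit_vec d) j \<in> {l j..u j}" for j
      by (auto simp: Rn_def less_Suc_eq)
  next
    fix y assume y: "y \<in> Rn (Suc d)" "\<forall>j<Suc d. coord y j \<in> {l j..u j}"
    let ?y = "y - coord y d *\<^sub>R unit_vec d"
    have "?y \<in> Rn d" using y(1) by (auto simp: Rn_def le_Suc_eq)
    moreover have "\<forall>j<d. coord ?y j \<in> {l j..u j}" using y(2) by auto
    ultimately show "y \<in> (\<lambda>p. fst p + snd p *\<^sub>R unit_vec d) ` (?B d \<times> {l d..u d})"
      using y(2) by (intro image_eqI[of _ _ "(?y, coord y d)"]) auto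
  qed
  finally show ?case .
qed

definition bump :: "real \<Rightarrow> real" where
  "bump = (SOME b. smooth1 b \<and> (\<forall>t. b t \<ge> 0) \<and> (\<forall>t. \<bar>t\<bar> \<ge> 1 \<longrightarrow> b t = 0) \<and> (\<integral>\<^sup>+t. ennreal (b t) \<partial>lborel) = 1)"

lemma bump: "smooth1 bump" "bump t \<ge> 0" "\<bar>t\<bar> \<ge> 1 \<Longrightarrow> bump t = 0" "(\<integral>\<^sup>+t. ennreal (bump t) \<partial>lborel) = 1"
  using someI_ex[OF ex_bump] unfolding bump_def[symmetric] by auto

text \<open>Rescaling keeps the integral and shrinks the support to half-width \<open>e\<close>. The
  summand \<open>0\<close> matches the shape \<open>a + b * t\<close> of the affine substitution
  rules.\<close>

definition sbump :: "real \<Rightarrow> real \<Rightarrow> real" where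
  "sbump e t = (1 / e) * bump (0 + (1 / e) * t)"

lemma sbump:
  assumes e: "e > 0"
  shows "smooth1c (sbump e)" "sbump e t \<ge> 0" "\<bar>t\<bar> \<ge> e \<Longrightarrow> sbump e t = 0" "(\<integral>\<^sup>+t. ennreal (sbump e t) \<partial>lborel) = 1"
proof -
  show z: "sbump e t = 0" if "\<bar>t\<bar> \<ge> e" for t
    using bump(3)[of "t / e"] that e by (simp add: sbump_def abs_divide)
  have "smooth1 (sbump e)" unfolding sbump_def by (rule smooth1_affine[OF bump(1)])
  with z show "smooth1c (sbump e)" unfolding smooth1c_def by (auto intro!: exI[of _ e])
  show "sbump e t \<ge> 0" using e bump(2) by (simp add: sbump_def)
  have bm: "bump \<in> borel_measurable borel" by (rule borel_measurable_continuous_onI[OF smooth1_continuous[OF bump(1)]])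
  have "1 = (\<integral>\<^sup>+t. ennreal (bump t) \<partial>lborel)" by (simp add: bump(4))
  also have "\<dots> = ennreal \<bar>1 / e\<bar> * (\<integral>\<^sup>+t. ennreal (bump (0 + (1 / e) * t)) \<partial>lborel)"
    by (rule nn_integral_real_affine) (use e bm in auto)
  also have "\<dots> = (\<integral>\<^sup>+t. ennreal (1 / e) * ennreal (bump (0 + (1 / e) * t)) \<partial>lborel)"
    using e bm by (subst nn_integral_cmult) auto
  also have "\<dots> = (\<integral>\<^sup>+t. ennreal (sbump e t) \<partial>lborel)"
    using e bump(2) by (intro nn_integral_cong) (simp add: sbump_def ennreal_mult[symmetric])
  finally show "(\<integral>\<^sup>+t. ennreal (sbump e t) \<partial>lborel) = 1" by simp
qed

text \<open>A product kernel, supported in a cube, instead of a radial one: its mass factorises over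
  the coordinates, and a partial derivative touches a single factor.\<close>

definition kern :: "nat \<Rightarrow> real \<Rightarrow> fvec \<Rightarrow> real" where
  "kern d e z = (\<Prod>j<d. sbump e (coord z j))"

lemma kern_nonneg: "e > 0 \<Longrightarrow> kern d e z \<ge> 0"
  unfolding kern_def by (intro prod_nonneg) (simp add: sbump(2))

lemma kern_nonzero_coord:
  assumes "e > 0" "kern d e z \<noteq> 0" "j < d"
  shows "\<bar>coord z j\<bar> < e"
proof (rule ccontr)
  assume "\<not> \<bar>coord z j\<bar> < e"
  then have "sbump e (coord z j) = 0" using sbump(3)[OF assms(1)] by simp
  then have "kern d e z = 0" unfolding kern_def using assms(3) by (intro prod_zero) auto
  with assms(2) show False by simp
qed

lemma kern_continuous: "e > 0 \<Longrightarrow> continuous_on A (kern d e)"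
  unfolding kern_def by (rule prod_coord_continuous) (use sbump(1) smooth1c_def in blast)

lemma kern_measurable: "e > 0 \<Longrightarrow> kern d e \<in> borel_measurable (lborel_Rn d)"
  by (rule continuous_on_imp_measurable_Rn[OF kern_continuous])

lemma nn_integral_kern:
  assumes e: "e > 0"
  shows "(\<integral>\<^sup>+z. ennreal (kern d e z) \<partial>lborel_Rn d) = 1"
proof -
  have m: "sbump e \<in> borel_measurable borel"
    using smooth1_continuous sbump(1)[OF e] by (auto simp: smooth1c_def intro: borel_measurable_continuous_onI)
  have "(\<integral>\<^sup>+z. ennreal (kern d e z) \<partial>lborel_Rn d) = (\<integral>\<^sup>+z. (\<Prod>j<d. ennreal (sbump e (coord z j))) \<partial>lborel_Rn d)"
    unfolding kern_def by (intro nn_integral_cong prod_ennreal[symmetric]) (simp add: sbump(2)[OF e])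
  also have "\<dots> = (\<Prod>j<d. \<integral>\<^sup>+t. ennreal (sbump e t) \<partial>lborel)"
    by (rule nn_integral_prod_Rn) (use m in auto)
  finally show ?thesis by (simp add: sbump(4)[OF e])
qed

text \<open>Translation and scaling applied to mass one. The case \<open>s = -1\<close> integrates
  the kernel over the averaged variable, \<open>s > 0\<close> over the evaluation point; the L^2
  bound needs both.\<close>

lemma nn_integral_kern_affine:
  assumes e: "e > 0" and s: "s \<noteq> 0" and w: "w \<in> Rn d"
  shows "ennreal (\<bar>s\<bar> ^ d) * (\<integral>\<^sup>+x. ennreal (kern d e (w + s *\<^sub>R x)) \<partial>lborel_Rn d) = 1"
proof -
  have m: "(\<lambda>z. ennreal (kern d e z)) \<in> borel_measurable (lborel_Rn d)"
    by (rule measurable_compose_rev[OF _ kern_measurable[OF e]]) simp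
  have m2: "(\<lambda>z. ennreal (kern d e (w + z))) \<in> borel_measurable (lborel_Rn d)"
    by (rule measurable_compose[OF measurable_translate_Rn[OF w] m])
  have "ennreal (\<bar>s\<bar> ^ d) * (\<integral>\<^sup>+x. ennreal (kern d e (w + s *\<^sub>R x)) \<partial>lborel_Rn d)
     = (\<integral>\<^sup>+x. ennreal (kern d e (w + x)) \<partial>lborel_Rn d)"
    by (rule nn_integral_scale_Rn[OF s m2, symmetric])
  also have "\<dots> = 1" unfolding nn_integral_translate_Rn[OF w m] by (rule nn_integral_kern[OF e])
  finally show ?thesis .
qed

lemma nn_integral_kern_reflect:
  assumes e: "e > 0" and w: "w \<in> Rn d"
  shows "(\<integral>\<^sup>+y. ennreal (kern d e (w - y)) \<partial>lborel_Rn d) = 1"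
  using nn_integral_kern_affine[OF e _ w, of "-1"] by simp

lemma kern_translate_measurable:
  assumes e: "e > 0"
  shows "(\<lambda>y. kern d e (w - y)) \<in> borel_measurable (lborel_Rn d)"
  by (rule continuous_on_imp_measurable_Rn)
    (rule continuous_on_compose2[OF kern_continuous[OF e, of UNIV]], auto intro!: continuous_intros)

lemma integral_kern_reflect:
  assumes e: "e > 0" and w: "w \<in> Rn d"
  shows "integrable (lborel_Rn d) (\<lambda>y. kern d e (w - y))" "(LINT y|lborel_Rn d. kern d e (w - y)) = 1"
proof -
  show "integrable (lborel_Rn d) (\<lambda>y. kern d e (w - y))"
    using nn_integral_kern_reflect[OF e w] kern_nonneg[OF e]
    by (simp add: integrable_iff_bounded kern_translate_measurable[OF e])
  show "(LINT y|lborel_Rn d. kern d e (w - y)) = 1"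
    using nn_integral_kern_reflect[OF e w] kern_nonneg[OF e]
    by (subst integral_eq_nn_integral) (auto simp: kern_translate_measurable[OF e])
qed

lemma kern_bounded: 
  assumes "e > 0" 
  shows "\<exists>B\<ge>0. \<forall>z. \<bar>kern d e z\<bar> \<le> B"
  unfolding kern_def using prod_bounded[of d "\<lambda>_. sbump e"] sbump(1)[OF assms] by auto

text \<open>Dilation and mollification in one operator: an average of \<open>V\<close> around the
  image of \<open>x\<close> under the affine map given by \<open>A\<close> and
  \<open>s\<close>.\<close>

definition moll :: "nat \<Rightarrow> fvec \<Rightarrow> real \<Rightarrow> real \<Rightarrow> (fvec \<Rightarrow> real) \<Rightarrow> fvec \<Rightarrow> real" where
  "moll d A s e V = mollify d V A s (\<lambda>_. sbump e)"

lemma moll_eq: "moll d A s e V x = (LINT y|lborel_Rn d. V y * kern d e (A + s *\<^sub>R x - y))"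
  by (simp add: moll_def mollify_def kern_def)

lemma integrable_mult_kern:
  assumes e: "e > 0" and V: "integrable (lborel_Rn d) V"
  shows "integrable (lborel_Rn d) (\<lambda>y. V y * kern d e (w - y))"
proof -
  obtain B where B: "B \<ge> 0" "\<And>z. \<bar>kern d e z\<bar> \<le> B" using kern_bounded[OF e] by blast
  show ?thesis
  proof (rule Bochner_Integration.integrable_bound)
    show "integrable (lborel_Rn d) (\<lambda>y. B * V y)" using V by simp
    show "(\<lambda>y. V y * kern d e (w - y)) \<in> borel_measurable (lborel_Rn d)"
      by (rule borel_measurable_times[OF borel_measurable_integrable[OF V] kern_translate_measurable[OF e]])
    show "AE y in lborel_Rn d. norm (V y * kern d e (w - y)) \<le> norm (B * V y)"
    proof (rule AE_I2)
      fix y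
      have "\<bar>V y\<bar> * \<bar>kern d e (w - y)\<bar> \<le> \<bar>V y\<bar> * B" by (intro mult_left_mono B) auto
      then show "norm (V y * kern d e (w - y)) \<le> norm (B * V y)" using B(1) by (simp add: abs_mult mult.commute)
    qed
  qed
qed

lemma moll_diff:
  assumes e: "e > 0" and V: "integrable (lborel_Rn d) V" and W: "integrable (lborel_Rn d) W"
  shows "moll d A s e (\<lambda>y. V y - W y) x = moll d A s e V x - moll d A s e W x"
  unfolding moll_eq left_diff_distrib
  by (rule Bochner_Integration.integral_diff) (use integrable_mult_kern[OF e] V W in auto)

lemma moll_smooth:
  assumes e: "e > 0" and V: "integrable (lborel_Rn d) V"
  shows "smooth d (moll d A s e V)"
  unfolding moll_def by (rule mollify_smooth[OF V sbump(1)[OF e]])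

text \<open>Jensen's inequality for the probability density \<open>kern\<close>, followed by Fubini.\<close>

lemma moll_l2:
  assumes e: "e > 0" and V: "integrable (lborel_Rn d) V" and V2: "sq_int (lborel_Rn d) V"
    and s: "s > 0" and A: "A \<in> Rn d"
  shows "sq_int (lborel_Rn d) (moll d A s e V)" "s ^ d * (l2 (lborel_Rn d) (moll d A s e V))\<^sup>2 \<le> (l2 (lborel_Rn d) V)\<^sup>2"
proof -
  let ?M = "lborel_Rn d"
  interpret sigma_finite_measure ?M by (rule sigma_finite_lborel_Rn)
  interpret pair_sigma_finite ?M ?M ..
  have Vm: "V \<in> borel_measurable ?M" using V by auto
  have pw: "ennreal ((moll d A s e V x)\<^sup>2) \<le> (\<integral>\<^sup>+y. ennreal ((V y)\<^sup>2) * ennreal (kern d e (A + s *\<^sub>R x - y)) \<partial>?M)"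
    if x: "x \<in> Rn d" for x
  proof -
    let ?k = "\<lambda>y. kern d e (A + s *\<^sub>R x - y)"
    have w: "A + s *\<^sub>R x \<in> Rn d" using A x by simp
    have km: "?k \<in> borel_measurable ?M" by (rule kern_translate_measurable[OF e])
    have k0: "?k y \<ge> 0" for y by (rule kern_nonneg[OF e])
    have "ennreal \<bar>moll d A s e V x\<bar> \<le> (\<integral>\<^sup>+y. ennreal \<bar>V y * ?k y\<bar> \<partial>?M)"
      using integral_norm_bound_ennreal[OF integrable_mult_kern[OF e V, of "A + s *\<^sub>R x"]] by (simp add: moll_eq)
    \<comment> \<open>Splitting the kernel into two square roots lets Cauchy-Schwarz play the role
      of Jensen's inequality; the second factor has mass one.\<close>
    also have "\<dots> = (\<integral>\<^sup>+y. ennreal (\<bar>V y\<bar> * sqrt (?k y)) * ennreal (sqrt (?k y)) \<partial>?M)"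
      using k0 by (intro nn_integral_cong) (simp add: ennreal_mult[symmetric] abs_mult mult.assoc)
    finally have "(ennreal \<bar>moll d A s e V x\<bar>)\<^sup>2 \<le> (\<integral>\<^sup>+y. ennreal (\<bar>V y\<bar> * sqrt (?k y)) * ennreal (sqrt (?k y)) \<partial>?M)\<^sup>2"
      by (intro power_mono) auto
    also have "\<dots> \<le> (\<integral>\<^sup>+y. (ennreal (\<bar>V y\<bar> * sqrt (?k y)))\<^sup>2 \<partial>?M) * (\<integral>\<^sup>+y. (ennreal (sqrt (?k y)))\<^sup>2 \<partial>?M)"
      by (rule Cauchy_Schwarz_nn_integral)
        (intro measurable_compose[OF _ measurable_ennreal] borel_measurable_times borel_measurable_abs Vm
           measurable_compose[OF km borel_measurable_sqrt])+
    also have "(\<integral>\<^sup>+y. (ennreal (sqrt (?k y)))\<^sup>2 \<partial>?M) = (\<integral>\<^sup>+y. ennreal (?k y) \<partial>?M)"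
      using k0 by (intro nn_integral_cong) (simp add: ennreal_power)
    also have "\<dots> = 1" by (rule nn_integral_kern_reflect[OF e w])
    also have "(\<integral>\<^sup>+y. (ennreal (\<bar>V y\<bar> * sqrt (?k y)))\<^sup>2 \<partial>?M) = (\<integral>\<^sup>+y. ennreal ((V y)\<^sup>2) * ennreal (?k y) \<partial>?M)"
      using k0 by (intro nn_integral_cong) (simp add: ennreal_power ennreal_mult[symmetric] power_mult_distrib)
    finally show ?thesis by (simp add: ennreal_power)
  qed
  have km: "(\<lambda>p. ennreal (kern d e (A + s *\<^sub>R fst p - snd p))) \<in> borel_measurable (?M \<Otimes>\<^sub>M ?M)"
  proof -
    have "(\<lambda>p. A + s *\<^sub>R fst p - snd p) \<in> ?M \<Otimes>\<^sub>M ?M \<rightarrow>\<^sub>M ?M"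
    proof (rule measurable_into_Rn)
      fix i
      have "(\<lambda>p. coord A i + s * coord (fst p) i - coord (snd p) i) \<in> borel_measurable (?M \<Otimes>\<^sub>M ?M)"
        by (intro borel_measurable_add borel_measurable_diff borel_measurable_times borel_measurable_const
            measurable_compose[OF measurable_fst measurable_coord_Rn] measurable_compose[OF measurable_snd measurable_coord_Rn])
      then show "(\<lambda>p. coord (A + s *\<^sub>R fst p - snd p) i) \<in> borel_measurable (?M \<Otimes>\<^sub>M ?M)" by simp
    qed (use A in \<open>auto simp: space_pair_measure\<close>)
    from measurable_compose[OF measurable_compose[OF this kern_measurable[OF e]] measurable_ennreal] show ?thesis .
  qed
  have V2m: "(\<lambda>y. ennreal ((V y)\<^sup>2)) \<in> borel_measurable ?M"
    by (rule measurable_compose[OF borel_measurable_power[OF Vm] measurable_ennreal])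
  have pm: "(\<lambda>(x, y). ennreal ((V y)\<^sup>2) * ennreal (kern d e (A + s *\<^sub>R x - y))) \<in> borel_measurable (?M \<Otimes>\<^sub>M ?M)"
    using borel_measurable_times_ennreal[OF measurable_compose[OF measurable_snd V2m] km] by (simp add: split_beta)
  have Tm: "moll d A s e V \<in> borel_measurable ?M"
    by (rule continuous_on_imp_measurable_Rn[OF smooth_partial(1)[OF moll_smooth[OF e V]]])
  have T2m: "(\<lambda>x. ennreal ((moll d A s e V x)\<^sup>2)) \<in> borel_measurable ?M"
    by (rule measurable_compose[OF borel_measurable_power[OF Tm] measurable_ennreal])
  have "ennreal (s ^ d) * (\<integral>\<^sup>+x. ennreal ((moll d A s e V x)\<^sup>2) \<partial>?M) \<le>
     ennreal (s ^ d) * (\<integral>\<^sup>+x. \<integral>\<^sup>+y. ennreal ((V y)\<^sup>2) * ennreal (kern d e (A + s *\<^sub>R x - y)) \<partial>?M \<partial>?M)"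
    using pw by (intro mult_left_mono nn_integral_mono) auto
  also have "(\<integral>\<^sup>+x. \<integral>\<^sup>+y. ennreal ((V y)\<^sup>2) * ennreal (kern d e (A + s *\<^sub>R x - y)) \<partial>?M \<partial>?M) =
      (\<integral>\<^sup>+y. \<integral>\<^sup>+x. ennreal ((V y)\<^sup>2) * ennreal (kern d e (A + s *\<^sub>R x - y)) \<partial>?M \<partial>?M)"
    by (rule Fubini'[OF pm, symmetric])
  also have "ennreal (s ^ d) * \<dots> = (\<integral>\<^sup>+y. ennreal (s ^ d) * (\<integral>\<^sup>+x. ennreal ((V y)\<^sup>2) * ennreal (kern d e (A + s *\<^sub>R x - y)) \<partial>?M) \<partial>?M)"
  proof (rule nn_integral_cmult[symmetric])
    have "(\<lambda>(y, x). ennreal ((V y)\<^sup>2) * ennreal (kern d e (A + s *\<^sub>R x - y))) \<in> borel_measurable (?M \<Otimes>\<^sub>M ?M)"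
      using measurable_pair_swap[OF pm] by (simp add: split_beta)
    then show "(\<lambda>y. \<integral>\<^sup>+x. ennreal ((V y)\<^sup>2) * ennreal (kern d e (A + s *\<^sub>R x - y)) \<partial>?M) \<in> borel_measurable ?M"
      by (rule sigma_finite_measure.borel_measurable_nn_integral[OF sigma_finite_lborel_Rn])
  qed
  \<comment> \<open>As a function of the evaluation point the kernel has mass
    \<open>1 / s ^ d\<close>, which the prefactor cancels.\<close>
  also have "\<dots> = (\<integral>\<^sup>+y. ennreal ((V y)\<^sup>2) \<partial>?M)"
  proof (rule nn_integral_cong)
    fix y assume "y \<in> space ?M"
    then have y: "A - y \<in> Rn d" using A by simp
    have eq: "A + s *\<^sub>R x - y = (A - y) + s *\<^sub>R x" for x by simp
    have "(\<lambda>x. ennreal (kern d e ((A - y) + s *\<^sub>R x))) \<in> borel_measurable ?M"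
      by (rule measurable_compose[OF measurable_scale_Rn measurable_compose[OF measurable_translate_Rn[OF y]
            measurable_compose[OF kern_measurable[OF e] measurable_ennreal]]])
    then have "(\<integral>\<^sup>+x. ennreal ((V y)\<^sup>2) * ennreal (kern d e (A + s *\<^sub>R x - y)) \<partial>?M) =
        ennreal ((V y)\<^sup>2) * (\<integral>\<^sup>+x. ennreal (kern d e ((A - y) + s *\<^sub>R x)) \<partial>?M)"
      unfolding eq by (rule nn_integral_cmult)
    then show "ennreal (s ^ d) * (\<integral>\<^sup>+x. ennreal ((V y)\<^sup>2) * ennreal (kern d e (A + s *\<^sub>R x - y)) \<partial>?M) = ennreal ((V y)\<^sup>2)"
      using nn_integral_kern_affine[OF e _ y, of s] s by (simp add: mult.left_commute[of "ennreal (s ^ d)"])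
  qed
  also have "\<dots> = ennreal ((l2 ?M V)\<^sup>2)" by (rule ennreal_l2_sq[OF V2])
  finally have le: "ennreal (s ^ d) * (\<integral>\<^sup>+x. ennreal ((moll d A s e V x)\<^sup>2) \<partial>?M) \<le> ennreal ((l2 ?M V)\<^sup>2)" .
  \<comment> \<open>An infinite integral would stay infinite after multiplication by the positive
    factor \<open>s ^ d\<close>, against the bound just shown.\<close>
  have "(\<integral>\<^sup>+x. ennreal ((moll d A s e V x)\<^sup>2) \<partial>?M) < \<infinity>"
  proof (rule ccontr)
    assume "\<not> ?thesis"
    then have "(\<integral>\<^sup>+x. ennreal ((moll d A s e V x)\<^sup>2) \<partial>?M) = top" by (simp only: infinity_ennreal_def not_less top_unique)
    with le s show False by (simp add: ennreal_mult_top top_unique)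
  qed
  then show sq: "sq_int ?M (moll d A s e V)"
    unfolding sq_int_def integrable_iff_bounded using Tm T2m by (auto intro: borel_measurable_power)
  show "s ^ d * (l2 ?M (moll d A s e V))\<^sup>2 \<le> (l2 ?M V)\<^sup>2"
    using le s unfolding ennreal_l2_sq[OF sq] by (simp add: ennreal_mult[symmetric])
qed

context cone_simplex
begin

text \<open>With these parameters the cube of half-width \<open>en i\<close> about \<open>c + sn i *\<^sub>R (x - c)\<close> lies in \<open>\<tau>\<close> for
  every \<open>x \<in> \<tau>\<close>, so the mollifiers are test functions.\<close>

definition "sn (i::nat) = 1 - inverse (real (Suc (Suc i)))"
definition "en i = (1 - sn i) * r / (real d + 1)"
definition "An i = (1 - sn i) *\<^sub>R c"
definition "T i = moll d (An i) (sn i) (en i)"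

lemma sn: "1 / 2 \<le> sn i" "sn i < 1" "0 < sn i" 
  by (auto simp: sn_def field_simps)

lemma sn_tendsto: "sn \<longlonglongrightarrow> 1"
proof -
  have "(\<lambda>i. 1 - inverse (real (Suc (Suc i)))) \<longlonglongrightarrow> 1 - 0"
    by (intro tendsto_intros LIMSEQ_Suc[OF LIMSEQ_inverse_real_of_nat])
  then show ?thesis unfolding sn_def by simp
qed

lemma en: "en i > 0" unfolding en_def using sn[of i] r by (simp add: add_nonneg_pos)

lemma c_Rn: "c \<in> Rn d" using c\<tau> \<tau>_K K_Rn by auto
lemma An: "An i \<in> Rn d" unfolding An_def using c_Rn by simp

text \<open>\<open>y\<close> combines \<open>x\<close> with a point \<open>z\<close> of the ball
  around \<open>c\<close>, with weights \<open>sn i\<close> and \<open>1 - sn i\<close>, so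
  convexity of \<open>\<tau>\<close> applies. The denominator \<open>real d + 1\<close> in
  \<open>en\<close> compensates for bounding the norm on the cube by the sum of the
  coordinates.\<close>

lemma box_subset_\<tau>:
  assumes x: "x \<in> \<tau>" and y: "y \<in> Rn d" "\<And>j. j < d \<Longrightarrow> \<bar>coord (An i + sn i *\<^sub>R x - y) j\<bar> \<le> en i"
  shows "y \<in> \<tau>" "norm (An i + sn i *\<^sub>R x - y) < (1 - sn i) * r"
proof -
  let ?w = "An i + sn i *\<^sub>R x"
  have xR: "x \<in> Rn d" using x \<tau>_K K_Rn by auto
  have R: "?w - y \<in> Rn d" using An xR y by simp
  have "norm (?w - y) \<le> (\<Sum>j<d. \<bar>coord (?w - y) j\<bar>)" by (rule norm_le_sum_coord[OF R])
  also have "\<dots> \<le> (\<Sum>j<d. en i)" by (intro sum_mono) (use y in auto)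
  also have "\<dots> = real d * en i" by simp
  also have "\<dots> < (real d + 1) * en i" using en[of i] by simp
  also have "\<dots> = (1 - sn i) * r"
  proof -
    have "real d + 1 \<noteq> 0" by (simp add: add_nonneg_pos)
    then show ?thesis by (simp add: en_def)
  qed
  finally show lt: "norm (?w - y) < (1 - sn i) * r" .
  define z where "z = c + (1 / (1 - sn i)) *\<^sub>R (y - ?w)"
  have s1: "1 - sn i > 0" using sn[of i] by simp
  have "z - c = (1 / (1 - sn i)) *\<^sub>R (y - ?w)" by (simp add: z_def)
  then have "norm (z - c) = norm (?w - y) / (1 - sn i)" using s1 by (simp add: norm_minus_commute)
  also have "\<dots> < r" using lt s1 by (simp add: field_simps)
  finally have "z \<in> ball c r" by (simp add: dist_norm norm_minus_commute)
  moreover have "z \<in> Rn d" unfolding z_def using c_Rn An xR y by (intro Rn_closure) auto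
  ultimately have z\<tau>: "z \<in> \<tau>" using ball_\<tau> by blast
  have "(1 - sn i) *\<^sub>R z = (1 - sn i) *\<^sub>R c + (y - ?w)"
    using s1 by (simp add: z_def scaleR_add_right)
  then have "y = (1 - sn i) *\<^sub>R z + sn i *\<^sub>R x" by (simp add: An_def algebra_simps)
  then show "y \<in> \<tau>" using convexD[OF convex_\<tau> z\<tau> x, of "1 - sn i" "sn i"] s1 sn(3)[of i] by simp
qed

text \<open>\<open>K\<close> has finite measure, and on it
  \<open>\<bar>V x\<bar> \<le> 1 + (V x)\<^sup>2\<close>.\<close>

lemma integrable_of_sq_int:
  assumes V: "sq_int (lborel_Rn d) V" "\<And>x. x \<notin> \<tau> \<Longrightarrow> V x = 0"
  shows "integrable (lborel_Rn d) V"
proof (rule Bochner_Integration.integrable_bound)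
  have "integrable (lborel_Rn d) (indicator K :: fvec \<Rightarrow> real)"
    by (rule integrable_real_indicator[OF K_sets]) (rule emeasure_bounded_Rn[OF compact_imp_bounded[OF compact_K]])
  then show "integrable (lborel_Rn d) (\<lambda>x. indicator K x + (V x)\<^sup>2)"
    using V by (intro Bochner_Integration.integrable_add) (auto simp: sq_int_def)
  show "AE x in lborel_Rn d. norm (V x) \<le> norm (indicator K x + (V x)\<^sup>2)"
  proof (rule AE_I2)
    fix x
    have "\<bar>V x\<bar> \<le> 1 + (V x)\<^sup>2" using zero_le_power2[of "\<bar>V x\<bar> - 1"] by (simp add: power2_eq_square algebra_simps) 
    then show "norm (V x) \<le> norm (indicator K x + (V x)\<^sup>2)"
      using V(2)[of x] \<tau>_K by (cases "x \<in> \<tau>") (auto simp: indicator_def)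
  qed
qed (use V in \<open>simp add: sq_int_def\<close>)

text \<open>For \<open>x \<in> \<tau>\<close> the cube carrying the kernel lies in
  \<open>\<tau>\<close>, so the cutoff by the indicator is invisible, and \<open>T i\<close>
  averages \<open>g\<close> against a probability density whose support shrinks to
  \<open>x\<close>.\<close>

lemma T_continuous_pointwise:
  assumes g: "continuous_on UNIV g" "\<And>x. \<bar>g x\<bar> \<le> B" and x: "x \<in> \<tau>"
  shows "(\<lambda>i. T i (\<lambda>y. indicator \<tau> y * g y) x) \<longlonglongrightarrow> g x" "\<bar>T i (\<lambda>y. indicator \<tau> y * g y) x\<bar> \<le> B"
proof -
  let ?M = "lborel_Rn d"
  have xR: "x \<in> Rn d" using x \<tau>_K K_Rn by auto
  define w where "w i = An i + sn i *\<^sub>R x" for i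
  have w: "w i \<in> Rn d" for i unfolding w_def using An xR by simp
  have gR: "continuous_on (Rn d) g" using g(1) continuous_on_subset by blast
  have sq: "sq_int ?M (\<lambda>y. indicator \<tau> y * g y)" by (rule sq_int_indicator_\<tau>[OF gR])
  have int: "integrable ?M (\<lambda>y. indicator \<tau> y * g y)" by (rule integrable_of_sq_int[OF sq]) simp
  have ker\<tau>: "indicator \<tau> y * g y * kern d (en i) (w i - y) = g y * kern d (en i) (w i - y)"
    if "y \<in> Rn d" for y i
  proof (cases "kern d (en i) (w i - y) = 0")
    case False
    then have "\<bar>coord (w i - y) j\<bar> \<le> en i" if "j < d" for j
      using kern_nonzero_coord[OF en False that] by simp
    then have "y \<in> \<tau>" using box_subset_\<tau>(1)[OF x \<open>y \<in> Rn d\<close>] unfolding w_def by blast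
    then show ?thesis by simp
  qed simp
  have Teq: "T i (\<lambda>y. indicator \<tau> y * g y) x = (LINT y|?M. g y * kern d (en i) (w i - y))" for i
    unfolding T_def moll_eq w_def[symmetric] by (rule Bochner_Integration.integral_cong) (use ker\<tau> in auto)
  have intk: "integrable ?M (\<lambda>y. g y * kern d (en i) (w i - y))" for i
    using integrable_mult_kern[OF en int, of i "w i"] by (rule Bochner_Integration.integrable_cong[THEN iffD1, rotated -1]) (use ker\<tau> in auto)
  have kb: "\<bar>g y * kern d (en i) (w i - y)\<bar> \<le> B * kern d (en i) (w i - y)" for y i
    using g(2)[of y] kern_nonneg[OF en, of d i "w i - y"] by (simp add: abs_mult mult_right_mono)
  have "\<bar>T i (\<lambda>y. indicator \<tau> y * g y) x\<bar> \<le> (LINT y|?M. B * kern d (en i) (w i - y))"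
  proof -
    have "\<bar>LINT y|?M. g y * kern d (en i) (w i - y)\<bar> \<le> (LINT y|?M. B * kern d (en i) (w i - y))"
      by (rule abs_integral_le) (use intk kb integral_kern_reflect(1)[OF en w] in auto)
    then show ?thesis by (simp only: Teq)
  qed
  also have "\<dots> = B" using integral_kern_reflect(2)[OF en w] by simp
  finally show "\<bar>T i (\<lambda>y. indicator \<tau> y * g y) x\<bar> \<le> B" .
  show "(\<lambda>i. T i (\<lambda>y. indicator \<tau> y * g y) x) \<longlonglongrightarrow> g x"
  proof (rule LIMSEQ_I)
    fix e :: real assume e: "e > 0"
    obtain \<delta> where \<delta>: "\<delta> > 0" "\<And>y. dist y x < \<delta> \<Longrightarrow> dist (g y) (g x) < e / 2"
      using g(1) e unfolding continuous_on_iff by (metis UNIV_I half_gt_zero)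
    \<comment> \<open>This bounds the distance from \<open>x\<close> of every point seen by the
      kernel: one part comes from the cube, one from the displacement of its centre.\<close>
    have "(\<lambda>i. (1 - sn i) * (r + norm (c - x))) \<longlonglongrightarrow> (1 - 1) * (r + norm (c - x))"
      by (intro tendsto_intros sn_tendsto)
    then have "\<forall>\<^sub>F i in sequentially. (1 - sn i) * (r + norm (c - x)) < \<delta>"
      using \<delta>(1) by (intro order_tendstoD(2)[where y = "(1 - 1) * (r + norm (c - x))"]) auto
    then obtain N where N: "\<And>i. i \<ge> N \<Longrightarrow> (1 - sn i) * (r + norm (c - x)) < \<delta>"
      unfolding eventually_sequentially by blast
    have "norm (T i (\<lambda>y. indicator \<tau> y * g y) x - g x) < e" if i: "i \<ge> N" for i
    proof -
      have kb': "\<bar>(g y - g x) * kern d (en i) (w i - y)\<bar> \<le> e / 2 * kern d (en i) (w i - y)" if y: "y \<in> Rn d" for y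
      proof (cases "kern d (en i) (w i - y) = 0")
        case False
        have "\<bar>coord (w i - y) j\<bar> \<le> en i" if "j < d" for j
          using kern_nonzero_coord[OF en False that] by simp
        then have "norm (w i - y) < (1 - sn i) * r"
          using box_subset_\<tau>(2)[OF x y] unfolding w_def by blast
        moreover have "w i - x = (1 - sn i) *\<^sub>R (c - x)" by (simp add: w_def An_def algebra_simps)
        then have "norm (w i - x) = (1 - sn i) * norm (c - x)" using sn(2)[of i] by simp
        moreover have "norm (y - x) \<le> norm (w i - y) + norm (w i - x)"
          using norm_triangle_ineq[of "y - w i" "w i - x"] by (simp add: norm_minus_commute)
        ultimately have "norm (y - x) < (1 - sn i) * (r + norm (c - x))" by (simp add: distrib_left)
        also have "\<dots> < \<delta>" by (rule N[OF i])
        finally have "\<bar>g y - g x\<bar> < e / 2" using \<delta>(2)[of y] by (simp add: dist_norm)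
        then show ?thesis unfolding abs_mult abs_of_nonneg[OF kern_nonneg[OF en]]
          by (intro mult_right_mono kern_nonneg[OF en]) simp
      qed simp
      have "T i (\<lambda>y. indicator \<tau> y * g y) x - g x = (LINT y|?M. g y * kern d (en i) (w i - y)) - (LINT y|?M. g x * kern d (en i) (w i - y))"
        using integral_kern_reflect(2)[OF en w] by (simp add: Teq)
      also have "\<dots> = (LINT y|?M. (g y - g x) * kern d (en i) (w i - y))"
        unfolding left_diff_distrib
        by (rule Bochner_Integration.integral_diff[symmetric]) (use intk integral_kern_reflect(1)[OF en w] in auto)
      also have "\<bar>\<dots>\<bar> \<le> (LINT y|?M. e / 2 * kern d (en i) (w i - y))"
      proof (rule abs_integral_le)
        show "integrable ?M (\<lambda>y. (g y - g x) * kern d (en i) (w i - y))"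
          unfolding left_diff_distrib
          by (rule Bochner_Integration.integrable_diff) (use intk integral_kern_reflect(1)[OF en w] in auto)
      qed (use kb' integral_kern_reflect(1)[OF en w] in auto)
      also have "\<dots> = e / 2" using integral_kern_reflect(2)[OF en w] by simp
      finally show ?thesis using e by (simp only: real_norm_def)
    qed
    then show "\<exists>N. \<forall>i\<ge>N. norm (T i (\<lambda>y. indicator \<tau> y * g y) x - g x) < e" by blast
  qed
qed

text \<open>Restricting Lebesgue measure to \<open>\<tau>\<close> gives a finite Borel measure on a
  subspace, the setting in which \<open>cont_approx_sq_int\<close> provides bounded continuous
  approximants.\<close>

lemma approx_continuous:
  assumes V: "sq_int (lborel_Rn d) V" "\<And>x. x \<notin> \<tau> \<Longrightarrow> V x = 0" and e: "e > 0"
  shows "\<exists>g. continuous_on UNIV g \<and> bounded (range g) \<and> l2 (lborel_Rn d) (\<lambda>x. V x - indicator \<tau> x * g x) < e"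
proof -
  let ?M = "lborel_Rn d"
  define N where "N = restrict_space ?M \<tau>"
  have \<tau>s: "\<tau> \<inter> space ?M \<in> sets ?M" using \<tau>_sets sets.sets_into_space[OF \<tau>_sets] by (simp add: Int_absorb2)
  have \<tau>R: "\<tau> \<subseteq> Rn d" using \<tau>_K K_Rn by auto
  have sets: "sets N = sets (restrict_space borel \<tau>)"
  proof -
    have "sets N = (\<inter>) \<tau> ` sets ?M" by (simp add: N_def sets_restrict_space)
    also have "\<dots> = (\<inter>) \<tau> ` (\<inter>) (Rn d) ` sets borel" by (simp add: sets_lborel_Rn sets_restrict_space)
    also have "\<dots> = (\<inter>) \<tau> ` sets borel"
      unfolding image_image Int_assoc[symmetric] using \<tau>R by (simp add: Int_absorb2)
    finally show ?thesis by (simp add: sets_restrict_space)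
  qed
  have "emeasure ?M \<tau> < \<infinity>"
    by (rule emeasure_bounded_Rn[OF bounded_subset[OF compact_imp_bounded[OF compact_K] \<tau>_K]])
  then have fin: "finite_measure N"
    unfolding N_def using \<tau>_sets \<tau>R by (intro finite_measureI) (simp add: emeasure_restrict_space \<tau>s space_restrict_space Int_absorb2)
  have l2N: "l2 N f = l2 ?M (\<lambda>x. indicator \<tau> x * f x)" for f
    unfolding l2_def N_def integral_restrict_space[OF \<tau>s]
    by (intro arg_cong[where f = sqrt] Bochner_Integration.integral_cong) (auto simp: indicator_def)
  have sqN: "sq_int N V"
  proof -
    have "integrable N (\<lambda>x. (V x)\<^sup>2)"
    proof -
      have "(\<lambda>x. indicator \<tau> x *\<^sub>R (V x)\<^sup>2) = (\<lambda>x. (V x)\<^sup>2)"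
        using V(2) by (auto simp: indicator_def fun_eq_iff)
      then show ?thesis using V(1) unfolding N_def integrable_restrict_space[OF \<tau>s] by (simp add: sq_int_def)
    qed
    moreover have "V \<in> borel_measurable N"
      unfolding N_def by (rule measurable_restrict_space1) (use V in \<open>simp add: sq_int_def\<close>)
    ultimately show ?thesis by (simp add: sq_int_def)
  qed
  from cont_approx_sq_int[OF fin sets sqN] e obtain g where
    g: "continuous_on UNIV g" "bounded (range g)" "l2 N (\<lambda>x. V x - g x) < e"
    unfolding cont_approx_def by blast
  have "indicator \<tau> x * (V x - g x) = V x - indicator \<tau> x * g x" for x
    using V(2)[of x] by (auto simp: indicator_def)
  then show ?thesis using g unfolding l2N by auto
qed

text \<open>The operators \<open>T i\<close> are bounded uniformly in \<open>i\<close> from L^2 to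
  L^2 and converge on cut-off bounded continuous functions, which are dense.\<close>

lemma T_tendsto:
  assumes V: "sq_int (lborel_Rn d) V" "\<And>x. x \<notin> \<tau> \<Longrightarrow> V x = 0"
  shows "(\<lambda>i. l2 (lborel_Rn d) (\<lambda>x. indicator \<tau> x * (T i V x - V x))) \<longlonglongrightarrow> 0"
proof (rule LIMSEQ_I)
  fix e :: real assume e: "e > 0"
  let ?M = "lborel_Rn d"
  \<comment> \<open>By \<open>moll_l2\<close> the operator norm is at most \<open>sn i\<close> to
    the power -d/2, and \<open>sn i \<ge> 1 / 2\<close> bounds this by \<open>C\<close>.\<close>
  define C where "C = sqrt (2 ^ d)"
  have C: "C \<ge> 1" by (simp add: C_def)
  obtain g where g: "continuous_on UNIV g" "bounded (range g)" "l2 ?M (\<lambda>x. V x - indicator \<tau> x * g x) < e / (4 * C)"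
    using approx_continuous[OF V, of "e / (4 * C)"] e C by auto
  from g(2) obtain B where B: "\<And>x. \<bar>g x\<bar> \<le> B" by (auto simp: bounded_iff)
  have gR: "continuous_on (Rn d) g" using g(1) continuous_on_subset by blast
  define W where "W x = indicator \<tau> x * g x" for x
  have W: "sq_int ?M W" unfolding W_def by (rule sq_int_indicator_\<tau>[OF gR])
  have Wi: "integrable ?M W" by (rule integrable_of_sq_int[OF W]) (simp add: W_def)
  have Vi: "integrable ?M V" by (rule integrable_of_sq_int[OF V])
  have sqT: "sq_int ?M (\<lambda>x. indicator \<tau> x * T i U x)" if "integrable ?M U" for i U
    unfolding T_def by (rule sq_int_indicator_\<tau>[OF smooth_partial(1)[OF moll_smooth[OF en that]]])
  have d1: "l2 ?M (\<lambda>x. indicator \<tau> x * (T i V x - T i W x)) \<le> C * l2 ?M (\<lambda>x. V x - W x)" for i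
  proof -
    let ?U = "\<lambda>x. V x - W x"
    have U: "sq_int ?M ?U" "integrable ?M ?U" using V W Vi Wi by (auto intro: sq_int_diff)
    have TU: "T i V x - T i W x = T i ?U x" for x
      unfolding T_def by (rule moll_diff[OF en Vi Wi, symmetric])
    note b = moll_l2[OF en U(2) U(1) sn(3) An, of i i i]
    have "(l2 ?M (\<lambda>x. indicator \<tau> x * T i ?U x))\<^sup>2 \<le> (l2 ?M (T i ?U))\<^sup>2"
      unfolding l2_power2
    proof (rule integral_mono)
      show "integrable ?M (\<lambda>x. (indicator \<tau> x * T i ?U x)\<^sup>2)" using sqT[OF U(2)] by (simp add: sq_int_def)
      show "integrable ?M (\<lambda>x. (T i ?U x)\<^sup>2)" using b(1) by (simp add: sq_int_def T_def)
    qed (auto simp: indicator_def)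
    also have "\<dots> \<le> 2 ^ d * (sn i ^ d * (l2 ?M (T i ?U))\<^sup>2)"
    proof -
      have "1 \<le> (2 * sn i) ^ d" using sn(1)[of i] by (intro one_le_power) simp
      then have "1 * (l2 ?M (T i ?U))\<^sup>2 \<le> (2 * sn i) ^ d * (l2 ?M (T i ?U))\<^sup>2" by (intro mult_right_mono) auto
      then show ?thesis by (simp add: power_mult_distrib mult.assoc)
    qed
    also have "\<dots> \<le> 2 ^ d * (l2 ?M ?U)\<^sup>2" using b(2) unfolding T_def by (intro mult_left_mono) auto
    also have "\<dots> = (C * l2 ?M ?U)\<^sup>2" by (simp add: C_def power_mult_distrib)
    finally have "l2 ?M (\<lambda>x. indicator \<tau> x * T i ?U x) \<le> C * l2 ?M ?U"
      by (rule power2_le_imp_le) (use C in auto)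
    then show ?thesis by (simp add: TU)
  qed
  have "(\<lambda>i. l2 ?M (\<lambda>x. indicator \<tau> x * T i W x - W x)) \<longlonglongrightarrow> 0"
  proof (rule l2_dominated_convergence[where g = "\<lambda>x. indicator \<tau> x * (2 * B)"])
    show "sq_int ?M (\<lambda>x. indicator \<tau> x * (2 * B))" by (rule sq_int_indicator_\<tau>) (rule continuous_on_const)
    show "(\<lambda>x. indicator \<tau> x * T i W x) \<in> borel_measurable ?M" for i by (rule sq_int_measurable[OF sqT[OF Wi]])
    show "W \<in> borel_measurable ?M" by (rule sq_int_measurable[OF W])
    show "(\<lambda>i. indicator \<tau> x * T i W x) \<longlonglongrightarrow> W x" for x
      using T_continuous_pointwise(1)[OF g(1) B, of x] unfolding W_def by (cases "x \<in> \<tau>") auto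
    show "\<bar>indicator \<tau> x * T i W x - W x\<bar> \<le> indicator \<tau> x * (2 * B)" for i x
    proof (cases "x \<in> \<tau>")
      case True
      have "\<bar>T i W x\<bar> \<le> B" unfolding W_def by (rule T_continuous_pointwise(2)[OF g(1) B True])
      then show ?thesis using True B[of x] by (simp add: W_def)
    qed (simp add: W_def)
  qed
  from LIMSEQ_D[OF this, of "e / 4"] e obtain N where
    N: "\<And>i. i \<ge> N \<Longrightarrow> l2 ?M (\<lambda>x. indicator \<tau> x * T i W x - W x) < e / 4" by auto
  have "l2 ?M (\<lambda>x. indicator \<tau> x * (T i V x - V x)) < e" if i: "i \<ge> N" for i
  proof -
    have eq1: "indicator \<tau> x * (T i V x - V x) = indicator \<tau> x * T i V x - V x" for x
      using V(2)[of x] by (auto simp: indicator_def)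
    have "l2 ?M (\<lambda>x. indicator \<tau> x * T i V x - V x) \<le> l2 ?M (\<lambda>x. indicator \<tau> x * T i V x - indicator \<tau> x * T i W x)
       + l2 ?M (\<lambda>x. indicator \<tau> x * T i W x - V x)"
      by (rule l2_triangle_diff[OF sqT[OF Vi] sqT[OF Wi] V(1)])
    also have "l2 ?M (\<lambda>x. indicator \<tau> x * T i W x - V x) \<le> l2 ?M (\<lambda>x. indicator \<tau> x * T i W x - W x) + l2 ?M (\<lambda>x. W x - V x)"
      by (rule l2_triangle_diff[OF sqT[OF Wi] W V(1)])
    also have "l2 ?M (\<lambda>x. W x - V x) = l2 ?M (\<lambda>x. V x - W x)" by (rule l2_minus_commute)
    also have "l2 ?M (\<lambda>x. indicator \<tau> x * T i V x - indicator \<tau> x * T i W x) \<le> C * l2 ?M (\<lambda>x. V x - W x)"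
      using d1[of i] by (simp add: right_diff_distrib)
    finally have 1: "l2 ?M (\<lambda>x. indicator \<tau> x * T i V x - V x) \<le>
      C * l2 ?M (\<lambda>x. V x - W x) + (l2 ?M (\<lambda>x. indicator \<tau> x * T i W x - W x) + l2 ?M (\<lambda>x. V x - W x))" by simp
    have "C * l2 ?M (\<lambda>x. V x - W x) < C * (e / (4 * C))" using g(3) C unfolding W_def by (intro mult_strict_left_mono) auto
    also have "\<dots> = e / 4" using C by simp
    finally have 2: "C * l2 ?M (\<lambda>x. V x - W x) < e / 4" .
    have "1 * l2 ?M (\<lambda>x. V x - W x) \<le> C * l2 ?M (\<lambda>x. V x - W x)" using C by (intro mult_right_mono) auto
    then show ?thesis using 1 2 N[OF i] e unfolding eq1 by simp
  qed
  then show "\<exists>N. \<forall>i\<ge>N. norm (l2 ?M (\<lambda>x. indicator \<tau> x * (T i V x - V x)) - 0) < e" by auto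
qed

end


section \<open>Traces\<close>

lemma c1_smooth: "smooth d u \<Longrightarrow> c1 d u (\<lambda>i. partial i u)"
  using smooth_partial[of d u] by (simp add: c1_def)

text \<open>Measurability is available for the coordinates, and the norm is the root of the sum of
  their squares. The identity reduces convergence of gradients to convergence of components.\<close>

lemma sq_int_norm:
  assumes X: "\<And>x. X x \<in> Rn d" and f: "\<And>i. i < d \<Longrightarrow> sq_int N (\<lambda>x. indicator \<tau> x * coord (X x) i)"
  shows "sq_int N (\<lambda>x. indicator \<tau> x * norm (X x))"
    and "(l2 N (\<lambda>x. indicator \<tau> x * norm (X x)))\<^sup>2 = (\<Sum>i<d. (l2 N (\<lambda>x. indicator \<tau> x * coord (X x) i))\<^sup>2)"
proof -
  have eq: "(indicator \<tau> x * norm (X x))\<^sup>2 = (\<Sum>i<d. (indicator \<tau> x * coord (X x) i)\<^sup>2)" for x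
    by (simp add: norm_Rn[OF X] power_mult_distrib sum_nonneg sum_distrib_left)
  have i: "integrable N (\<lambda>x. (indicator \<tau> x * coord (X x) i)\<^sup>2)" if "i < d" for i
    using f[OF that] by (simp add: sq_int_def)
  have "(\<lambda>x. sqrt (\<Sum>i<d. (indicator \<tau> x * coord (X x) i)\<^sup>2)) \<in> borel_measurable N"
    using f by (intro measurable_compose[OF borel_measurable_sum borel_measurable_sqrt] borel_measurable_power sq_int_measurable) auto
  moreover have "(\<lambda>x. sqrt (\<Sum>i<d. (indicator \<tau> x * coord (X x) i)\<^sup>2)) = (\<lambda>x. indicator \<tau> x * norm (X x))"
    unfolding eq[symmetric] by (simp add: fun_eq_iff indicator_def)
  ultimately show "sq_int N (\<lambda>x. indicator \<tau> x * norm (X x))"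
    unfolding sq_int_def eq using i by (auto intro: Bochner_Integration.integrable_sum)
  show "(l2 N (\<lambda>x. indicator \<tau> x * norm (X x)))\<^sup>2 = (\<Sum>i<d. (l2 N (\<lambda>x. indicator \<tau> x * coord (X x) i))\<^sup>2)"
    unfolding l2_power2 eq using i by (intro Bochner_Integration.integral_sum) auto
qed

section \<open>Passing between a measure and its completion\<close>

lemma sq_int_completion: "f \<in> borel_measurable M \<Longrightarrow> sq_int (completion M) f \<longleftrightarrow> sq_int M f"
  unfolding sq_int_def by (simp add: integrable_completion measurable_completion)

lemma l2_completion: "f \<in> borel_measurable M \<Longrightarrow> l2 (completion M) f = l2 M f"
  unfolding l2_def by (simp add: integral_completion)

lemma l2_cong_AE:
  assumes "f \<in> borel_measurable M" "g \<in> borel_measurable M" "AE x in M. f x = g x"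
  shows "l2 M f = l2 M g"
  unfolding l2_def by (intro arg_cong[where f = sqrt] integral_cong_AE) (use assms in auto)

text \<open>A function measurable for the completion agrees almost everywhere with a Borel function;
  multiplying the latter by the indicator makes it vanish at every point off \<open>S\<close>.
  Mollification is applied to such representatives.\<close>

lemma sq_int_completion_rep:
  assumes f: "sq_int (completion M) (\<lambda>x. indicator S x * f x)" and S: "S \<in> sets M"
  shows "\<exists>V. sq_int M V \<and> (\<forall>x. x \<notin> S \<longrightarrow> V x = 0) \<and> (AE x in completion M. indicator S x * f x = V x)"
proof -
  from completion_ex_borel_measurable_real[OF sq_int_measurable[OF f]] obtain g where
    g: "g \<in> borel_measurable M" "AE x in M. indicator S x * f x = g x" by blast
  define V where "V x = indicator S x * g x" for x
  have Vm: "V \<in> borel_measurable M" unfolding V_def using g(1) S by auto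
  from AE_completion[OF g(2)] have ae: "AE x in completion M. indicator S x * f x = V x"
    by eventually_elim (auto simp: V_def indicator_def split: if_splits)
  have "integrable (completion M) (\<lambda>x. (V x)\<^sup>2) \<longleftrightarrow> integrable (completion M) (\<lambda>x. (indicator S x * f x)\<^sup>2)"
    using Vm f ae by (intro integrable_cong_AE) (auto simp: sq_int_def measurable_completion)
  then have "sq_int (completion M) V"
    using f Vm by (simp add: sq_int_def measurable_completion)
  then have "sq_int M V" using sq_int_completion[OF Vm] by simp
  moreover have "\<forall>x. x \<notin> S \<longrightarrow> V x = 0" by (simp add: V_def)
  ultimately show ?thesis using ae by blast
qed

text \<open>The kernel is differentiated in \<open>y\<close>, which enters with a minus sign; this
  sign meets the one in the definition of the weak gradient.\<close>

lemma partial_kern: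
  assumes e: "e > 0" and i: "i < d"
  shows "partial i (\<lambda>y. kern d e (w - y)) y = - (\<Prod>j<d. ((\<lambda>_. sbump e)(i := deriv (sbump e))) j (coord (w - y) j))"
proof -
  have sm: "smooth1 (sbump e)" using sbump(1)[OF e] by (simp add: smooth1c_def)
  have eq: "w - (y + t *\<^sub>R unit_vec i) = (w - y) + (- t) *\<^sub>R unit_vec i" for t by simp
  have "((\<lambda>t. kern d e ((w - y) + (- t) *\<^sub>R unit_vec i)) has_real_derivative
      (\<Prod>j<d. ((\<lambda>_. sbump e)(i := deriv (sbump e))) j (coord ((w - y) + (- 0) *\<^sub>R unit_vec i) j)) * (- 1)) (at 0)"
    unfolding kern_def
    by (rule DERIV_chain2[OF prod_coord_DERIV[where g = "\<lambda>_. sbump e"]]) (use sm i in \<open>auto intro!: derivative_eq_intros\<close>)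
  from DERIV_imp_deriv[OF this] show ?thesis unfolding partial_def eq by simp
qed

section \<open>Weak gradients and smooth approximation\<close>

lemma in_H1_weak_grad: "in_H1 d U v \<Longrightarrow> has_weak_grad d U v (weak_grad d U v)"
  using someI_ex[of "has_weak_grad d U v"] by (auto simp: in_H1_def weak_grad_def)

lemma in_H1_sq_int: "in_H1 d U v \<Longrightarrow> sq_int (completion (lborel_Rn d)) (\<lambda>x. indicator U x * v x)"
  by (simp add: in_H1_def in_L2_iff lebesgue_Rn_def)

lemma has_weak_grad_Rn: "has_weak_grad d U v G \<Longrightarrow> G x \<in> Rn d"
  by (simp add: has_weak_grad_def)

lemma has_weak_grad_sq_int:
  "has_weak_grad d U v G \<Longrightarrow> i < d \<Longrightarrow> sq_int (completion (lborel_Rn d)) (\<lambda>x. indicator U x * coord (G x) i)"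
  by (simp add: has_weak_grad_def in_L2_iff lebesgue_Rn_def)

context cone_simplex
begin

text \<open>The support lies in a compact box, and \<open>box_subset_\<tau>\<close> places that box
  inside \<open>\<tau>\<close>.\<close>

lemma test_function_kern:
  assumes x: "x \<in> \<tau>"
  shows "test_function d \<tau> (\<lambda>y. kern d (en l) (An l + sn l *\<^sub>R x - y))"
  unfolding test_function_def
proof
  let ?w = "An l + sn l *\<^sub>R x"
  have sm: "smooth1 (sbump (en l))" using sbump(1)[OF en] by (simp add: smooth1c_def)
  \<comment> \<open>Each factor is brought into the form \<open>c * f (a + b * t)\<close> with
    \<open>c = 1\<close> and \<open>b = -1\<close>, which \<open>smooth1_affine\<close>
    covers.\<close>
  have "smooth d (\<lambda>y. \<Prod>j<d. 1 * sbump (en l) (coord ?w j + (- 1) * coord y j))"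
    by (rule smooth_prod) (rule smooth1_affine[OF sm])
  then show "smooth d (\<lambda>y. kern d (en l) (?w - y))" by (simp add: kern_def)
  let ?K = "{y \<in> Rn d. \<forall>j<d. coord y j \<in> {coord ?w j - en l..coord ?w j + en l}}"
  show "\<exists>K. compact K \<and> K \<subseteq> \<tau> \<and> (\<forall>y\<in>Rn d - K. kern d (en l) (?w - y) = 0)"
  proof (intro exI[of _ ?K] conjI ballI)
    show "compact ?K" by (rule compact_box_Rn)
    show "?K \<subseteq> \<tau>"
    proof
      fix y assume y: "y \<in> ?K"
      show "y \<in> \<tau>"
      proof (rule box_subset_\<tau>(1)[OF x])
        show "y \<in> Rn d" using y by simp
        show "\<bar>coord (?w - y) j\<bar> \<le> en l" if "j < d" for j using y that by (auto simp: abs_le_iff)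
      qed
    qed
    fix y assume y: "y \<in> Rn d - ?K"
    show "kern d (en l) (?w - y) = 0"
    proof (rule ccontr)
      assume nz: "kern d (en l) (?w - y) \<noteq> 0"
      have "coord y j \<in> {coord ?w j - en l..coord ?w j + en l}" if "j < d" for j
        using kern_nonzero_coord[OF en nz that] by (auto simp: abs_less_iff)
      then have "y \<in> ?K" using y by blast
      with y show False by blast
    qed
  qed
qed

text \<open>The derivative falls on the kernel, which is a test function of \<open>y\<close>, and
  the weak identity moves it to \<open>W\<close>. The two minus signs cancel; the factor
  \<open>sn l\<close> is the inner derivative of the dilation.\<close>

lemma partial_T:
  assumes V: "sq_int (lborel_Rn d) V" "\<And>x. x \<notin> \<tau> \<Longrightarrow> V x = 0"
    and W: "sq_int (lborel_Rn d) W" "\<And>x. x \<notin> \<tau> \<Longrightarrow> W x = 0"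
    and weak: "\<And>\<phi>. test_function d \<tau> \<phi> \<Longrightarrow> (LINT y|lborel_Rn d. V y * partial i \<phi> y) = - (LINT y|lborel_Rn d. W y * \<phi> y)"
    and i: "i < d" and x: "x \<in> \<tau>"
  shows "partial i (T l V) x = sn l * T l W x"
proof -
  let ?g' = "(\<lambda>_::nat. sbump (en l))(i := deriv (sbump (en l)))" and ?w = "An l + sn l *\<^sub>R x"
  have Vi: "integrable (lborel_Rn d) V" by (rule integrable_of_sq_int[OF V])
  have "((\<lambda>t. T l V (x + t *\<^sub>R unit_vec i)) has_real_derivative sn l * mollify d V (An l) (sn l) ?g' x) (at 0)"
    unfolding T_def moll_def by (rule mollify_DERIV[OF Vi sbump(1)[OF en] i])
  then have 1: "partial i (T l V) x = sn l * mollify d V (An l) (sn l) ?g' x"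
    unfolding partial_def by (rule DERIV_imp_deriv)
  have "- mollify d V (An l) (sn l) ?g' x = (LINT y|lborel_Rn d. V y * partial i (\<lambda>y. kern d (en l) (?w - y)) y)"
    unfolding mollify_def partial_kern[OF en i] by simp
  also have "\<dots> = - (LINT y|lborel_Rn d. W y * kern d (en l) (?w - y))"
    by (rule weak[OF test_function_kern[OF x]])
  finally have "mollify d V (An l) (sn l) ?g' x = T l W x" unfolding T_def moll_eq by simp
  with 1 show ?thesis by simp
qed

text \<open>The gradient of a dilated function carries the factor \<open>sn l\<close>. As this
  factor tends to \<open>1\<close>, it costs at most \<open>1 - sn l\<close> times the norm of
  \<open>V\<close>.\<close>

lemma T_scaled_tendsto:
  assumes V: "sq_int (lborel_Rn d) V" "\<And>x. x \<notin> \<tau> \<Longrightarrow> V x = 0"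
  shows "(\<lambda>l. l2 (lborel_Rn d) (\<lambda>x. indicator \<tau> x * (sn l * T l V x - V x))) \<longlonglongrightarrow> 0"
proof (rule tendsto_sandwich[where f = "\<lambda>_. 0" and
      h = "\<lambda>l. sn l * l2 (lborel_Rn d) (\<lambda>x. indicator \<tau> x * (T l V x - V x)) + (1 - sn l) * l2 (lborel_Rn d) V"])
  let ?M = "lborel_Rn d"
  have Vi: "integrable ?M V" by (rule integrable_of_sq_int[OF V])
  have sq: "sq_int ?M (\<lambda>x. indicator \<tau> x * T l V x)" for l
    unfolding T_def by (rule sq_int_indicator_\<tau>[OF smooth_partial(1)[OF moll_smooth[OF en Vi]]])
  have iV: "indicator \<tau> x * V x = V x" for x using V(2)[of x] by (auto simp: indicator_def)
  have "l2 ?M (\<lambda>x. indicator \<tau> x * (sn l * T l V x - V x)) \<le>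
      sn l * l2 ?M (\<lambda>x. indicator \<tau> x * (T l V x - V x)) + (1 - sn l) * l2 ?M V" for l
  proof -
    have eq: "indicator \<tau> x * (sn l * T l V x - V x) = sn l * (indicator \<tau> x * (T l V x - V x)) + (sn l - 1) * V x" for x
      using V(2)[of x] by (cases "x \<in> \<tau>") (auto simp: algebra_simps)
    have "sq_int ?M (\<lambda>x. indicator \<tau> x * (T l V x - V x))"
      using sq_int_diff[OF sq V(1), of l] by (simp add: right_diff_distrib iV)
    then have "l2 ?M (\<lambda>x. sn l * (indicator \<tau> x * (T l V x - V x)) + (sn l - 1) * V x) \<le>
       l2 ?M (\<lambda>x. sn l * (indicator \<tau> x * (T l V x - V x))) + l2 ?M (\<lambda>x. (sn l - 1) * V x)"
      by (intro l2_triangle sq_int_cmult V)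
    then show ?thesis unfolding eq l2_cmult using sn[of l] by simp
  qed
  then show "\<forall>\<^sub>F l in sequentially. l2 ?M (\<lambda>x. indicator \<tau> x * (sn l * T l V x - V x)) \<le>
      sn l * l2 ?M (\<lambda>x. indicator \<tau> x * (T l V x - V x)) + (1 - sn l) * l2 ?M V" by simp
  have "(\<lambda>l. sn l * l2 ?M (\<lambda>x. indicator \<tau> x * (T l V x - V x)) + (1 - sn l) * l2 ?M V) \<longlonglongrightarrow> 1 * 0 + (1 - 1) * l2 ?M V"
    by (intro tendsto_intros sn_tendsto T_tendsto V)
  then show "(\<lambda>l. sn l * l2 ?M (\<lambda>x. indicator \<tau> x * (T l V x - V x)) + (1 - sn l) * l2 ?M V) \<longlonglongrightarrow> 0" by simp
qed auto

lemma smooth_in_L2: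
  assumes u: "smooth d u"
  shows "sq_int (completion (lborel_Rn d)) (\<lambda>x. indicator \<tau> x * u x)"
    and "l2 (completion (lborel_Rn d)) (\<lambda>x. indicator \<tau> x * u x) = l2 (lborel_Rn d) (\<lambda>x. indicator \<tau> x * u x)"
    and "i < d \<Longrightarrow> sq_int (completion (lborel_Rn d)) (\<lambda>x. indicator \<tau> x * partial i u x)"
    and "i < d \<Longrightarrow> l2 (completion (lborel_Rn d)) (\<lambda>x. indicator \<tau> x * partial i u x) = l2 (lborel_Rn d) (\<lambda>x. indicator \<tau> x * partial i u x)"
proof -
  note s1 = sq_int_indicator_\<tau>[OF smooth_partial(1)[OF u]] and s2 = sq_int_indicator_\<tau>[OF smooth_partial(2)[OF u]]
  show "sq_int (completion (lborel_Rn d)) (\<lambda>x. indicator \<tau> x * u x)"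
    using s1 sq_int_completion[OF sq_int_measurable[OF s1]] by simp
  show "l2 (completion (lborel_Rn d)) (\<lambda>x. indicator \<tau> x * u x) = l2 (lborel_Rn d) (\<lambda>x. indicator \<tau> x * u x)"
    by (rule l2_completion[OF sq_int_measurable[OF s1]])
  show "sq_int (completion (lborel_Rn d)) (\<lambda>x. indicator \<tau> x * partial i u x)" if i: "i < d"
    using s2[OF i] sq_int_completion[OF sq_int_measurable[OF s2[OF i]]] by simp
  show "l2 (completion (lborel_Rn d)) (\<lambda>x. indicator \<tau> x * partial i u x) = l2 (lborel_Rn d) (\<lambda>x. indicator \<tau> x * partial i u x)" if i: "i < d"
    by (rule l2_completion[OF sq_int_measurable[OF s2[OF i]]])
qed

lemma coord_grad: "i < d \<Longrightarrow> coord (grad d u x) i = partial i u x"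
  by (simp add: grad_def coord_sum if_distrib cong: if_cong)

lemma grad_Rn: "grad d u x \<in> Rn d"
  unfolding grad_def by (intro Rn_sum Rn_closure) auto

lemma S_in_L2:
  assumes u: "smooth d u"
  shows "sq_int (completion S) (\<lambda>x. indicator F x * u x)"
    and "l2 (completion S) (\<lambda>x. indicator F x * u x) = l2 S (\<lambda>x. indicator F x * u x)"
proof -
  note s = trace_S(1)[OF c1_smooth[OF u]]
  show "sq_int (completion S) (\<lambda>x. indicator F x * u x)"
    using s sq_int_completion[OF sq_int_measurable[OF s]] by simp
  show "l2 (completion S) (\<lambda>x. indicator F x * u x) = l2 S (\<lambda>x. indicator F x * u x)"
    by (rule l2_completion[OF sq_int_measurable[OF s]])
qed

text \<open>The squared estimate becomes linear through
  \<open>x\<^sup>2 + y\<^sup>2 \<le> (x + y)\<^sup>2\<close> for \<open>x * y \<ge> 0\<close>. In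
  the linear form, limits of norms can be taken term by term.\<close>

lemma trace_smooth:
  assumes u: "smooth d u"
  shows "L2_norm (surface_measure d F) F u \<le>
     sqrt (2 * real d / D) * L2_norm (lebesgue_Rn d) \<tau> u + sqrt (h\<^sup>2 / (real d * D)) * L2_norm (lebesgue_Rn d) \<tau> (\<lambda>x. norm (grad d u x))"
proof -
  let ?M = "lborel_Rn d"
  have d0: "real d > 0" using d by simp
  define \<alpha> where "\<alpha> = l2 ?M (\<lambda>x. indicator \<tau> x * u x)"
  define \<gamma> where "\<gamma> = L2_norm (lebesgue_Rn d) \<tau> (\<lambda>x. norm (grad d u x))"
  have \<alpha>0: "\<alpha> \<ge> 0" and \<gamma>0: "\<gamma> \<ge> 0" by (auto simp: \<alpha>_def \<gamma>_def L2_norm_eq)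
  have "\<gamma>\<^sup>2 = (\<Sum>i<d. (l2 ?M (\<lambda>x. indicator \<tau> x * partial i u x))\<^sup>2)"
    unfolding \<gamma>_def L2_norm_eq lebesgue_Rn_def
    by (subst sq_int_norm(2)[OF grad_Rn]) (auto simp: coord_grad smooth_in_L2[OF u])
  then have "(l2 S (\<lambda>x. indicator F x * u x))\<^sup>2 \<le> 2 * real d / D * \<alpha>\<^sup>2 + h\<^sup>2 / (real d * D) * \<gamma>\<^sup>2"
    using trace_S(2)[OF c1_smooth[OF u]] by (simp add: \<alpha>_def)
  also have "\<dots> = (sqrt (2 * real d / D) * \<alpha>)\<^sup>2 + (sqrt (h\<^sup>2 / (real d * D)) * \<gamma>)\<^sup>2"
    using D d0 by (simp add: power_mult_distrib)
  also have "\<dots> \<le> (sqrt (2 * real d / D) * \<alpha> + sqrt (h\<^sup>2 / (real d * D)) * \<gamma>)\<^sup>2"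
  proof -
    have "0 \<le> (sqrt (2 * real d / D) * \<alpha>) * (sqrt (h\<^sup>2 / (real d * D)) * \<gamma>)"
      using D d0 \<alpha>0 \<gamma>0 by (intro mult_nonneg_nonneg real_sqrt_ge_zero divide_nonneg_nonneg) auto
    moreover have "x\<^sup>2 + y\<^sup>2 \<le> (x + y)\<^sup>2" if "0 \<le> x * y" for x y :: real
      using that by (simp add: power2_sum)
    ultimately show ?thesis by blast
  qed
  finally have "l2 S (\<lambda>x. indicator F x * u x) \<le> sqrt (2 * real d / D) * \<alpha> + sqrt (h\<^sup>2 / (real d * D)) * \<gamma>"
    by (rule power2_le_imp_le) (use D d0 \<alpha>0 \<gamma>0 in \<open>intro add_nonneg_nonneg mult_nonneg_nonneg real_sqrt_ge_zero divide_nonneg_nonneg; simp\<close>)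
  then show ?thesis
    by (simp add: L2_norm_eq surface_measure_eq lebesgue_Rn_def S_in_L2(2)[OF u] smooth_in_L2(2)[OF u] \<alpha>_def \<gamma>_def)
qed

text \<open>The approximants are \<open>T l V\<close> for a Borel representative \<open>V\<close> of
  \<open>v\<close>. On \<open>\<tau>\<close> their partial derivatives are scaled mollifications of
  representatives of the weak derivatives, so both limits reduce to \<open>T_tendsto\<close> and its
  scaled version.\<close>

lemma ex_approximation:
  assumes v: "in_H1 d \<tau> v"
  shows "\<exists>u :: nat \<Rightarrow> fvec \<Rightarrow> real. (\<forall>k. smooth d (u k)) \<and>
        (\<lambda>k. L2_norm (lebesgue_Rn d) \<tau> (\<lambda>x. u k x - v x)) \<longlonglongrightarrow> 0 \<and>
        (\<lambda>k. L2_norm (lebesgue_Rn d) \<tau> (\<lambda>x. norm (grad d (u k) x - weak_grad d \<tau> v x))) \<longlonglongrightarrow> 0"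
proof -
  let ?M = "lborel_Rn d"
  define G where "G = weak_grad d \<tau> v"
  note wG = in_H1_weak_grad[OF v, folded G_def] and vs = in_H1_sq_int[OF v]
  note GR = has_weak_grad_Rn[OF wG] and Gs = has_weak_grad_sq_int[OF wG]
  from sq_int_completion_rep[OF vs \<tau>_sets] obtain V where
    V: "sq_int ?M V" "\<And>x. x \<notin> \<tau> \<Longrightarrow> V x = 0" "AE x in completion ?M. indicator \<tau> x * v x = V x" by blast
  have "\<forall>i. \<exists>W. i < d \<longrightarrow> sq_int ?M W \<and> (\<forall>x. x \<notin> \<tau> \<longrightarrow> W x = 0) \<and> (AE x in completion ?M. indicator \<tau> x * coord (G x) i = W x)"
    using sq_int_completion_rep[OF Gs \<tau>_sets] by blast
  then obtain W where W: "\<And>i. i < d \<Longrightarrow> sq_int ?M (W i)" "\<And>i x. i < d \<Longrightarrow> x \<notin> \<tau> \<Longrightarrow> W i x = 0"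
    "\<And>i. i < d \<Longrightarrow> AE x in completion ?M. indicator \<tau> x * coord (G x) i = W i x" by metis
  have Vi: "integrable ?M V" by (rule integrable_of_sq_int[OF V(1,2)])
  have sm: "smooth d (T l V)" for l unfolding T_def by (rule moll_smooth[OF en Vi])
  \<comment> \<open>The weak identity survives the exchange of \<open>v\<close> and \<open>G\<close>
    for their representatives, which alters the integrands only on null sets, and then the exchange
    of measures, because all factors are Borel measurable.\<close>
  have weak: "(LINT y|?M. V y * partial i \<phi> y) = - (LINT y|?M. W i y * \<phi> y)"
    if \<phi>: "test_function d \<tau> \<phi>" and i: "i < d" for \<phi> i
  proof -
    have sm\<phi>: "smooth d \<phi>" using \<phi> by (simp add: test_function_def)
    have m1: "\<phi> \<in> borel_measurable ?M" "partial i \<phi> \<in> borel_measurable ?M"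
      using continuous_on_imp_measurable_Rn smooth_partial(1,2)[OF sm\<phi>] i by auto
    have "(LINT y|?M. V y * partial i \<phi> y) = (LINT y|completion ?M. V y * partial i \<phi> y)"
      by (rule integral_completion[symmetric]) (rule borel_measurable_times[OF sq_int_measurable[OF V(1)] m1(2)])
    also have "\<dots> = (LINT y|completion ?M. (indicator \<tau> y * v y) * partial i \<phi> y)"
    proof (rule integral_cong_AE)
      show "AE y in completion ?M. V y * partial i \<phi> y = (indicator \<tau> y * v y) * partial i \<phi> y"
        using V(3) by eventually_elim simp
    qed (intro borel_measurable_times measurable_completion[OF sq_int_measurable[OF V(1)]] measurable_completion[OF m1(2)] sq_int_measurable[OF vs])+
    also have "\<dots> = (LINT y:\<tau>|lebesgue_Rn d. v y * partial i \<phi> y)"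
      by (simp add: set_lebesgue_integral_def lebesgue_Rn_def mult.assoc)
    also have "\<dots> = - (LINT y:\<tau>|lebesgue_Rn d. coord (G y) i * \<phi> y)"
      using wG \<phi> i by (simp add: has_weak_grad_def)
    also have "(LINT y:\<tau>|lebesgue_Rn d. coord (G y) i * \<phi> y) = (LINT y|completion ?M. (indicator \<tau> y * coord (G y) i) * \<phi> y)"
      by (simp add: set_lebesgue_integral_def lebesgue_Rn_def mult.assoc)
    also have "\<dots> = (LINT y|completion ?M. W i y * \<phi> y)"
    proof (rule integral_cong_AE)
      show "AE y in completion ?M. (indicator \<tau> y * coord (G y) i) * \<phi> y = W i y * \<phi> y"
        using W(3)[OF i] by eventually_elim simp
    qed (intro borel_measurable_times measurable_completion[OF sq_int_measurable[OF W(1)[OF i]]] measurable_completion[OF m1(1)] sq_int_measurable[OF Gs[OF i]])+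
    also have "\<dots> = (LINT y|?M. W i y * \<phi> y)"
      by (rule integral_completion) (rule borel_measurable_times[OF sq_int_measurable[OF W(1)[OF i]] m1(1)])
    finally show ?thesis .
  qed
  have pT: "partial i (T l V) x = sn l * T l (W i) x" if "i < d" "x \<in> \<tau>" for i l x
    by (rule partial_T[OF V(1,2) W(1,2)[OF that(1)] weak[OF _ that(1)] that])
  have conv0: "L2_norm (lebesgue_Rn d) \<tau> (\<lambda>x. T l V x - v x) = l2 ?M (\<lambda>x. indicator \<tau> x * (T l V x - V x))" for l
  proof -
    have s: "sq_int ?M (\<lambda>x. indicator \<tau> x * (T l V x - V x))"
    proof -
      have eq: "indicator \<tau> x * (T l V x - V x) = indicator \<tau> x * T l V x - V x" for x
        using V(2)[of x] by (auto simp: indicator_def)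
      show ?thesis
        unfolding eq by (rule sq_int_diff[OF sq_int_indicator_\<tau>[OF smooth_partial(1)[OF sm]] V(1)])
    qed
    have s2: "sq_int (completion ?M) (\<lambda>x. indicator \<tau> x * (T l V x - v x))"
      using sq_int_diff[OF smooth_in_L2(1)[OF sm] vs, of l] by (simp add: right_diff_distrib)
    have "l2 (completion ?M) (\<lambda>x. indicator \<tau> x * (T l V x - v x)) = l2 (completion ?M) (\<lambda>x. indicator \<tau> x * (T l V x - V x))"
    proof (rule l2_cong_AE[OF sq_int_measurable[OF s2] measurable_completion[OF sq_int_measurable[OF s]]])
      show "AE x in completion ?M. indicator \<tau> x * (T l V x - v x) = indicator \<tau> x * (T l V x - V x)"
        using V(3) by eventually_elim (auto simp: indicator_def)
    qed
    then show ?thesis by (simp add: L2_norm_eq lebesgue_Rn_def l2_completion[OF sq_int_measurable[OF s]])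
  qed
  have conv1: "(L2_norm (lebesgue_Rn d) \<tau> (\<lambda>x. norm (grad d (T l V) x - G x)))\<^sup>2 =
     (\<Sum>i<d. (l2 ?M (\<lambda>x. indicator \<tau> x * (sn l * T l (W i) x - W i x)))\<^sup>2)" for l
  proof -
    have s2: "sq_int (completion ?M) (\<lambda>x. indicator \<tau> x * (partial i (T l V) x - coord (G x) i))" if "i < d" for i
      using sq_int_diff[OF smooth_in_L2(3)[OF sm that] Gs[OF that]] by (simp add: right_diff_distrib)
    have eq: "l2 (completion ?M) (\<lambda>x. indicator \<tau> x * (partial i (T l V) x - coord (G x) i)) =
       l2 ?M (\<lambda>x. indicator \<tau> x * (sn l * T l (W i) x - W i x))" if i: "i < d" for i
    proof -
      have eq1: "indicator \<tau> x * (sn l * T l (W i) x - W i x) = indicator \<tau> x * partial i (T l V) x - W i x" for x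
        using pT[OF i, of x l] W(2)[OF i, of x] by (auto simp: indicator_def)
      have s: "sq_int ?M (\<lambda>x. indicator \<tau> x * (sn l * T l (W i) x - W i x))"
        unfolding eq1 by (rule sq_int_diff[OF sq_int_indicator_\<tau>[OF smooth_partial(2)[OF sm i]] W(1)[OF i]])
      have "l2 (completion ?M) (\<lambda>x. indicator \<tau> x * (partial i (T l V) x - coord (G x) i)) =
        l2 (completion ?M) (\<lambda>x. indicator \<tau> x * (sn l * T l (W i) x - W i x))"
      proof (rule l2_cong_AE[OF sq_int_measurable[OF s2[OF i]] measurable_completion[OF sq_int_measurable[OF s]]])
        show "AE x in completion ?M. indicator \<tau> x * (partial i (T l V) x - coord (G x) i) = indicator \<tau> x * (sn l * T l (W i) x - W i x)"
          using W(3)[OF i] unfolding eq1 by eventually_elim (simp add: right_diff_distrib)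
      qed
      then show ?thesis by (simp add: l2_completion[OF sq_int_measurable[OF s]])
    qed
    have "(l2 (completion ?M) (\<lambda>x. indicator \<tau> x * norm (grad d (T l V) x - G x)))\<^sup>2 =
       (\<Sum>i<d. (l2 (completion ?M) (\<lambda>x. indicator \<tau> x * coord (grad d (T l V) x - G x) i))\<^sup>2)"
      by (rule sq_int_norm(2)) (use grad_Rn GR s2 in \<open>auto simp: coord_grad\<close>)
    also have "\<dots> = (\<Sum>i<d. (l2 ?M (\<lambda>x. indicator \<tau> x * (sn l * T l (W i) x - W i x)))\<^sup>2)"
      by (intro sum.cong refl) (simp add: coord_grad eq)
    finally show ?thesis by (simp add: L2_norm_eq lebesgue_Rn_def)
  qed
  have "(\<lambda>l. sqrt (\<Sum>i<d. (l2 ?M (\<lambda>x. indicator \<tau> x * (sn l * T l (W i) x - W i x)))\<^sup>2)) \<longlonglongrightarrow> sqrt (\<Sum>i<d. 0\<^sup>2)"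
    by (intro tendsto_real_sqrt tendsto_sum tendsto_power T_scaled_tendsto W) auto
  moreover have "sqrt (\<Sum>i<d. (l2 ?M (\<lambda>x. indicator \<tau> x * (sn l * T l (W i) x - W i x)))\<^sup>2) = 
      L2_norm (lebesgue_Rn d) \<tau> (\<lambda>x. norm (grad d (T l V) x - G x))" for l
    unfolding conv1[symmetric] by (simp add: L2_norm_eq)
  ultimately have "(\<lambda>l. L2_norm (lebesgue_Rn d) \<tau> (\<lambda>x. norm (grad d (T l V) x - G x))) \<longlonglongrightarrow> 0" by simp
  moreover have "(\<lambda>l. L2_norm (lebesgue_Rn d) \<tau> (\<lambda>x. T l V x - v x)) \<longlonglongrightarrow> 0"
    unfolding conv0 by (rule T_tendsto[OF V(1,2)])
  ultimately show ?thesis using sm unfolding G_def by (intro exI[of _ "\<lambda>l. T l V"]) blast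
qed

text \<open>Two approximants differ at most by the sum of their distances to \<open>v\<close>, in
  the function and in each partial derivative. The squared bound on the facet transfers this to
  \<open>F\<close>, and completeness of L^2 supplies the limit.\<close>

lemma ex_trace:
  assumes v: "in_H1 d \<tau> v"
  shows "\<exists>w. is_trace d \<tau> F v w"
proof -
  let ?M = "lborel_Rn d" and ?C = "completion (lborel_Rn d)"
  have d0: "real d > 0" using d by simp
  define G where "G = weak_grad d \<tau> v"
  note wG = in_H1_weak_grad[OF v, folded G_def] and vs = in_H1_sq_int[OF v]
  note GR = has_weak_grad_Rn[OF wG] and Gs = has_weak_grad_sq_int[OF wG]
  from ex_approximation[OF v] obtain u where u: "\<And>k. smooth d (u k)"
    "(\<lambda>k. L2_norm (lebesgue_Rn d) \<tau> (\<lambda>x. u k x - v x)) \<longlonglongrightarrow> 0"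
    "(\<lambda>k. L2_norm (lebesgue_Rn d) \<tau> (\<lambda>x. norm (grad d (u k) x - G x))) \<longlonglongrightarrow> 0"
    unfolding G_def by blast
  define a0 where "a0 k = L2_norm (lebesgue_Rn d) \<tau> (\<lambda>x. u k x - v x)" for k
  define a1 where "a1 k = L2_norm (lebesgue_Rn d) \<tau> (\<lambda>x. norm (grad d (u k) x - G x))" for k
  have a0n: "a0 k \<ge> 0" and a1n: "a1 k \<ge> 0" for k by (auto simp: a0_def a1_def L2_norm_eq)
  have diff0: "l2 ?M (\<lambda>x. indicator \<tau> x * (u k x - u l x)) \<le> a0 k + a0 l" for k l
  proof -
    have "l2 ?C (\<lambda>x. indicator \<tau> x * u k x - indicator \<tau> x * u l x) \<le>
      l2 ?C (\<lambda>x. indicator \<tau> x * u k x - indicator \<tau> x * v x) + l2 ?C (\<lambda>x. indicator \<tau> x * v x - indicator \<tau> x * u l x)"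
      by (rule l2_triangle_diff[OF smooth_in_L2(1)[OF u(1)] vs smooth_in_L2(1)[OF u(1)]])
    also have "l2 ?C (\<lambda>x. indicator \<tau> x * v x - indicator \<tau> x * u l x) = l2 ?C (\<lambda>x. indicator \<tau> x * u l x - indicator \<tau> x * v x)"
      by (rule l2_minus_commute)
    finally have "l2 ?C (\<lambda>x. indicator \<tau> x * (u k x - u l x)) \<le> a0 k + a0 l"
      by (simp add: a0_def L2_norm_eq lebesgue_Rn_def right_diff_distrib)
    moreover have "(\<lambda>x. indicator \<tau> x * (u k x - u l x)) \<in> borel_measurable ?M"
      using sq_int_indicator_\<tau>[of "\<lambda>x. u k x - u l x"] smooth_partial(1)[OF u(1)]
      by (auto intro!: sq_int_measurable continuous_intros)
    ultimately show ?thesis by (simp add: l2_completion)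
  qed
  have diff1: "l2 ?M (\<lambda>x. indicator \<tau> x * (partial i (u k) x - partial i (u l) x)) \<le> a1 k + a1 l" if i: "i < d" for i k l
  proof -
    have le: "l2 ?C (\<lambda>x. indicator \<tau> x * partial i (u k) x - indicator \<tau> x * coord (G x) i) \<le> a1 k" for k
    proof -
      have s: "sq_int ?C (\<lambda>x. indicator \<tau> x * coord (grad d (u k) x - G x) j)" if "j < d" for j
        using sq_int_diff[OF smooth_in_L2(3)[OF u(1) that] Gs[OF that]] that by (simp add: right_diff_distrib coord_grad)
      have "(l2 ?C (\<lambda>x. indicator \<tau> x * coord (grad d (u k) x - G x) i))\<^sup>2 \<le>
         (\<Sum>i<d. (l2 ?C (\<lambda>x. indicator \<tau> x * coord (grad d (u k) x - G x) i))\<^sup>2)"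
        using i by (intro member_le_sum) auto
      also have "\<dots> = (a1 k)\<^sup>2"
        unfolding a1_def L2_norm_eq lebesgue_Rn_def
        by (rule sq_int_norm(2)[symmetric]) (use grad_Rn GR s in auto)
      finally have "l2 ?C (\<lambda>x. indicator \<tau> x * coord (grad d (u k) x - G x) i) \<le> a1 k"
        using a1n by (rule power2_le_imp_le)
      then show ?thesis using i by (simp add: right_diff_distrib coord_grad)
    qed
    have "l2 ?C (\<lambda>x. indicator \<tau> x * partial i (u k) x - indicator \<tau> x * partial i (u l) x) \<le>
      l2 ?C (\<lambda>x. indicator \<tau> x * partial i (u k) x - indicator \<tau> x * coord (G x) i) +
      l2 ?C (\<lambda>x. indicator \<tau> x * coord (G x) i - indicator \<tau> x * partial i (u l) x)"
      by (rule l2_triangle_diff[OF smooth_in_L2(3)[OF u(1) i] Gs[OF i] smooth_in_L2(3)[OF u(1) i]])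
    also have "l2 ?C (\<lambda>x. indicator \<tau> x * coord (G x) i - indicator \<tau> x * partial i (u l) x) =
        l2 ?C (\<lambda>x. indicator \<tau> x * partial i (u l) x - indicator \<tau> x * coord (G x) i)"
      by (rule l2_minus_commute)
    finally have "l2 ?C (\<lambda>x. indicator \<tau> x * (partial i (u k) x - partial i (u l) x)) \<le> a1 k + a1 l"
      using le[of k] le[of l] by (simp add: right_diff_distrib)
    moreover have "(\<lambda>x. indicator \<tau> x * (partial i (u k) x - partial i (u l) x)) \<in> borel_measurable ?M"
      using sq_int_indicator_\<tau>[of "\<lambda>x. partial i (u k) x - partial i (u l) x"] smooth_partial(2)[OF u(1) i]
      by (auto intro!: sq_int_measurable continuous_intros)
    ultimately show ?thesis by (simp add: l2_completion)
  qed
  define \<delta> where "\<delta> k l = 2 * real d / D * (a0 k + a0 l)\<^sup>2 + h\<^sup>2 / (real d * D) * (\<Sum>i<d. (a1 k + a1 l)\<^sup>2)" for k l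
  have trace_diff: "(l2 S (\<lambda>x. indicator F x * u k x - indicator F x * u l x))\<^sup>2 \<le> \<delta> k l" for k l
  proof -
    have "(l2 S (\<lambda>x. indicator F x * (u k x - u l x)))\<^sup>2 \<le>
       2 * real d / D * (l2 ?M (\<lambda>x. indicator \<tau> x * (u k x - u l x)))\<^sup>2
       + h\<^sup>2 / (real d * D) * (\<Sum>i<d. (l2 ?M (\<lambda>x. indicator \<tau> x * (partial i (u k) x - partial i (u l) x)))\<^sup>2)"
      by (rule trace_S(2)[OF c1_diff[OF c1_smooth[OF u(1)] c1_smooth[OF u(1)]]])
    also have "\<dots> \<le> \<delta> k l"
      unfolding \<delta>_def using diff0[of k l] diff1[of _ k l] D d0
      by (intro add_mono mult_left_mono sum_mono power_mono) auto
    finally show ?thesis by (simp add: right_diff_distrib)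
  qed
  have Fs: "sq_int S (\<lambda>x. indicator F x * u k x)" for k by (rule trace_S(1)[OF c1_smooth[OF u(1)]])
  have "\<exists>w. sq_int S w \<and> (\<lambda>k. l2 S (\<lambda>x. indicator F x * u k x - w x)) \<longlonglongrightarrow> 0"
  proof (rule l2_complete[OF Fs])
    fix e :: real assume e: "e > 0"
    \<comment> \<open>\<open>B - 1\<close> collects the coefficients of \<open>e'\<^sup>2\<close>
      when all approximation errors are below \<open>e'\<close>; the extra \<open>1\<close> makes
      \<open>B\<close> positive and the final estimate strict.\<close>
    define B where "B = 2 * real d / D * 4 + h\<^sup>2 / (real d * D) * (real d * 4) + 1"
    have B: "B > 0" unfolding B_def using D d0 by (intro add_nonneg_pos add_nonneg_nonneg mult_nonneg_nonneg divide_nonneg_nonneg) auto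
    define e' where "e' = e / sqrt B"
    have e': "e' > 0" using e B by (simp add: e'_def)
    have "\<forall>\<^sub>F k in sequentially. a0 k < e'" "\<forall>\<^sub>F k in sequentially. a1 k < e'"
      using order_tendstoD(2)[OF u(2) e'] order_tendstoD(2)[OF u(3) e'] by (simp_all add: a0_def a1_def)
    then have "\<forall>\<^sub>F k in sequentially. a0 k < e' \<and> a1 k < e'" by (rule eventually_conj)
    then obtain N where N: "\<And>k. k \<ge> N \<Longrightarrow> a0 k < e' \<and> a1 k < e'" unfolding eventually_sequentially by blast
    have "l2 S (\<lambda>x. indicator F x * u m x - indicator F x * u l x) < e" if ml: "m \<ge> N" "l \<ge> N" for m l
    proof -
      have a: "(a0 m + a0 l)\<^sup>2 \<le> 4 * e'\<^sup>2" "(a1 m + a1 l)\<^sup>2 \<le> 4 * e'\<^sup>2"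
      proof -
        have "(a0 m + a0 l)\<^sup>2 \<le> (2 * e')\<^sup>2" using N[OF ml(1)] N[OF ml(2)] a0n[of m] a0n[of l] by (intro power_mono) auto
        then show "(a0 m + a0 l)\<^sup>2 \<le> 4 * e'\<^sup>2" by (simp add: power_mult_distrib)
        have "(a1 m + a1 l)\<^sup>2 \<le> (2 * e')\<^sup>2" using N[OF ml(1)] N[OF ml(2)] a1n[of m] a1n[of l] by (intro power_mono) auto
        then show "(a1 m + a1 l)\<^sup>2 \<le> 4 * e'\<^sup>2" by (simp add: power_mult_distrib)
      qed
      have "\<delta> m l \<le> 2 * real d / D * (4 * e'\<^sup>2) + h\<^sup>2 / (real d * D) * (\<Sum>i<d. 4 * e'\<^sup>2)"
        unfolding \<delta>_def using a D d0 by (intro add_mono mult_left_mono sum_mono) auto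
      also have "\<dots> = (B - 1) * e'\<^sup>2" by (simp add: B_def algebra_simps)
      also have "\<dots> < B * e'\<^sup>2" using e' by simp
      also have "\<dots> = e\<^sup>2" using B by (simp add: e'_def power_divide)
      finally have "(l2 S (\<lambda>x. indicator F x * u m x - indicator F x * u l x))\<^sup>2 < e\<^sup>2" using trace_diff[of m l] by simp
      then show ?thesis using e by (rule power2_less_imp_less[OF _ less_imp_le])
    qed
    then show "\<exists>N. \<forall>m\<ge>N. \<forall>n\<ge>N. l2 S (\<lambda>x. indicator F x * u m x - indicator F x * u n x) < e" by blast
  qed
  then obtain w where w: "sq_int S w" "(\<lambda>k. l2 S (\<lambda>x. indicator F x * u k x - w x)) \<longlonglongrightarrow> 0" by blast
  have FwS: "sq_int S (\<lambda>x. indicator F x * w x)"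
  proof (rule sq_int_bound[OF w(1), where c = 1])
    show "(\<lambda>x. indicator F x * w x) \<in> borel_measurable S"
      by (rule borel_measurable_times[OF borel_measurable_indicator[OF F_sets] sq_int_measurable[OF w(1)]])
  qed (auto simp: indicator_def)
  \<comment> \<open>The limit \<open>w\<close> may be nonzero off \<open>F\<close>; inserting the
    indicator only decreases the distance.\<close>
  have lim: "(\<lambda>k. L2_norm (surface_measure d F) F (\<lambda>x. u k x - w x)) \<longlonglongrightarrow> 0"
  proof (rule tendsto_sandwich[OF _ _ tendsto_const w(2)])
    have "L2_norm (surface_measure d F) F (\<lambda>x. u k x - w x) \<le> l2 S (\<lambda>x. indicator F x * u k x - w x)" for k
    proof -
      have s: "sq_int S (\<lambda>x. indicator F x * (u k x - w x))"
        using sq_int_diff[OF Fs FwS] by (simp add: right_diff_distrib)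
      have "L2_norm (surface_measure d F) F (\<lambda>x. u k x - w x) = l2 S (\<lambda>x. indicator F x * (u k x - w x))"
        unfolding L2_norm_eq surface_measure_eq by (rule l2_completion[OF sq_int_measurable[OF s]])
      also have "\<dots> \<le> l2 S (\<lambda>x. indicator F x * u k x - w x)"
        unfolding l2_def
      proof (intro real_sqrt_le_mono integral_mono)
        show "integrable S (\<lambda>x. (indicator F x * (u k x - w x))\<^sup>2)" using s by (simp add: sq_int_def)
        show "integrable S (\<lambda>x. (indicator F x * u k x - w x)\<^sup>2)" using sq_int_diff[OF Fs w(1)] by (simp add: sq_int_def)
      qed (auto simp: indicator_def)
      finally show ?thesis .
    qed
    then show "\<forall>\<^sub>F k in sequentially. L2_norm (surface_measure d F) F (\<lambda>x. u k x - w x) \<le> l2 S (\<lambda>x. indicator F x * u k x - w x)" by simp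
  qed (simp add: L2_norm_eq)
  have "in_L2 (surface_measure d F) F w"
    unfolding in_L2_iff surface_measure_eq using FwS sq_int_completion[OF sq_int_measurable[OF FwS]] by simp
  with lim u show ?thesis unfolding is_trace_def G_def by blast
qed

text \<open>Pass to the limit in \<open>trace_smooth\<close> along the sequence that witnesses
  \<open>is_trace\<close>. The estimate covers every such \<open>w\<close>, hence the one selected
  by \<open>trace_on\<close>.\<close>

lemma trace_inequality:
  assumes v: "in_H1 d \<tau> v" and w: "is_trace d \<tau> F v w"
  shows "L2_norm (surface_measure d F) F w \<le> sqrt (2 * real d / D) * L2_norm (lebesgue_Rn d) \<tau> v + sqrt (h\<^sup>2 / (real d * D)) * H1_seminorm d \<tau> v"
proof -
  let ?C = "completion (lborel_Rn d)" and ?S = "surface_measure d F"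
  have d0: "real d > 0" using d by simp
  define G where "G = weak_grad d \<tau> v"
  note wG = in_H1_weak_grad[OF v, folded G_def] and vs = in_H1_sq_int[OF v]
  note GR = has_weak_grad_Rn[OF wG] and Gs = has_weak_grad_sq_int[OF wG]
  from w obtain u where ws: "sq_int ?S (\<lambda>x. indicator F x * w x)" and u: "\<And>k. smooth d (u k)"
    "(\<lambda>k. L2_norm (lebesgue_Rn d) \<tau> (\<lambda>x. u k x - v x)) \<longlonglongrightarrow> 0"
    "(\<lambda>k. L2_norm (lebesgue_Rn d) \<tau> (\<lambda>x. norm (grad d (u k) x - G x))) \<longlonglongrightarrow> 0"
    "(\<lambda>k. L2_norm ?S F (\<lambda>x. u k x - w x)) \<longlonglongrightarrow> 0"
    unfolding is_trace_def in_L2_iff G_def by blast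
  define p where "p = sqrt (2 * real d / D)"
  define q where "q = sqrt (h\<^sup>2 / (real d * D))"
  have p: "p \<ge> 0" and q: "q \<ge> 0" using D d0 by (auto simp: p_def q_def)
  define b0 where "b0 k = L2_norm (lebesgue_Rn d) \<tau> (\<lambda>x. u k x - v x)" for k
  define b1 where "b1 k = L2_norm (lebesgue_Rn d) \<tau> (\<lambda>x. norm (grad d (u k) x - G x))" for k
  define b2 where "b2 k = L2_norm ?S F (\<lambda>x. u k x - w x)" for k
  have le: "L2_norm ?S F w \<le> (p * (L2_norm (lebesgue_Rn d) \<tau> v + b0 k) + q * (H1_seminorm d \<tau> v + b1 k)) + b2 k" for k
  proof -
    have uF: "sq_int ?S (\<lambda>x. indicator F x * u k x)" unfolding surface_measure_eq by (rule S_in_L2(1)[OF u(1)])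
    have 1: "L2_norm ?S F w \<le> L2_norm ?S F (u k) + b2 k"
      using l2_le_add_diff[OF ws uF] l2_minus_commute[of ?S "\<lambda>x. indicator F x * w x" "\<lambda>x. indicator F x * u k x"]
      by (simp add: b2_def L2_norm_eq right_diff_distrib)
    have 2: "L2_norm (lebesgue_Rn d) \<tau> (u k) \<le> L2_norm (lebesgue_Rn d) \<tau> v + b0 k"
      using l2_le_add_diff[OF smooth_in_L2(1)[OF u(1)] vs, of k]
      by (simp add: b0_def L2_norm_eq right_diff_distrib lebesgue_Rn_def)
    have 3: "L2_norm (lebesgue_Rn d) \<tau> (\<lambda>x. norm (grad d (u k) x)) \<le> H1_seminorm d \<tau> v + b1 k"
    proof -
      have s1: "sq_int ?C (\<lambda>x. indicator \<tau> x * norm (grad d (u k) x))"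
        by (rule sq_int_norm(1)[OF grad_Rn]) (simp add: coord_grad smooth_in_L2(3)[OF u(1)])
      have s2: "sq_int ?C (\<lambda>x. indicator \<tau> x * norm (G x))" by (rule sq_int_norm(1)[OF GR Gs])
      have s3: "sq_int ?C (\<lambda>x. indicator \<tau> x * norm (grad d (u k) x - G x))"
      proof (rule sq_int_norm(1))
        show "grad d (u k) x - G x \<in> Rn d" for x using grad_Rn GR by simp
        show "sq_int ?C (\<lambda>x. indicator \<tau> x * coord (grad d (u k) x - G x) j)" if "j < d" for j
          using sq_int_diff[OF smooth_in_L2(3)[OF u(1) that] Gs[OF that]] that by (simp add: right_diff_distrib coord_grad)
      qed
      have "l2 ?C (\<lambda>x. indicator \<tau> x * norm (grad d (u k) x)) \<le>
         l2 ?C (\<lambda>x. indicator \<tau> x * norm (G x) + indicator \<tau> x * norm (grad d (u k) x - G x))"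
        unfolding l2_def
      proof (intro real_sqrt_le_mono integral_mono power_mono)
        show "integrable ?C (\<lambda>x. (indicator \<tau> x * norm (grad d (u k) x))\<^sup>2)" using s1 by (simp add: sq_int_def)
        show "integrable ?C (\<lambda>x. (indicator \<tau> x * norm (G x) + indicator \<tau> x * norm (grad d (u k) x - G x))\<^sup>2)"
          using sq_int_add[OF s2 s3] by (simp add: sq_int_def)
        show "indicator \<tau> x * norm (grad d (u k) x) \<le> indicator \<tau> x * norm (G x) + indicator \<tau> x * norm (grad d (u k) x - G x)" for x
          using norm_triangle_sub[of "grad d (u k) x" "G x"] by (simp add: indicator_def)
      qed auto
      also have "\<dots> \<le> l2 ?C (\<lambda>x. indicator \<tau> x * norm (G x)) + l2 ?C (\<lambda>x. indicator \<tau> x * norm (grad d (u k) x - G x))"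
        by (rule l2_triangle[OF s2 s3])
      finally show ?thesis by (simp add: H1_seminorm_def b1_def L2_norm_eq lebesgue_Rn_def G_def)
    qed
    have "L2_norm ?S F (u k) \<le> p * L2_norm (lebesgue_Rn d) \<tau> (u k) + q * L2_norm (lebesgue_Rn d) \<tau> (\<lambda>x. norm (grad d (u k) x))"
      unfolding p_def q_def by (rule trace_smooth[OF u(1)])
    also have "\<dots> \<le> p * (L2_norm (lebesgue_Rn d) \<tau> v + b0 k) + q * (H1_seminorm d \<tau> v + b1 k)"
      using 2 3 p q by (intro add_mono mult_left_mono)
    finally show ?thesis using 1 by simp
  qed
  have "(\<lambda>k. (p * (L2_norm (lebesgue_Rn d) \<tau> v + b0 k) + q * (H1_seminorm d \<tau> v + b1 k)) + b2 k) \<longlonglongrightarrow>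
     (p * (L2_norm (lebesgue_Rn d) \<tau> v + 0) + q * (H1_seminorm d \<tau> v + 0)) + 0"
    unfolding b0_def b1_def b2_def by (intro tendsto_intros u)
  from LIMSEQ_le_const[OF this] le have "L2_norm ?S F w \<le> (p * (L2_norm (lebesgue_Rn d) \<tau> v + 0) + q * (H1_seminorm d \<tau> v + 0)) + 0"
    by blast
  then show ?thesis by (simp add: p_def q_def)
qed

text \<open>With diameter zero, \<open>K\<close> would be the single point \<open>a\<close>; yet it
  contains a ball around \<open>c\<close>, and \<open>d \<ge> 1\<close> provides a direction to move
  in. Positivity is used when the estimate is divided by \<open>h\<close>.\<close>

lemma h_pos: "h > 0"
proof (rule ccontr)
  assume "\<not> h > 0"
  have "x = a" if "x \<in> K" for x
  proof -
    have "norm (x - a) \<le> 0" using diam[OF that] \<open>\<not> h > 0\<close> unfolding h_def by linarith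
    then show ?thesis by simp
  qed
  moreover have "c \<in> K" using c\<tau> \<tau>_K by auto
  moreover have "c + (r / 2) *\<^sub>R unit_vec 0 \<in> K"
  proof -
    have "c + (r / 2) *\<^sub>R unit_vec 0 \<in> ball c r \<inter> Rn d" using r d c_Rn by (auto simp: dist_norm)
    then show ?thesis using ball_\<tau> \<tau>_K by blast
  qed
  ultimately have "c + (r / 2) *\<^sub>R unit_vec 0 = c" by metis
  then have "unit_vec 0 = 0" using r by simp
  then have "norm (unit_vec 0) = 0" by (simp only: norm_zero)
  then show False by simp
qed

text \<open>Shape regularity gives \<open>1 / D \<le> \<rho> / h\<close>, since the height is at
  least the inradius. The coefficients are then at most sqrt 2 and 1 times the desired ones, and
  \<open>2\<close> bounds both.\<close>

lemma trace_inequality_shape_regular: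
  assumes v: "in_H1 d \<tau> v" and \<rho>: "\<rho> > 0" "diameter \<tau> \<le> \<rho> * inradius d \<tau>"
  shows "L2_norm (surface_measure d F) F (trace_on d \<tau> F v)
     \<le> 2 * (\<rho> powr (1/2) * real d powr (1/2) * diameter \<tau> powr (-1/2) * L2_norm (lebesgue_Rn d) \<tau> v
          + \<rho> powr (1/2) * real d powr (-1/2) * diameter \<tau> powr (1/2) * H1_seminorm d \<tau> v)"
proof -
  have d0: "real d > 0" using d by simp
  have tr: "is_trace d \<tau> F v (trace_on d \<tau> F v)"
    unfolding trace_on_def by (rule someI_ex[OF ex_trace[OF v]])
  have "h \<le> \<rho> * D" using \<rho> inradius_D unfolding h_def by (meson mult_left_mono less_imp_le order_trans)
  then have iD: "1 / D \<le> \<rho> / h" using h_pos D by (simp add: field_simps)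
  have n0: "L2_norm (lebesgue_Rn d) \<tau> v \<ge> 0" "H1_seminorm d \<tau> v \<ge> 0"
    by (auto simp: H1_seminorm_def L2_norm_eq)
  have pm: "x powr (-1/2) = 1 / sqrt x" if "x > 0" for x :: real
    using powr_minus_divide[of x "1/2"] powr_half_sqrt[of x] that by simp
  have 1: "sqrt (2 * real d / D) \<le> 2 * (\<rho> powr (1/2) * real d powr (1/2) * diameter \<tau> powr (-1/2))"
  proof -
    have "sqrt (2 * real d / D) \<le> sqrt (4 * (real d * (\<rho> / h)))"
    proof (rule real_sqrt_le_mono)
      have "2 * real d / D = 2 * (real d * (1 / D))" by simp
      also have "\<dots> \<le> 2 * (real d * (\<rho> / h))" using iD by (intro mult_left_mono) auto
      also have "\<dots> \<le> 4 * (real d * (\<rho> / h))" using \<rho>(1) h_pos by (intro mult_right_mono) auto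
      finally show "2 * real d / D \<le> 4 * (real d * (\<rho> / h))" .
    qed
    also have "\<dots> = 2 * (sqrt \<rho> * sqrt (real d) * (1 / sqrt h))" by (simp add: real_sqrt_mult real_sqrt_divide)
    finally show ?thesis using \<rho>(1) d0 h_pos unfolding h_def[symmetric] pm[OF h_pos] by (simp add: powr_half_sqrt)
  qed
  have 2: "sqrt (h\<^sup>2 / (real d * D)) \<le> 2 * (\<rho> powr (1/2) * real d powr (-1/2) * diameter \<tau> powr (1/2))"
  proof -
    have "sqrt (h\<^sup>2 / (real d * D)) \<le> sqrt (\<rho> * h / real d)"
    proof (rule real_sqrt_le_mono)
      have "h\<^sup>2 / real d * (1 / D) \<le> h\<^sup>2 / real d * (\<rho> / h)" using iD by (intro mult_left_mono) auto
      then show "h\<^sup>2 / (real d * D) \<le> \<rho> * h / real d" using h_pos by (simp add: power2_eq_square ac_simps)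
    qed
    also have "\<dots> = sqrt \<rho> * (1 / sqrt (real d)) * sqrt h" by (simp add: real_sqrt_mult real_sqrt_divide)
    also have "\<dots> \<le> 2 * (sqrt \<rho> * (1 / sqrt (real d)) * sqrt h)"
    proof -
      have "0 \<le> sqrt \<rho> * (1 / sqrt (real d)) * sqrt h"
        using \<rho>(1) h_pos by (intro mult_nonneg_nonneg) auto
      then show ?thesis by linarith
    qed
    finally show ?thesis using \<rho>(1) d0 h_pos unfolding h_def[symmetric] pm[OF d0] by (simp add: powr_half_sqrt)
  qed
  have "L2_norm (surface_measure d F) F (trace_on d \<tau> F v) \<le>
     sqrt (2 * real d / D) * L2_norm (lebesgue_Rn d) \<tau> v + sqrt (h\<^sup>2 / (real d * D)) * H1_seminorm d \<tau> v"
    by (rule trace_inequality[OF v tr])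
  also have "\<dots> \<le> 2 * (\<rho> powr (1/2) * real d powr (1/2) * diameter \<tau> powr (-1/2)) * L2_norm (lebesgue_Rn d) \<tau> v
      + 2 * (\<rho> powr (1/2) * real d powr (-1/2) * diameter \<tau> powr (1/2)) * H1_seminorm d \<tau> v"
    using 1 2 n0 by (intro add_mono mult_right_mono)
  finally show ?thesis by (simp add: distrib_left mult.assoc)
qed

end

theorem lemma4p5:
  shows "\<exists>C::real. C > 0 \<and>
    (\<forall>(d::nat) (\<Omega>::fvec set) (\<rho>::real) (\<T>::fvec set set).
       d \<ge> 1 \<and> bounded \<Omega> \<and> polyhedral_domain d \<Omega> \<and>
       triangulation_of d \<Omega> \<T> \<and> shape_regular d \<rho> \<T> \<longrightarrow>
       (\<forall>\<tau>\<in>\<T>. \<forall>F. simplex_facet d \<tau> F \<longrightarrow>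
          (\<forall>v. in_H1 d \<tau> v \<longrightarrow>
             L2_norm (surface_measure d F) F (trace_on d \<tau> F v)
             \<le> C * (\<rho> powr (1/2) * real d powr (1/2) * diameter \<tau> powr (-1/2)
                      * L2_norm (lebesgue_Rn d) \<tau> v
                    + \<rho> powr (1/2) * real d powr (-1/2) * diameter \<tau> powr (1/2)
                      * H1_seminorm d \<tau> v))))"
proof (rule exI[of _ 2], intro conjI allI impI ballI)
  fix d \<Omega> \<rho> \<T> \<tau> F v
  assume A: "d \<ge> 1 \<and> bounded \<Omega> \<and> polyhedral_domain d \<Omega> \<and> triangulation_of d \<Omega> \<T> \<and> shape_regular d \<rho> \<T>"
    and \<tau>: "\<tau> \<in> \<T>" and F: "simplex_facet d \<tau> F" and v: "in_H1 d \<tau> v"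
  from A \<tau> have "open_simplex d \<tau>" by (auto simp: triangulation_of_def)
  from ex_cone_simplex[OF this F] A obtain K H a n q c D r where "cone_simplex d \<tau> F K H a n q c D r" by blast
  then interpret cone_simplex d \<tau> F K H a n q c D r .
  show "L2_norm (surface_measure d F) F (trace_on d \<tau> F v)
     \<le> 2 * (\<rho> powr (1/2) * real d powr (1/2) * diameter \<tau> powr (-1/2) * L2_norm (lebesgue_Rn d) \<tau> v
          + \<rho> powr (1/2) * real d powr (-1/2) * diameter \<tau> powr (1/2) * H1_seminorm d \<tau> v)"
    using A \<tau> by (intro trace_inequality_shape_regular[OF v]) (auto simp: shape_regular_def)
qed simp

end
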